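(* Consider the Gaussian sequence model with $n\to\infty$, $s_n\to\infty$, $n/s_n\to\infty$. Let $a_b=\sqrt{2\log(n/s_n)}+b$ for an arbitrary real $b$ or a sequence $b=b_n\to\pm\infty$, and let $$\Theta_b'=\bigcup_{0\le s\le s_n}\{\theta\in\mathbb R^n:\ |S_\theta|=s,\ |\theta_i|\ge a_b\ \text{for all } i\in S_\theta\}.$$ Then the sharp asymptotic minimax risk for classification is $$\inf_\varphi\sup_{\theta\in\Theta_b'}E_\theta L_C(\theta,\varphi)/s_n=\overline\Phi(b)+o(1).$$ Moreover, for $\varphi=\varphi^{\hat\ell}$ the empirical Bayes $\ell$-value procedure (with any fixed threshold $t\in(0,1)$), or for $\varphi=\varphi^{BH}_\alpha$ the Benjamini–Hochberg procedure at a level $\alpha=\alpha_n=o(1)$ with $-\log\alpha=o((\log n)^{1/2})$ (in the latter case additionally assuming $s_n\lesssim n^c$ for some $c<1$), the bound is achieved: for any real $b$, or for $b=b_n\to\pm\infty$, $$\sup_{\theta\in\Theta_b'}E_\theta L_C(\theta,\varphi)/s_n=\overline\Phi(b)+o(1).$$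
   Context: Model: for each $n$, one observes $X_i=\theta_i+\varepsilon_i$, $1\le i\le n$, $\varepsilon_i$ i.i.d. $\mathcal N(0,1)$, $\theta\in\mathbb R^n$ deterministic; $P_\theta,E_\theta$ denote the law of $X$ and its expectation; $S_\theta=\{i:\theta_i\ne0\}$; $(s_n)$ integers. $\phi$ is the standard normal density and $\overline\Phi(x)=P(\mathcal N(0,1)>x)$, $\overline\Phi(+\infty)=0$, $\overline\Phi(-\infty)=1$. A multiple testing procedure is a measurable $\varphi:\mathbb R^n\to\{0,1\}^n$ (depending on $n$); the infimum is over all such procedures. Classification (Hamming) loss: $L_C(\theta,\varphi)=\sum_{i=1}^n(\mathbf 1\{\theta_i=0\}\mathbf 1\{\varphi_i\ne0\}+\mathbf 1\{\theta_i\ne0\}\mathbf 1\{\varphi_i=0\})$. $\ell$-value procedure: let $g(x)=(2\pi)^{-1/2}x^{-2}(1-e^{-x^2/2})$ (extended by continuity at $0$), $\beta(x)=g(x)/\phi(x)-1$, and let $\hat w$ be a maximiser over $w\in[1/n,1]$ of $\sum_{i=1}^n\log(1+w\beta(X_i))$. Put $\ell_{i,w}(X)=\frac{(1-w)\phi(X_i)}{(1-w)\phi(X_i)+w g(X_i)}$ and $\varphi^{\hat\ell}_i(X)=\mathbf 1\{\ell_{i,\hat w}(X)<t\}$. BH procedure at level $\alpha$: $\varphi^{BH}_{\alpha,i}(X)=\mathbf 1\{|X_i|\ge\hat t\}$, with $\hat t=\min\{t\in\mathbb R\cup\{+\infty\}:\ n^{-1}\sum_{i=1}^n\mathbf 1\{|X_i|\ge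 t\}\ge 2\overline\Phi(t)/\alpha\}$. *)

theory Defs
  imports "HOL-Probability.Probability" "HOL-Library.Landau_Symbols" "HOL-Real_Asymp.Real_Asymp"
begin

(* Vectors of R^n are the extensional functions on {1..n}, i.e. the points of the product
   space below. *)
definition seq_space :: "nat \<Rightarrow> (nat \<Rightarrow> real) measure" where
  "seq_space n = (\<Pi>\<^sub>M i\<in>{1..n}. borel)"

definition std_gauss :: "real measure" where
  "std_gauss = density lborel std_normal_density"

(* The law of X, where X i = \<theta> i + \<epsilon> i and the \<epsilon> i are i.i.d. N(0,1). *)
definition obs_law :: "nat \<Rightarrow> (nat \<Rightarrow> real) \<Rightarrow> (nat \<Rightarrow> real) measure" where
  "obs_law n \<theta> =
     distr (\<Pi>\<^sub>M i\<in>{1..n}. std_gauss) (seq_space n) (\<lambda>\<epsilon>. \<lambda>i\<in>{1..n}. \<theta> i + \<epsilon> i)"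

definition Phi_bar :: "ereal \<Rightarrow> real" where
  "Phi_bar x = measure std_gauss {y. x < ereal y}"

lemma prob_space_std_gauss: "prob_space std_gauss"
  unfolding std_gauss_def by (rule prob_space_normal_density) simp

lemma Phi_bar_PInf: "Phi_bar \<infinity> = 0"
  by (simp add: Phi_bar_def)

lemma Phi_bar_MInf: "Phi_bar (-\<infinity>) = 1"
  using prob_space.prob_space[OF prob_space_std_gauss]
  by (simp add: Phi_bar_def std_gauss_def)

definition signal_set :: "nat \<Rightarrow> (nat \<Rightarrow> real) \<Rightarrow> nat set" where
  "signal_set n \<theta> = {i \<in> {1..n}. \<theta> i \<noteq> 0}"

(* The argument s is the value s_n of the sparsity sequence. *)
definition signal_bound :: "nat \<Rightarrow> nat \<Rightarrow> real \<Rightarrow> real" where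
  "signal_bound n s b = sqrt (2 * ln (real n / real s)) + b"

definition Theta' :: "nat \<Rightarrow> nat \<Rightarrow> real \<Rightarrow> (nat \<Rightarrow> real) set" where
  "Theta' n s b =
     (\<Union>k\<in>{0..s}. {\<theta> \<in> {1..n} \<rightarrow>\<^sub>E UNIV.
        card (signal_set n \<theta>) = k \<and> (\<forall>i\<in>signal_set n \<theta>. \<bar>\<theta> i\<bar> \<ge> signal_bound n s b)})"

definition procedures :: "nat \<Rightarrow> ((nat \<Rightarrow> real) \<Rightarrow> (nat \<Rightarrow> nat)) set" where
  "procedures n = measurable (seq_space n) (\<Pi>\<^sub>M i\<in>{1..n}. count_space {0, 1})"

definition class_loss :: "nat \<Rightarrow> (nat \<Rightarrow> real) \<Rightarrow> (nat \<Rightarrow> nat) \<Rightarrow> real" where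
  "class_loss n \<theta> d =
     (\<Sum>i\<in>{1..n}. of_bool (\<theta> i = 0) * of_bool (d i \<noteq> 0) + of_bool (\<theta> i \<noteq> 0) * of_bool (d i = 0))"

definition class_risk :: "nat \<Rightarrow> (nat \<Rightarrow> real) \<Rightarrow> ((nat \<Rightarrow> real) \<Rightarrow> (nat \<Rightarrow> nat)) \<Rightarrow> real" where
  "class_risk n \<theta> \<phi> = (\<integral>x. class_loss n \<theta> (\<phi> x) \<partial>obs_law n \<theta>)"

definition sup_class_risk ::
    "nat \<Rightarrow> nat \<Rightarrow> real \<Rightarrow> ((nat \<Rightarrow> real) \<Rightarrow> (nat \<Rightarrow> nat)) \<Rightarrow> real" where
  "sup_class_risk n s b \<phi> = (SUP \<theta>\<in>Theta' n s b. class_risk n \<theta> \<phi> / real s)"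

definition slab_g :: "real \<Rightarrow> real" where
  "slab_g x =
     (if x = 0 then 1 / (2 * sqrt (2 * pi))
      else 1 / sqrt (2 * pi) * (1 - exp (- (x\<^sup>2) / 2)) / x\<^sup>2)"

lemma isCont_slab_g_0: "isCont slab_g 0"
proof -
  have "((\<lambda>x::real. (1 - exp (- (x\<^sup>2) / 2)) / x\<^sup>2) \<longlongrightarrow> 1 / 2) (at 0)"
    by real_asymp
  from tendsto_mult_left[OF this, of "1 / sqrt (2 * pi)"]
  have "((\<lambda>x::real. 1 / sqrt (2 * pi) * (1 - exp (- (x\<^sup>2) / 2)) / x\<^sup>2)
          \<longlongrightarrow> 1 / (2 * sqrt (2 * pi))) (at 0)"
    by (simp add: mult.commute)
  then have "(slab_g \<longlongrightarrow> 1 / (2 * sqrt (2 * pi))) (at 0)"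
    by (rule Lim_transform_eventually) (auto simp: slab_g_def eventually_at_filter)
  then show ?thesis
    by (simp add: isCont_def slab_g_def)
qed

definition slab_beta :: "real \<Rightarrow> real" where
  "slab_beta x = slab_g x / std_normal_density x - 1"

definition log_marginal :: "nat \<Rightarrow> (nat \<Rightarrow> real) \<Rightarrow> real \<Rightarrow> real" where
  "log_marginal n x w = (\<Sum>i\<in>{1..n}. ln (1 + w * slab_beta (x i)))"

(* A choice of a maximiser of the likelihood for every n and every data vector; the maximiser
   is unique unless slab_beta vanishes at all observations. *)
definition mml_weight :: "(nat \<Rightarrow> (nat \<Rightarrow> real) \<Rightarrow> real) \<Rightarrow> bool" where
  "mml_weight w \<longleftrightarrow>
     (\<forall>n\<ge>1. \<forall>x. is_arg_max (log_marginal n x) (\<lambda>v. v \<in> {1 / real n..1}) (w n x))"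

definition ell_value :: "real \<Rightarrow> real \<Rightarrow> real" where
  "ell_value w y =
     (1 - w) * std_normal_density y / ((1 - w) * std_normal_density y + w * slab_g y)"

definition ell_procedure ::
    "(nat \<Rightarrow> (nat \<Rightarrow> real) \<Rightarrow> real) \<Rightarrow> real \<Rightarrow> nat \<Rightarrow> (nat \<Rightarrow> real) \<Rightarrow> (nat \<Rightarrow> nat)" where
  "ell_procedure w t n x = (\<lambda>i\<in>{1..n}. of_bool (ell_value (w n x) (x i) < t))"

(* For 0 < \<alpha> < 1 the minimum exists. *)
definition BH_threshold :: "real \<Rightarrow> nat \<Rightarrow> (nat \<Rightarrow> real) \<Rightarrow> ereal" where
  "BH_threshold \<alpha> n x =
     (LEAST t. t \<noteq> -\<infinity> \<and>
        (\<Sum>i\<in>{1..n}. of_bool (ereal \<bar>x i\<bar> \<ge> t)) / real n \<ge> 2 * Phi_bar t / \<alpha>)"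

definition BH_procedure :: "real \<Rightarrow> nat \<Rightarrow> (nat \<Rightarrow> real) \<Rightarrow> (nat \<Rightarrow> nat)" where
  "BH_procedure \<alpha> n x = (\<lambda>i\<in>{1..n}. of_bool (ereal \<bar>x i\<bar> \<ge> BH_threshold \<alpha> n x))"

end

theory Submission
  imports Defs
begin

text \<open>
  Write $\tau = \sqrt{2\log(n/s_n)}$. For the lower bound take the prior under which coordinates are
  independently \<open>0\<close> or $a_b$, with signal probability slightly below $s_n/n$; coordinatewise the
  Bayes test cannot detect an observation below $\tau + o(1)$, which a signal of size
  $\tau + b$ misses with probability $\overline\Phi(b)$.

  For the upper bound it suffices that a procedure makes $o(s_n)$ false discoveries in expectation,
  uniformly over sparse means, and that it rejects everything above $\tau + \epsilon$ as soon as a fixed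
  fraction of $s_n$ observations lie there. The second property is deterministic. The first follows
  for Benjamini--Hochberg from a union bound over the number of false discoveries. For the
  empirical Bayes procedure, a null $X_i$ is rejected iff $\hat w$ exceeds a critical weight
  $w = \omega(X_i)$; by concavity of the log-likelihood this forces
  $\prod_j (1 + w\beta(X_j)) / (1 + w\beta(X_j)/2) \geq 1$, and each null factor has mean at most
  $\exp(-c\,w/\tau)$. The cases $b_n\to\pm\infty$ reduce to fixed \<open>b\<close> by monotonicity.
\<close>

text \<open>The parameter set contains every sparsity up to s_n, so there may be too few signals for
  an adaptive rule to calibrate itself. Such configurations are harmless: with at most Phi_bar(b)
  s_n signals, missing all of them costs no more than the target risk. Otherwise a fixed fraction of
  s_n observations clears tau + eps with probability close to 1; hence detection is only asked for
  under a count condition, and can then be deterministic. For empirical Bayes the maximiser depends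
  on all the data. Replacing it by the critical weight of the coordinate under test, a function of
  X_i alone, restores independence from the other coordinates. The likelihood is compared with that
  at half the weight because each factor is then at most 2, so the signal coordinates, whose size is
  unrestricted, cost at most 2^s_n. The null factors can pay for this at weights well above the
  order tau s_n/n. The cutoff tau^2 s_n/n satisfies this, and a null has a smaller critical weight
  only with probability o(s_n/n).\<close>

declare One_nat_def [simp del]

subsection \<open>Gaussian tails\<close>

lemma sets_std_gauss [measurable_cong, simp]: "sets std_gauss = sets borel"
  by (simp add: std_gauss_def)

lemma space_std_gauss [simp]: "space std_gauss = UNIV"
  by (simp add: std_gauss_def)

interpretation std_gauss: prob_space std_gauss
  by (rule prob_space_std_gauss)

lemma real_distribution_std_gauss: "real_distribution std_gauss"
  unfolding real_distribution_def real_distribution_axioms_def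
  using prob_space_std_gauss by simp

lemma nn_integral_std_gauss:
  "f \<in> borel_measurable borel \<Longrightarrow>
     (\<integral>\<^sup>+x. f x \<partial>std_gauss) = (\<integral>\<^sup>+x. ennreal (std_normal_density x) * f x \<partial>lborel)"
  unfolding std_gauss_def by (subst nn_integral_density) auto

lemma emeasure_std_gauss:
  "A \<in> sets borel \<Longrightarrow>
     emeasure std_gauss A = (\<integral>\<^sup>+x. ennreal (std_normal_density x) * indicator A x \<partial>lborel)"
  by (simp add: std_gauss_def emeasure_density)

lemma std_gauss_null: "A \<in> null_sets lborel \<Longrightarrow> A \<in> null_sets std_gauss"
  using AE_not_in[of A lborel] by (auto simp: std_gauss_def null_sets_density_iff)

lemma measure_std_gauss_singleton [simp]: "measure std_gauss {x} = 0"
  using std_gauss_null[of "{x}"] by (simp add: measure_def null_sets_def)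

lemma measure_std_gauss_reflect:
  assumes A: "A \<in> sets borel"
  shows "measure std_gauss {x. - x \<in> A} = measure std_gauss A"
proof -
  have [measurable]: "{x. - x \<in> A} \<in> sets borel"
    using measurable_sets[of uminus borel borel A] A by (simp add: vimage_def)
  have "emeasure std_gauss {x. - x \<in> A}
      = (\<integral>\<^sup>+x. ennreal (std_normal_density (- x)) * indicator A (- x) \<partial>lborel)"
    by (subst emeasure_std_gauss) (auto intro!: nn_integral_cong simp: std_normal_density_def indicator_def)
  also have "\<dots> = (\<integral>\<^sup>+x. ennreal (std_normal_density x) * indicator A x \<partial>lborel)"
    using nn_integral_real_affine[of "\<lambda>x. ennreal (std_normal_density x) * indicator A x" "-1" 0] A
    by simp
  also have "\<dots> = emeasure std_gauss A"
    using A by (simp add: emeasure_std_gauss)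
  finally show ?thesis by (simp add: measure_def)
qed

lemma Phi_bar_real: "Phi_bar (ereal x) = measure std_gauss {x<..}"
  by (simp add: Phi_bar_def greaterThan_def)

lemma Phi_bar_atLeast: "measure std_gauss {x..} = Phi_bar (ereal x)"
proof -
  have "measure std_gauss ({x} \<union> {x<..}) = measure std_gauss {x} + measure std_gauss {x<..}"
    by (rule std_gauss.finite_measure_Union) auto
  moreover have "{x} \<union> {x<..} = {x..}" by auto
  ultimately show ?thesis by (simp add: Phi_bar_real)
qed

lemma Phi_bar_lessThan: "measure std_gauss {..<x} = Phi_bar (ereal (- x))"
  using measure_std_gauss_reflect[of "{..<x}"]
  by (simp add: Phi_bar_real greaterThan_def minus_less_iff)

lemma Phi_bar_atMost: "measure std_gauss {..x} = Phi_bar (ereal (- x))"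
  using measure_std_gauss_reflect[of "{..x}"] Phi_bar_atLeast[of "- x"]
  by (simp add: atLeast_def minus_le_iff)

lemma Phi_bar_cdf: "Phi_bar (ereal x) = 1 - cdf std_gauss x"
  using std_gauss.prob_compl[of "{..x}"] by (simp add: Phi_bar_real cdf_def Compl_eq_Diff_UNIV[symmetric])

lemma Phi_bar_nonneg [simp]: "0 \<le> Phi_bar x"
  by (simp add: Phi_bar_def)

lemma Phi_bar_le_1 [simp]: "Phi_bar x \<le> 1"
  by (simp add: Phi_bar_def)

lemma Phi_bar_antimono: "x \<le> y \<Longrightarrow> Phi_bar y \<le> Phi_bar x"
  unfolding Phi_bar_def
  by (rule std_gauss.finite_measure_mono) (auto simp: )

lemma Phi_bar_reflect: "Phi_bar (ereal (- x)) = 1 - Phi_bar (ereal x)"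
  using Phi_bar_cdf[of x] Phi_bar_atMost[of x] by (simp add: cdf_def)

lemma isCont_Phi_bar: "isCont (\<lambda>x. Phi_bar (ereal x)) x"
proof -
  interpret real_distribution std_gauss by (rule real_distribution_std_gauss)
  show ?thesis unfolding Phi_bar_cdf using isCont_cdf[of x] by (intro continuous_intros) auto
qed

lemma borel_measurable_Phi_bar [measurable]: "(\<lambda>x. Phi_bar (ereal x)) \<in> borel_measurable borel"
  by (intro borel_measurable_continuous_onI continuous_at_imp_continuous_on ballI isCont_Phi_bar)

lemma Phi_bar_at_top: "((\<lambda>x. Phi_bar (ereal x)) \<longlongrightarrow> 0) at_top"
proof -
  interpret real_distribution std_gauss by (rule real_distribution_std_gauss)
  show ?thesis unfolding Phi_bar_cdf using tendsto_diff[OF tendsto_const[of 1] cdf_lim_at_top_prob] by simp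
qed

lemma Phi_bar_at_bot: "((\<lambda>x. Phi_bar (ereal x)) \<longlongrightarrow> 1) at_bot"
proof -
  interpret real_distribution std_gauss by (rule real_distribution_std_gauss)
  show ?thesis unfolding Phi_bar_cdf using tendsto_diff[OF tendsto_const[of 1] cdf_lim_at_bot] by simp
qed

text \<open>On the half-line above \<open>t\<close> the factor \<open>x / t\<close> is at least 1,
  and it turns the density into an exact derivative.\<close>

lemma Mills_upper:
  assumes "0 < t"
  shows "Phi_bar (ereal t) \<le> std_normal_density t / t"
proof -
  let ?F = "\<lambda>x::real. - std_normal_density x / t"
  have D: "DERIV ?F x :> std_normal_density x * (x / t)" for x
    unfolding std_normal_density_def using assms by (auto intro!: derivative_eq_intros)
  have L: "(?F \<longlongrightarrow> 0) at_top"
    unfolding std_normal_density_def using \<open>0 < t\<close> by real_asymp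
  have "emeasure std_gauss {t..} = (\<integral>\<^sup>+x. ennreal (std_normal_density x) * indicator {t..} x \<partial>lborel)"
    by (simp add: emeasure_std_gauss)
  also have "\<dots> \<le> (\<integral>\<^sup>+x. ennreal (std_normal_density x * (x / t)) * indicator {t..} x \<partial>lborel)"
  proof (rule nn_integral_mono)
    fix x
    have "std_normal_density x \<le> std_normal_density x * (x / t)" if "t \<le> x"
      using that \<open>0 < t\<close> mult_left_mono[of 1 "x / t" "std_normal_density x"] by simp
    then show "ennreal (std_normal_density x) * indicator {t..} x
        \<le> ennreal (std_normal_density x * (x / t)) * indicator {t..} x"
      by (auto simp: indicator_def intro!: ennreal_leI)
  qed
  also have "\<dots> = ennreal (0 - ?F t)"
    by (rule nn_integral_FTC_atLeast[OF _ D _ L]) (use \<open>0 < t\<close> in auto)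
  finally show ?thesis
    using \<open>0 < t\<close> by (simp add: Phi_bar_atLeast[symmetric] std_gauss.emeasure_eq_measure)
qed

lemma Phi_bar_le_exp:
  assumes "1 \<le> t"
  shows "Phi_bar (ereal t) \<le> exp (- t\<^sup>2 / 2)"
proof -
  have "1 \<le> sqrt (2 * pi)" using pi_gt3 by simp
  then have "1 / (sqrt (2 * pi) * t) \<le> 1"
    using assms mult_mono[of 1 "sqrt (2*pi)" 1 t] by simp
  then have "exp (- t\<^sup>2 / 2) * (1 / (sqrt (2 * pi) * t)) \<le> exp (- t\<^sup>2 / 2)"
    by (intro mult_right_le_one_le) (use assms in auto)
  then show ?thesis
    using Mills_upper[of t] assms by (simp add: std_normal_density_def mult.commute)
qed

text \<open>Only the side of the interval facing the mean is kept, which makes the bound a function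
  of \<open>\<bar>\<theta>\<bar>\<close> alone and decreasing in it: weaker signals are the worse
  case.\<close>

lemma gauss_shift_below:
  assumes "0 \<le> T"
  shows "measure std_gauss {e. \<bar>\<theta> + e\<bar> < T} \<le> Phi_bar (ereal (\<bar>\<theta>\<bar> - T))"
proof (cases "0 \<le> \<theta>")
  case True
  have "measure std_gauss {e. \<bar>\<theta> + e\<bar> < T} \<le> measure std_gauss {..<T - \<theta>}"
    by (rule std_gauss.finite_measure_mono) auto
  then show ?thesis using True by (simp add: Phi_bar_lessThan)
next
  case False
  have "measure std_gauss {e. \<bar>\<theta> + e\<bar> < T} \<le> measure std_gauss {- \<theta> - T<..}"
    by (rule std_gauss.finite_measure_mono) auto
  then show ?thesis using False by (simp add: Phi_bar_real)
qed

lemma gauss_shift_above: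
  assumes "0 \<le> T"
  shows "Phi_bar (ereal (T - \<bar>\<theta>\<bar>)) \<le> measure std_gauss {e. T \<le> \<bar>\<theta> + e\<bar>}"
proof -
  have "measure std_gauss {e. T \<le> \<bar>\<theta> + e\<bar>} = 1 - measure std_gauss {e. \<bar>\<theta> + e\<bar> < T}"
    using std_gauss.prob_compl[of "{e. \<bar>\<theta> + e\<bar> < T}"]
    by (auto simp: not_less Collect_neg_eq[symmetric] Compl_eq_Diff_UNIV[symmetric])
  with gauss_shift_below[OF assms, of \<theta>] show ?thesis
    using Phi_bar_reflect[of "\<bar>\<theta>\<bar> - T"] by simp
qed

lemma gauss_two_sided:
  assumes "0 < T"
  shows "measure std_gauss {e. T \<le> \<bar>e\<bar>} = 2 * Phi_bar (ereal T)"
proof -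
  have "measure std_gauss ({T..} \<union> {..-T}) = measure std_gauss {T..} + measure std_gauss {..-T}"
    by (rule std_gauss.finite_measure_Union) (use assms in auto)
  moreover have "{T..} \<union> {..-T} = {e. T \<le> \<bar>e\<bar>}" using assms by (auto simp: abs_if)
  ultimately show ?thesis by (simp add: Phi_bar_atLeast Phi_bar_atMost)
qed

lemma Phi_bar_strict_antimono:
  assumes "x < y"
  shows "Phi_bar (ereal y) < Phi_bar (ereal x)"
proof (rule ccontr)
  assume "\<not> Phi_bar (ereal y) < Phi_bar (ereal x)"
  moreover have "measure std_gauss ({x<..y} \<union> {y<..}) = measure std_gauss {x<..y} + measure std_gauss {y<..}"
    by (rule std_gauss.finite_measure_Union) auto
  moreover have "{x<..y} \<union> {y<..} = {x<..}" using assms by auto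
  ultimately have "measure std_gauss {x<..y} \<le> 0" by (simp add: Phi_bar_real)
  then have "emeasure std_gauss {x<..y} = 0"
    using measure_nonneg[of std_gauss "{x<..y}"]
    by (simp add: std_gauss.emeasure_eq_measure order_antisym_conv)
  then have "AE z in lborel. ennreal (std_normal_density z) * indicator {x<..y} z = 0"
    by (subst (asm) emeasure_std_gauss) (auto simp: nn_integral_0_iff_AE)
  then have "AE z in lborel. z \<notin> {x<..y}"
    by (rule eventually_mono) (auto simp: indicator_def ennreal_eq_0_iff not_le normal_density_pos
        simp flip: not_less split: if_splits)
  then have "emeasure lborel {x<..y} = 0"
    by (subst (asm) AE_iff_null) (auto simp: null_sets_def greaterThanAtMost_def greaterThan_def atMost_def Int_def)
  then show False using assms by simp
qed

lemma Phi_bar_pos: "0 < Phi_bar (ereal x)"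
  using Phi_bar_strict_antimono[of x "x + 1"] Phi_bar_nonneg[of "ereal (x + 1)"] by linarith

lemma Phi_bar_le_iff: "Phi_bar (ereal x) \<le> Phi_bar (ereal y) \<longleftrightarrow> y \<le> x"
proof (cases "y \<le> x")
  case True
  then show ?thesis using Phi_bar_antimono[of "ereal y" "ereal x"] by simp
next
  case False
  then show ?thesis using Phi_bar_strict_antimono[of x y] by simp
qed

lemma Phi_bar_0: "Phi_bar 0 = 1 / 2"
  using Phi_bar_reflect[of 0] by (simp add: zero_ereal_def)

lemma Phi_bar_surj:
  assumes "0 < q" "q < 1"
  obtains z where "Phi_bar (ereal z) = q"
proof -
  obtain a where a: "Phi_bar (ereal a) > q"
    using eventually_happens[OF order_tendstoD(1)[OF Phi_bar_at_bot assms(2)]] by auto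
  obtain c where c: "Phi_bar (ereal c) < q"
    using eventually_happens[OF order_tendstoD(2)[OF Phi_bar_at_top assms(1)]] by auto
  have "a \<le> c" using a c Phi_bar_le_iff[of c a] by linarith
  with a c show ?thesis
    using IVT2[of "\<lambda>x. Phi_bar (ereal x)" c q a] isCont_Phi_bar that by auto
qed

text \<open>The two-sided p-value of a null observation is uniform. The inequality form also covers
  levels \<open>q \<ge> 1\<close>, which occur when the level grows with a number of
  rejections.\<close>

lemma gauss_p_value:
  assumes "0 \<le> q"
  shows "measure std_gauss {e. 2 * Phi_bar (ereal \<bar>e\<bar>) \<le> q} \<le> q"
proof -
  consider "q = 0" | "1 \<le> q" | "0 < q" "q < 1" using assms by linarith
  then show ?thesis
  proof cases
    case 1
    then have "{e. 2 * Phi_bar (ereal \<bar>e\<bar>) \<le> q} = {}"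
      using Phi_bar_pos by (auto simp: not_le)
    then show ?thesis using 1 by simp
  next
    case 2
    then show ?thesis using std_gauss.prob_le_1 order_trans by blast
  next
    case 3
    then obtain z where z: "Phi_bar (ereal z) = q / 2" using Phi_bar_surj[of "q / 2"] by auto
    have "0 < z"
      using z 3 Phi_bar_0 Phi_bar_le_iff[of 0 z] by (simp add: zero_ereal_def not_le[symmetric])
    have "{e. 2 * Phi_bar (ereal \<bar>e\<bar>) \<le> q} = {e. z \<le> \<bar>e\<bar>}"
    proof (rule Collect_cong)
      fix e
      have "2 * Phi_bar (ereal \<bar>e\<bar>) \<le> q \<longleftrightarrow> Phi_bar (ereal \<bar>e\<bar>) \<le> Phi_bar (ereal z)"
        unfolding z by linarith
      then show "2 * Phi_bar (ereal \<bar>e\<bar>) \<le> q \<longleftrightarrow> z \<le> \<bar>e\<bar>"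
        by (simp only: Phi_bar_le_iff)
    qed
    then show ?thesis using gauss_two_sided[OF \<open>0 < z\<close>] z by simp
  qed
qed

subsection \<open>Observations, procedures and their risk\<close>

lemma measure_std_gauss_UNIV [simp]: "measure std_gauss UNIV = 1"
  using std_gauss.prob_space by simp

interpretation gauss_product: product_sigma_finite "\<lambda>_::nat. std_gauss"
  by unfold_locales

text \<open>One noise space carries all the laws \<open>obs_law n \<theta>\<close> at once, so that
  different parameters can be compared at the same noise vector.\<close>

definition noise :: "nat \<Rightarrow> (nat \<Rightarrow> real) measure" where
  "noise n = (\<Pi>\<^sub>M i\<in>{1..n}. std_gauss)"

definition observe :: "nat \<Rightarrow> (nat \<Rightarrow> real) \<Rightarrow> (nat \<Rightarrow> real) \<Rightarrow> (nat \<Rightarrow> real)" where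
  "observe n \<theta> e = (\<lambda>i\<in>{1..n}. \<theta> i + e i)"

lemma sets_noise [measurable_cong]: "sets (noise n) = sets (seq_space n)"
  unfolding noise_def seq_space_def by (rule sets_PiM_cong) auto

lemma space_seq_space [simp]: "space (seq_space n) = {1..n} \<rightarrow>\<^sub>E UNIV"
  by (simp add: seq_space_def space_PiM)

lemma space_noise [simp]: "space (noise n) = {1..n} \<rightarrow>\<^sub>E UNIV"
  by (simp add: noise_def space_PiM)

lemma prob_space_noise: "prob_space (noise n)"
  unfolding noise_def by (rule prob_space_PiM) (rule prob_space_std_gauss)

text \<open>Unconditional in \<open>i\<close>: outside \<open>{1..n}\<close> every point of the
  product space takes the value \<open>undefined\<close>, so measurability goals carry no index side
  condition.\<close>

lemma measurable_seq_component [measurable (raw)]: "(\<lambda>x. x i) \<in> borel_measurable (seq_space n)"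
proof (cases "i \<in> {1..n}")
  case True
  then show ?thesis unfolding seq_space_def by measurable
next
  case False
  then have "x i = undefined" if "x \<in> space (seq_space n)" for x
    using that by (auto simp: PiE_def extensional_def)
  then show ?thesis by (subst measurable_cong[where g = "\<lambda>_. undefined"]) auto
qed

lemma measurable_noise_component [measurable (raw)]: "(\<lambda>x. x i) \<in> borel_measurable (noise n)"
  using measurable_seq_component measurable_cong_sets[OF sets_noise refl] by blast

lemma measurable_observe [measurable]: "observe n \<theta> \<in> measurable (noise n) (seq_space n)"
  unfolding observe_def seq_space_def by (rule measurable_restrict) measurable

lemma obs_law_eq: "obs_law n \<theta> = distr (noise n) (seq_space n) (observe n \<theta>)"
  unfolding obs_law_def noise_def observe_def ..

lemma space_obs_law [simp]: "space (obs_law n \<theta>) = {1..n} \<rightarrow>\<^sub>E UNIV"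
  by (simp add: obs_law_eq)

lemma sets_obs_law [measurable_cong, simp]: "sets (obs_law n \<theta>) = sets (seq_space n)"
  by (simp add: obs_law_eq)

lemma prob_space_obs_law: "prob_space (obs_law n \<theta>)"
  unfolding obs_law_eq by (rule prob_space.prob_space_distr[OF prob_space_noise measurable_observe])

lemma observe_in_space [simp]: "observe n \<theta> e \<in> {1..n} \<rightarrow>\<^sub>E UNIV"
  by (auto simp: observe_def)

lemma observe_apply [simp]: "i \<in> {1..n} \<Longrightarrow> observe n \<theta> e i = \<theta> i + e i"
  by (simp add: observe_def)

lemma measure_obs_law:
  assumes "{x \<in> {1..n} \<rightarrow>\<^sub>E UNIV. P x} \<in> sets (seq_space n)"
  shows "measure (obs_law n \<theta>) {x \<in> {1..n} \<rightarrow>\<^sub>E UNIV. P x}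
       = measure (noise n) {e \<in> {1..n} \<rightarrow>\<^sub>E UNIV. P (observe n \<theta> e)}"
proof -
  have "observe n \<theta> -` {x \<in> {1..n} \<rightarrow>\<^sub>E UNIV. P x} \<inter> space (noise n)
      = {e \<in> {1..n} \<rightarrow>\<^sub>E UNIV. P (observe n \<theta> e)}"
    by (simp add: vimage_def Int_def conj_commute)
  then show ?thesis
    unfolding obs_law_eq by (simp only: measure_distr[OF measurable_observe assms])
qed

lemma measure_noise_component:
  assumes "i \<in> {1..n}" "A \<in> sets borel"
  shows "measure (noise n) {e \<in> {1..n} \<rightarrow>\<^sub>E UNIV. e i \<in> A} = measure std_gauss A"
proof -
  have "distr (noise n) std_gauss (\<lambda>e. e i) = std_gauss"
    unfolding noise_def using assms(1)
    by (intro distr_PiM_component) (auto intro: prob_space_std_gauss)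
  then have "measure std_gauss A = measure (distr (noise n) std_gauss (\<lambda>e. e i)) A" by simp
  also have "\<dots> = measure (noise n) ((\<lambda>e. e i) -` A \<inter> space (noise n))"
    by (rule measure_distr) (use assms in \<open>auto simp: noise_def\<close>)
  also have "(\<lambda>e. e i) -` A \<inter> space (noise n) = {e \<in> {1..n} \<rightarrow>\<^sub>E UNIV. e i \<in> A}" by auto
  finally show ?thesis ..
qed

text \<open>Factors missing from \<open>J\<close> are padded with 1. The index set \<open>I\<close>
  stays free because the formula is used both with all coordinates and with one removed.\<close>

lemma nn_integral_gauss_prod:
  fixes f :: "nat \<Rightarrow> real \<Rightarrow> ennreal"
  assumes "finite I" "J \<subseteq> I" "\<And>j. j \<in> J \<Longrightarrow> f j \<in> borel_measurable borel"
  shows "(\<integral>\<^sup>+e. (\<Prod>j\<in>J. f j (e j)) \<partial>(\<Pi>\<^sub>M i\<in>I. std_gauss)) = (\<Prod>j\<in>J. \<integral>\<^sup>+y. f j y \<partial>std_gauss)"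
proof -
  define g where "g j = (if j \<in> J then f j else (\<lambda>_. 1))" for j
  have "(\<integral>\<^sup>+e. (\<Prod>j\<in>J. f j (e j)) \<partial>(\<Pi>\<^sub>M i\<in>I. std_gauss)) = (\<integral>\<^sup>+e. (\<Prod>j\<in>I. g j (e j)) \<partial>(\<Pi>\<^sub>M i\<in>I. std_gauss))"
    by (intro nn_integral_cong prod.mono_neutral_cong_left) (use assms in \<open>auto simp: g_def\<close>)
  also have "\<dots> = (\<Prod>j\<in>I. \<integral>\<^sup>+y. g j y \<partial>std_gauss)"
    by (rule gauss_product.product_nn_integral_prod) (use assms in \<open>auto simp: g_def\<close>)
  also have "\<dots> = (\<Prod>j\<in>J. \<integral>\<^sup>+y. f j y \<partial>std_gauss)"
    by (intro prod.mono_neutral_cong_right) (use assms std_gauss.emeasure_space_1 in \<open>auto simp: g_def\<close>)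
  finally show ?thesis .
qed

section \<open>Rejection and acceptance probabilities; the risk as their sum\<close>

definition reject_prob :: "nat \<Rightarrow> (nat \<Rightarrow> real) \<Rightarrow> ((nat \<Rightarrow> real) \<Rightarrow> (nat \<Rightarrow> nat)) \<Rightarrow> nat \<Rightarrow> real" where
  "reject_prob n \<theta> \<phi> i = measure (obs_law n \<theta>) {x \<in> {1..n} \<rightarrow>\<^sub>E UNIV. \<phi> x i \<noteq> 0}"

definition accept_prob :: "nat \<Rightarrow> (nat \<Rightarrow> real) \<Rightarrow> ((nat \<Rightarrow> real) \<Rightarrow> (nat \<Rightarrow> nat)) \<Rightarrow> nat \<Rightarrow> real" where
  "accept_prob n \<theta> \<phi> i = measure (obs_law n \<theta>) {x \<in> {1..n} \<rightarrow>\<^sub>E UNIV. \<phi> x i = 0}"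

lemma accept_prob_nonneg [simp]: "0 \<le> accept_prob n \<theta> \<phi> i"
  by (simp add: accept_prob_def)

lemma accept_prob_le_1 [simp]: "accept_prob n \<theta> \<phi> i \<le> 1"
  using prob_space.prob_le_1[OF prob_space_obs_law] by (simp add: accept_prob_def)

lemma reject_prob_nonneg [simp]: "0 \<le> reject_prob n \<theta> \<phi> i"
  by (simp add: reject_prob_def)

lemma reject_prob_le_1 [simp]: "reject_prob n \<theta> \<phi> i \<le> 1"
  using prob_space.prob_le_1[OF prob_space_obs_law] by (simp add: reject_prob_def)

lemma measurable_procedure:
  assumes "\<phi> \<in> procedures n" "i \<in> {1..n}"
  shows "(\<lambda>x. \<phi> x i) \<in> measurable (seq_space n) (count_space UNIV)"
proof -
  have "(\<lambda>x. \<phi> x i) \<in> measurable (seq_space n) (count_space {0, 1})"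
    using measurable_compose[OF assms(1)[unfolded procedures_def] measurable_component_singleton[OF assms(2)]] .
  then show ?thesis
    by (rule measurable_compose) simp
qed

lemma sets_reject:
  assumes "\<phi> \<in> procedures n" "i \<in> {1..n}"
  shows "{x \<in> {1..n} \<rightarrow>\<^sub>E UNIV. \<phi> x i \<noteq> 0} \<in> sets (seq_space n)"
    and "{x \<in> {1..n} \<rightarrow>\<^sub>E UNIV. \<phi> x i = 0} \<in> sets (seq_space n)"
proof -
  note [measurable] = measurable_procedure[OF assms]
  have "{x \<in> space (seq_space n). \<phi> x i \<noteq> 0} \<in> sets (seq_space n)" by measurable
  then show "{x \<in> {1..n} \<rightarrow>\<^sub>E UNIV. \<phi> x i \<noteq> 0} \<in> sets (seq_space n)" by simp
  have "{x \<in> space (seq_space n). \<phi> x i = 0} \<in> sets (seq_space n)" by measurable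
  then show "{x \<in> {1..n} \<rightarrow>\<^sub>E UNIV. \<phi> x i = 0} \<in> sets (seq_space n)" by simp
qed

lemma finite_signal_set [simp]: "finite (signal_set n \<theta>)"
  by (simp add: signal_set_def)

lemma signal_set_subset: "signal_set n \<theta> \<subseteq> {1..n}"
  by (auto simp: signal_set_def)

lemma class_risk_eq:
  assumes "\<phi> \<in> procedures n"
  shows "class_risk n \<theta> \<phi> = (\<Sum>i\<in>{1..n} - signal_set n \<theta>. reject_prob n \<theta> \<phi> i)
                           + (\<Sum>i\<in>signal_set n \<theta>. accept_prob n \<theta> \<phi> i)"
proof -
  interpret prob_space "obs_law n \<theta>" by (rule prob_space_obs_law)
  let ?R = "\<lambda>i. {x \<in> {1..n} \<rightarrow>\<^sub>E UNIV. \<phi> x i \<noteq> 0}" and ?A = "\<lambda>i. {x \<in> {1..n} \<rightarrow>\<^sub>E UNIV. \<phi> x i = 0}"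
  note sets = sets_reject[OF assms]
  have "class_risk n \<theta> \<phi> = (\<integral>x. (\<Sum>i\<in>{1..n}. of_bool (\<theta> i = 0) * indicator (?R i) x
           + of_bool (\<theta> i \<noteq> 0) * indicator (?A i) x) \<partial>obs_law n \<theta>)"
    unfolding class_risk_def class_loss_def
    by (intro Bochner_Integration.integral_cong refl sum.cong) (auto simp: indicator_def)
  also have "\<dots> = (\<Sum>i\<in>{1..n}. \<integral>x. of_bool (\<theta> i = 0) * indicator (?R i) x
           + of_bool (\<theta> i \<noteq> 0) * indicator (?A i) x \<partial>obs_law n \<theta>)"
    by (rule Bochner_Integration.integral_sum)
       (intro Bochner_Integration.integrable_add integrable_mult_right
          integrable_real_indicator; simp add: emeasure_eq_measure sets del: neq0_conv)
  also have "\<dots> = (\<Sum>i\<in>{1..n}. of_bool (\<theta> i = 0) * reject_prob n \<theta> \<phi> i + of_bool (\<theta> i \<noteq> 0) * accept_prob n \<theta> \<phi> i)"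
    unfolding reject_prob_def accept_prob_def
    by (intro sum.cong refl, subst Bochner_Integration.integral_add)
       (auto intro!: integrable_real_indicator arg_cong[where f=prob] simp: emeasure_eq_measure sets
          simp del: neq0_conv)
  also have "\<dots> = (\<Sum>i\<in>{1..n}. if i \<in> signal_set n \<theta> then accept_prob n \<theta> \<phi> i else reject_prob n \<theta> \<phi> i)"
    by (intro sum.cong) (auto simp: signal_set_def)
  also have "\<dots> = (\<Sum>i\<in>{1..n} - signal_set n \<theta>. reject_prob n \<theta> \<phi> i)
                           + (\<Sum>i\<in>signal_set n \<theta>. accept_prob n \<theta> \<phi> i)"
    using signal_set_subset[of n \<theta>]
    by (subst sum.subset_diff[OF signal_set_subset]) (auto intro!: arg_cong2[where f="(+)"] sum.cong)
  finally show ?thesis .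
qed

lemma class_risk_nonneg [simp]: "0 \<le> class_risk n \<theta> \<phi>"
  unfolding class_risk_def class_loss_def by (intro Bochner_Integration.integral_nonneg sum_nonneg) auto

lemma class_risk_le: "\<phi> \<in> procedures n \<Longrightarrow> class_risk n \<theta> \<phi> \<le> real n"
proof -
  assume "\<phi> \<in> procedures n"
  then have "class_risk n \<theta> \<phi> \<le> (\<Sum>i\<in>{1..n} - signal_set n \<theta>. 1) + (\<Sum>i\<in>signal_set n \<theta>. 1)"
    by (subst class_risk_eq) (auto intro!: add_mono sum_mono simp del: sum_constant)
  also have "\<dots> = (\<Sum>i\<in>{1..n}. 1)"
    by (rule sum.subset_diff[symmetric]) (auto simp: signal_set_def)
  finally show ?thesis by simp
qed

section \<open>The parameter set and the worst-case risk\<close>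

lemma zero_in_Theta': "(\<lambda>i\<in>{1..n}. 0) \<in> Theta' n s b"
proof -
  have "signal_set n (\<lambda>i\<in>{1..n}. 0) = {}" by (auto simp: signal_set_def)
  then show ?thesis unfolding Theta'_def by (intro UN_I[of 0]) auto
qed

lemma Theta'_nonempty [simp]: "Theta' n s b \<noteq> {}"
  using zero_in_Theta' by blast

lemma Theta'_iff: "\<theta> \<in> Theta' n s b \<longleftrightarrow> \<theta> \<in> {1..n} \<rightarrow>\<^sub>E UNIV \<and> card (signal_set n \<theta>) \<le> s
     \<and> (\<forall>i\<in>signal_set n \<theta>. signal_bound n s b \<le> \<bar>\<theta> i\<bar>)"
  by (auto simp: Theta'_def)

lemma Theta'_antimono: "b \<le> c \<Longrightarrow> Theta' n s c \<subseteq> Theta' n s b"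
  by (force simp: Theta'_iff signal_bound_def)

text \<open>A real supremum can be compared with its members only for bounded families; the crude
  bound by \<open>n\<close> supplies this everywhere.\<close>

lemma bdd_above_class_risk:
  "\<phi> \<in> procedures n \<Longrightarrow> bdd_above ((\<lambda>\<theta>. class_risk n \<theta> \<phi> / real s) ` A)"
  by (rule bdd_aboveI2[of _ _ "real n / real s"]) (simp add: class_risk_le divide_right_mono)

lemma class_risk_le_sup:
  "\<phi> \<in> procedures n \<Longrightarrow> \<theta> \<in> Theta' n s b \<Longrightarrow> class_risk n \<theta> \<phi> / real s \<le> sup_class_risk n s b \<phi>"
  unfolding sup_class_risk_def by (intro cSUP_upper bdd_above_class_risk)

lemma sup_class_risk_antimono:
  "\<phi> \<in> procedures n \<Longrightarrow> b \<le> c \<Longrightarrow> sup_class_risk n s c \<phi> \<le> sup_class_risk n s b \<phi>"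
  unfolding sup_class_risk_def
  by (intro cSUP_subset_mono bdd_above_class_risk Theta'_antimono) auto

lemma sup_class_risk_nonneg: "\<phi> \<in> procedures n \<Longrightarrow> 0 \<le> sup_class_risk n s b \<phi>"
  by (rule order_trans[OF _ class_risk_le_sup[OF _ zero_in_Theta']]) auto

lemma bdd_below_sup_class_risk: "bdd_below (sup_class_risk n s b ` procedures n)"
  by (rule bdd_belowI2[of _ 0]) (rule sup_class_risk_nonneg)

text \<open>Chernoff's method with weight 1/2 per success: each factor has mean at most 1 - p/2
  \<le> exp(-p/2), so the product has mean at most exp(-p card J / 2). On the event it is at least
  exp(-p card J / 4), and half of the exponent survives.\<close>

lemma measure_noise_count_lower_tail:
  assumes "J \<subseteq> {1..n}" "\<And>j. j \<in> J \<Longrightarrow> A j \<in> sets borel"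
    and p: "\<And>j. j \<in> J \<Longrightarrow> p \<le> measure std_gauss (A j)"
  shows "measure (noise n) {e \<in> {1..n} \<rightarrow>\<^sub>E UNIV. real (card {j \<in> J. e j \<in> A j}) < p * card J / 4}
           \<le> exp (- p * card J / 4)"
proof -
  interpret prob_space "noise n" by (rule prob_space_noise)
  have fin: "finite J" using assms(1) finite_subset by blast
  define f where "f j y = ennreal (if y \<in> A j then 1/2 else 1)" for j y
  have [measurable]: "f j \<in> borel_measurable borel" if "j \<in> J" for j
    using assms(2)[OF that] unfolding f_def by measurable
  have f_eq: "f j y = ennreal (1 - indicator (A j) y / 2)" for j y
    by (auto simp: f_def indicator_def)
  have Ef: "(\<integral>\<^sup>+y. f j y \<partial>std_gauss) \<le> ennreal (exp (- p / 2))" if "j \<in> J" for j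
  proof -
    have "(\<integral>\<^sup>+y. f j y \<partial>std_gauss) = ennreal (\<integral>y. 1 - indicator (A j) y / 2 \<partial>std_gauss)"
      unfolding f_eq using assms(2)[OF that]
      by (intro nn_integral_eq_integral Bochner_Integration.integrable_diff
          integrable_divide integrable_real_indicator)
        (auto simp: indicator_def std_gauss.emeasure_eq_measure)
    also have "(\<integral>y. 1 - indicator (A j) y / 2 \<partial>std_gauss) = 1 - measure std_gauss (A j) / 2"
      using assms(2)[OF that] by (subst Bochner_Integration.integral_diff)
        (auto intro!: integrable_real_indicator simp: std_gauss.emeasure_eq_measure std_gauss.prob_space)
    also have "\<dots> \<le> exp (- p / 2)"
      using p[OF that] exp_ge_add_one_self[of "- p / 2"] by simp
    finally show ?thesis by (simp add: ennreal_leI)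
  qed
  let ?k = "p * card J / 4"
  let ?E = "{e \<in> {1..n} \<rightarrow>\<^sub>E UNIV. real (card {j \<in> J. e j \<in> A j}) < ?k}"
  have cnt: "real (card {j \<in> J. e j \<in> A j}) = (\<Sum>j\<in>J. indicator (A j) (e j))" for e :: "nat \<Rightarrow> real"
    using fin by (simp add: indicator_def sum.If_cases Int_def)
  have sub: "i \<in> J \<Longrightarrow> i \<in> {1..n}" for i using assms(1) by auto
  have mE [measurable]: "?E \<in> sets (noise n)"
  proof -
    have "{e \<in> space (noise n). (\<Sum>j\<in>J. indicator (A j) (e j)) < ?k} \<in> sets (noise n)"
      using assms(2) sub by measurable
    then show ?thesis by (simp add: cnt)
  qed
  have prod_eq: "(\<Prod>j\<in>J. f j (e j)) = ennreal ((1/2) ^ card {j \<in> J. e j \<in> A j})" for e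
  proof -
    have "(\<Prod>j\<in>J. f j (e j)) = ennreal (\<Prod>j\<in>J. if e j \<in> A j then 1/2 else 1)"
      unfolding f_def by (rule prod_ennreal) auto
    also have "(\<Prod>j\<in>J. if e j \<in> A j then 1/2 else 1 :: real) = (1/2) ^ card {j \<in> J. e j \<in> A j}"
      using fin by (simp add: prod.If_cases Int_def)
    finally show ?thesis .
  qed
  have "ennreal (measure (noise n) ?E) = (\<integral>\<^sup>+e. indicator ?E e \<partial>noise n)"
    by (simp only: nn_integral_indicator[OF mE] emeasure_eq_measure)
  also have "\<dots> \<le> (\<integral>\<^sup>+e. ennreal (exp ?k) * (\<Prod>j\<in>J. f j (e j)) \<partial>noise n)"
  proof (rule nn_integral_mono)
    fix e :: "nat \<Rightarrow> real"
    let ?c = "card {j \<in> J. e j \<in> A j}"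
    have "1 \<le> exp ?k * (1/2) ^ ?c" if "real ?c < ?k"
    proof -
      \<comment> \<open>Enlarging 2 to e weakens the constant slightly but lets the two exponents
        cancel without logarithms of 2.\<close>
      have "(2::real) ^ ?c \<le> exp 1 ^ ?c"
        using exp_ge_add_one_self[of "1::real"] by (intro power_mono) auto
      also have "\<dots> = exp (real ?c)" by (simp flip: exp_of_nat_mult)
      also have "\<dots> \<le> exp ?k" using that by simp
      finally show ?thesis by (simp add: power_divide field_simps)
    qed
    then show "indicator ?E e \<le> ennreal (exp ?k) * (\<Prod>j\<in>J. f j (e j))"
      unfolding prod_eq by (auto simp: indicator_def ennreal_mult[symmetric] simp flip: ennreal_1 intro!: ennreal_leI)
  qed
  also have "\<dots> = ennreal (exp ?k) * (\<Prod>j\<in>J. \<integral>\<^sup>+y. f j y \<partial>std_gauss)"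
    unfolding noise_def using assms(1) sub
    by (subst nn_integral_cmult) (auto simp: nn_integral_gauss_prod)
  also have "\<dots> \<le> ennreal (exp ?k) * (\<Prod>j\<in>J. ennreal (exp (- p / 2)))"
    by (intro mult_left_mono prod_mono_ennreal Ef) auto
  also have "\<dots> = ennreal (exp ?k * exp (- p / 2) ^ card J)"
    by (simp add: ennreal_power ennreal_mult)
  also have "exp ?k * exp (- p / 2) ^ card J = exp (- p * card J / 4)"
    by (simp add: exp_of_nat_mult[symmetric] exp_add[symmetric] field_simps)
  finally show ?thesis by simp
qed

subsection \<open>An upper bound for adaptive procedures\<close>

definition false_positives :: "nat \<Rightarrow> (nat \<Rightarrow> real) \<Rightarrow> ((nat \<Rightarrow> real) \<Rightarrow> (nat \<Rightarrow> nat)) \<Rightarrow> real" where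
  "false_positives n \<theta> \<phi> = (\<Sum>i\<in>{1..n} - signal_set n \<theta>. reject_prob n \<theta> \<phi> i)"

text \<open>A signal is missed only if its own observation falls below \<open>T\<close> or if fewer
  than \<open>k\<close> observations reach \<open>T\<close>. The union bound copes with the
  dependence between the two events; the second is a Chernoff event, since each signal reaches
  \<open>T\<close> with probability at least \<open>p\<close>.\<close>

lemma false_negatives_le:
  assumes \<phi>: "\<phi> \<in> procedures n" and T: "0 \<le> T"
    and sig: "\<And>i. i \<in> signal_set n \<theta> \<Longrightarrow> A \<le> \<bar>\<theta> i\<bar>"
    and detect: "\<And>x. k \<le> real (card {i \<in> {1..n}. T \<le> \<bar>x i\<bar>}) \<Longrightarrow> (\<forall>i\<in>{1..n}. T \<le> \<bar>x i\<bar> \<longrightarrow> \<phi> x i \<noteq> 0)"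
    and p: "p = Phi_bar (ereal (T - A))" and m: "m = card (signal_set n \<theta>)"
    and k: "k \<le> p * m / 4"
  shows "(\<Sum>i\<in>signal_set n \<theta>. accept_prob n \<theta> \<phi> i) \<le> m * (Phi_bar (ereal (A - T)) + exp (- p * m / 4))"
proof -
  interpret prob_space "noise n" by (rule prob_space_noise)
  define S where "S = signal_set n \<theta>"
  have S: "S \<subseteq> {1..n}" "finite S" using signal_set_subset by (auto simp: S_def)
  define B where "B j = {e. T \<le> \<bar>\<theta> j + e\<bar>}" for j
  let ?E = "{e \<in> {1..n} \<rightarrow>\<^sub>E UNIV. real (card {j \<in> S. e j \<in> B j}) < p * card S / 4}"
  have [measurable]: "B j \<in> sets borel" for j unfolding B_def by measurable
  have tail: "measure (noise n) ?E \<le> exp (- p * card S / 4)"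
  proof (rule measure_noise_count_lower_tail[OF S(1)])
    fix j assume "j \<in> S"
    then have "p \<le> Phi_bar (ereal (T - \<bar>\<theta> j\<bar>))"
      unfolding p using sig[of j] by (intro Phi_bar_antimono) (simp add: S_def)
    also have "\<dots> \<le> measure std_gauss (B j)" unfolding B_def by (rule gauss_shift_above[OF T])
    finally show "p \<le> measure std_gauss (B j)" .
  qed simp
  have mE: "?E \<in> events"
  proof -
    have cnt: "real (card {j \<in> S. e j \<in> B j}) = (\<Sum>j\<in>S. indicator (B j) (e j))" for e :: "nat \<Rightarrow> real"
      using S by (simp add: indicator_def sum.If_cases Int_def)
    have sub: "i \<in> S \<Longrightarrow> i \<in> {1..n}" for i using S by auto
    have "{e \<in> space (noise n). (\<Sum>j\<in>S. indicator (B j) (e j)) < p * card S / 4} \<in> events"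
      using sub by measurable
    then show ?thesis by (simp add: cnt)
  qed
  have "accept_prob n \<theta> \<phi> i \<le> Phi_bar (ereal (A - T)) + exp (- p * m / 4)" if "i \<in> S" for i
  proof -
    have i: "i \<in> {1..n}" using that S by auto
    let ?L = "{e \<in> {1..n} \<rightarrow>\<^sub>E UNIV. e i \<in> - B i}"
    have mL: "?L \<in> events"
    proof -
      have "{e \<in> space (noise n). e i \<in> - B i} \<in> events" using i by measurable
      then show ?thesis by simp
    qed
    have "accept_prob n \<theta> \<phi> i = measure (noise n) {e \<in> {1..n} \<rightarrow>\<^sub>E UNIV. \<phi> (observe n \<theta> e) i = 0}"
      unfolding accept_prob_def by (rule measure_obs_law) (rule sets_reject[OF \<phi> i])
    also have "\<dots> \<le> measure (noise n) (?L \<union> ?E)"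
    proof (rule finite_measure_mono)
      show "{e \<in> {1..n} \<rightarrow>\<^sub>E UNIV. \<phi> (observe n \<theta> e) i = 0} \<subseteq> ?L \<union> ?E"
      proof safe
        fix e :: "nat \<Rightarrow> real"
        assume e: "\<phi> (observe n \<theta> e) i = 0" "\<not> real (card {j \<in> S. e j \<in> B j}) < p * card S / 4" "e i \<in> B i"
          "e \<in> {1..n} \<rightarrow>\<^sub>E UNIV"
        \<comment> \<open>The signals alone supply the required count; large null observations can
          only add to it.\<close>
        have "card {j \<in> S. e j \<in> B j} \<le> card {i \<in> {1..n}. T \<le> \<bar>observe n \<theta> e i\<bar>}"
          by (rule card_mono) (use S in \<open>auto simp: B_def subset_eq\<close>)
        with e(2) k m have "k \<le> real (card {i \<in> {1..n}. T \<le> \<bar>observe n \<theta> e i\<bar>})"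
          by (simp add: S_def)
        from detect[OF this] i e(1,3) show False by (auto simp: B_def)
      qed
    qed (use mL mE in auto)
    also have "\<dots> \<le> measure (noise n) ?L + measure (noise n) ?E"
      by (rule measure_Un_le[OF mL mE])
    also have "measure (noise n) ?L = measure std_gauss {e. \<bar>\<theta> i + e\<bar> < T}"
      by (subst measure_noise_component[OF i]) (auto simp: B_def not_le intro!: arg_cong[where f="measure _"])
    also have "\<dots> \<le> Phi_bar (ereal (\<bar>\<theta> i\<bar> - T))" by (rule gauss_shift_below[OF T])
    also have "\<dots> \<le> Phi_bar (ereal (A - T))"
      using sig[of i] that by (intro Phi_bar_antimono) (simp add: S_def)
    finally show ?thesis using tail m by (simp add: S_def)
  qed
  then have "(\<Sum>i\<in>S. accept_prob n \<theta> \<phi> i) \<le> (\<Sum>i\<in>S. Phi_bar (ereal (A - T)) + exp (- p * m / 4))"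
    by (rule sum_mono)
  then show ?thesis by (simp add: S_def m)
qed

text \<open>The threshold \<^term>\<open>signal_bound n (s n) 0\<close> is the detection level
  $\sqrt{2\log(n/s_n)}$; \<open>detect\<close> is a deterministic property of the procedure.\<close>

locale adaptive_procedure =
  fixes s :: "nat \<Rightarrow> nat" and \<phi> :: "nat \<Rightarrow> (nat \<Rightarrow> real) \<Rightarrow> (nat \<Rightarrow> nat)"
  assumes s_inf: "filterlim s at_top sequentially"
    and sparse: "filterlim (\<lambda>n. real n / real (s n)) at_top sequentially"
    and procedure: "\<forall>\<^sub>F n in sequentially. \<phi> n \<in> procedures n"
    and few_false_positives: "\<And>\<eta>. 0 < \<eta> \<Longrightarrow> \<forall>\<^sub>F n in sequentially.
          \<forall>\<theta>. card (signal_set n \<theta>) \<le> s n \<longrightarrow> false_positives n \<theta> (\<phi> n) \<le> \<eta> * real (s n)"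
    and detect: "\<And>\<kappa> \<epsilon>. 0 < \<kappa> \<Longrightarrow> 0 < \<epsilon> \<Longrightarrow> \<forall>\<^sub>F n in sequentially.
          \<forall>x. \<kappa> * real (s n) \<le> real (card {i \<in> {1..n}. signal_bound n (s n) \<epsilon> \<le> \<bar>x i\<bar>})
            \<longrightarrow> (\<forall>i\<in>{1..n}. signal_bound n (s n) \<epsilon> \<le> \<bar>x i\<bar> \<longrightarrow> \<phi> n x i \<noteq> 0)"
begin

lemma eventually_s_pos: "\<forall>\<^sub>F n in sequentially. 0 < s n"
  using s_inf eventually_gt_at_top[of 0] by (auto simp: filterlim_iff)

text \<open>Charging every signal as missed gives a bound uniform in \<open>b\<close>. This is what
  controls levels tending to minus infinity, where the parameter sets grow and a bound at a fixed
  level gives nothing from above.\<close>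

lemma sup_class_risk_le_1:
  assumes "0 < e"
  shows "\<forall>\<^sub>F n in sequentially. \<forall>b. sup_class_risk n (s n) b (\<phi> n) \<le> 1 + e"
  using procedure few_false_positives[OF assms] eventually_s_pos
proof eventually_elim
  case (elim n)
  show ?case
  proof
    fix b
    show "sup_class_risk n (s n) b (\<phi> n) \<le> 1 + e"
      unfolding sup_class_risk_def
    proof (rule cSUP_least)
      fix \<theta> assume "\<theta> \<in> Theta' n (s n) b"
      then have c: "card (signal_set n \<theta>) \<le> s n" by (simp add: Theta'_iff)
      have "(\<Sum>i\<in>signal_set n \<theta>. accept_prob n \<theta> (\<phi> n) i) \<le> (\<Sum>i\<in>signal_set n \<theta>. 1)"
        by (intro sum_mono) simp
      also have "\<dots> \<le> s n" using c by simp
      finally have "class_risk n \<theta> (\<phi> n) \<le> e * s n + s n"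
        using elim(2) c class_risk_eq[OF elim(1)] by (auto simp: false_positives_def intro!: add_mono)
      then show "class_risk n \<theta> (\<phi> n) / real (s n) \<le> 1 + e"
        using elim(3) by (simp add: field_simps)
    qed simp
  qed
qed

text \<open>Split at \<open>q * s n\<close> signals with q = Phi_bar(b). Below it, missing
  everything is affordable; above it there are enough large observations to trigger detection, and a
  signal is then lost essentially only when it falls below tau + \<epsilon>.\<close>

lemma sup_class_risk_le:
  assumes "0 < e"
  shows "\<forall>\<^sub>F n in sequentially. sup_class_risk n (s n) b (\<phi> n) \<le> Phi_bar (ereal b) + e"
proof -
  define q where "q = Phi_bar (ereal b)"
  have q: "0 < q" unfolding q_def by (rule Phi_bar_pos)
  \<comment> \<open>Detection works only slightly above tau; by continuity the price of this margin
    is below e/4.\<close>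
  have "((\<lambda>\<epsilon>. Phi_bar (ereal (b - \<epsilon>))) \<longlongrightarrow> Phi_bar (ereal (b - 0))) (at_right 0)"
    by (rule isCont_tendsto_compose[OF isCont_Phi_bar]) (intro tendsto_intros)
  then have "\<forall>\<^sub>F \<epsilon> in at_right 0. Phi_bar (ereal (b - \<epsilon>)) < q + e / 4"
    by (rule order_tendstoD(2)) (use assms in \<open>simp add: q_def\<close>)
  moreover have "\<forall>\<^sub>F \<epsilon> in at_right (0::real). 0 < \<epsilon>" by (simp add: eventually_at_right_less)
  ultimately have "\<forall>\<^sub>F \<epsilon> in at_right 0. 0 < \<epsilon> \<and> Phi_bar (ereal (b - \<epsilon>)) < q + e / 4"
    by eventually_elim simp
  from eventually_happens[OF this] obtain \<epsilon> where \<epsilon>: "0 < \<epsilon>" "Phi_bar (ereal (b - \<epsilon>)) < q + e / 4"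
    by auto
  define p where "p = Phi_bar (ereal (\<epsilon> - b))"
  have p: "0 < p" unfolding p_def by (rule Phi_bar_pos)
  \<comment> \<open>The detection fraction: at least q s_n signals, each above tau + \<epsilon> with
    probability at least p, and the Chernoff bound guarantees a quarter of the mean.\<close>
  have pq: "0 < p * q / 4" using p q by simp
  have "((\<lambda>n. exp (- (p * q / 4) * real (s n))) \<longlongrightarrow> 0) sequentially"
    by (rule filterlim_compose[OF _ filterlim_compose[OF filterlim_real_sequentially s_inf]])
       (use p q in real_asymp)
  then have "\<forall>\<^sub>F n in sequentially. exp (- (p * q / 4) * real (s n)) < e / 4"
    by (rule order_tendstoD(2)) (use assms in simp)
  moreover have "\<forall>\<^sub>F n in sequentially. real n / real (s n) \<ge> 1"
    using sparse by (simp add: filterlim_at_top)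
  ultimately show ?thesis
    using procedure few_false_positives[OF half_gt_zero[OF assms]] eventually_s_pos detect[OF pq \<epsilon>(1)]
  proof eventually_elim
    case (elim n)
    then have n: "\<phi> n \<in> procedures n" "0 < s n" "exp (- (p * q / 4) * real (s n)) < e / 4"
      "1 \<le> real n / real (s n)" by auto
    define \<tau> where "\<tau> = signal_bound n (s n) 0"
    have \<tau>: "0 \<le> \<tau>" "signal_bound n (s n) c = \<tau> + c" for c
      using n(4) by (auto simp: \<tau>_def signal_bound_def)
    show "sup_class_risk n (s n) b (\<phi> n) \<le> Phi_bar (ereal b) + e"
      unfolding sup_class_risk_def
    proof (rule cSUP_least)
      fix \<theta> assume \<theta>: "\<theta> \<in> Theta' n (s n) b"
      define m where "m = card (signal_set n \<theta>)"
      have c: "m \<le> s n" using \<theta> by (simp add: Theta'_iff m_def)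
      have FP: "false_positives n \<theta> (\<phi> n) \<le> e / 2 * real (s n)"
        using elim c by (simp add: m_def)
      have FN: "(\<Sum>i\<in>signal_set n \<theta>. accept_prob n \<theta> (\<phi> n) i) \<le> (q + e / 2) * s n"
      proof (cases "real m \<le> q * s n")
        case True
        have "(\<Sum>i\<in>signal_set n \<theta>. accept_prob n \<theta> (\<phi> n) i) \<le> (\<Sum>i\<in>signal_set n \<theta>. 1)"
          by (intro sum_mono) simp
        also have "\<dots> \<le> q * s n" using True by (simp add: m_def)
        also have "\<dots> \<le> (q + e / 2) * s n" using assms by (simp add: algebra_simps)
        finally show ?thesis .
      next
        case False
        have "(\<Sum>i\<in>signal_set n \<theta>. accept_prob n \<theta> (\<phi> n) i)
            \<le> m * (Phi_bar (ereal (signal_bound n (s n) b - (\<tau> + \<epsilon>))) + exp (- p * m / 4))"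
        proof (rule false_negatives_le[OF n(1), where k = "p * q / 4 * s n"])
          show "0 \<le> \<tau> + \<epsilon>" using \<tau> \<epsilon> by simp
          show "signal_bound n (s n) b \<le> \<bar>\<theta> i\<bar>" if "i \<in> signal_set n \<theta>" for i
            using \<theta> that by (simp add: Theta'_iff)
          show "\<forall>i\<in>{1..n}. \<tau> + \<epsilon> \<le> \<bar>x i\<bar> \<longrightarrow> \<phi> n x i \<noteq> 0"
            if "p * q / 4 * real (s n) \<le> real (card {i \<in> {1..n}. \<tau> + \<epsilon> \<le> \<bar>x i\<bar>})" for x
            using elim that by (auto simp: \<tau>(2))
          show "p = Phi_bar (ereal (\<tau> + \<epsilon> - signal_bound n (s n) b))" by (simp add: p_def \<tau>(2))
          show "m = card (signal_set n \<theta>)" by (simp add: m_def)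
          show "p * q / 4 * real (s n) \<le> p * real m / 4"
            using False p mult_left_mono[of "q * real (s n)" "real m" "p / 4"] by simp
        qed
        also have "\<dots> = m * (Phi_bar (ereal (b - \<epsilon>)) + exp (- p * m / 4))"
          by (simp add: \<tau>(2))
        also have "\<dots> \<le> s n * (q + e / 4 + e / 4)"
        proof (intro mult_mono add_mono)
          have "exp (- p * m / 4) \<le> exp (- (p * q / 4) * real (s n))"
            using False p mult_left_mono[of "q * real (s n)" "real m" "p / 4"] by simp
          then show "exp (- p * m / 4) \<le> e / 4" using n(3) by linarith
        qed (use c \<epsilon> q assms in auto)
        finally show ?thesis by (simp add: mult.commute add.commute)
      qed
      have "class_risk n \<theta> (\<phi> n) \<le> (q + e) * s n"
        using FP FN class_risk_eq[OF n(1), of \<theta>] by (simp add: false_positives_def algebra_simps)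
      then show "class_risk n \<theta> (\<phi> n) / real (s n) \<le> Phi_bar (ereal b) + e"
        using n(2) by (simp add: q_def field_simps)
    qed simp
  qed
qed

end

subsection \<open>The minimax lower bound\<close>

definition bernoulli_weight :: "real \<Rightarrow> nat set \<Rightarrow> nat set \<Rightarrow> real" where
  "bernoulli_weight p A S = p ^ card S * (1 - p) ^ card (A - S)"

lemma bernoulli_weight_nonneg: "0 \<le> p \<Longrightarrow> p \<le> 1 \<Longrightarrow> 0 \<le> bernoulli_weight p A S"
  by (simp add: bernoulli_weight_def)

lemma sum_bernoulli_weight_power:
  assumes "finite A"
  shows "(\<Sum>S\<in>Pow A. bernoulli_weight p A S * l ^ card S) = (1 - p + p * l) ^ card A"
proof -
  have "(1 - p + p * l) ^ card A = (\<Prod>i\<in>A. p * l + (1 - p))"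
    by (simp add: add.commute)
  also have "\<dots> = (\<Sum>S\<in>Pow A. bernoulli_weight p A S * l ^ card S)"
    unfolding prod_add[OF assms] bernoulli_weight_def
    by (intro sum.cong) (auto simp: power_mult_distrib)
  finally show ?thesis ..
qed

lemma sum_bernoulli_weight: "finite A \<Longrightarrow> (\<Sum>S\<in>Pow A. bernoulli_weight p A S) = 1"
  using sum_bernoulli_weight_power[of A p 1] by simp

lemma bernoulli_weight_insert:
  assumes "finite A" "i \<in> A" "S \<subseteq> A - {i}"
  shows "bernoulli_weight p A S = (1 - p) * bernoulli_weight p (A - {i}) S"
    and "bernoulli_weight p A (insert i S) = p * bernoulli_weight p (A - {i}) S"
proof -
  have "A - S = insert i (A - {i} - S)" using assms by auto
  then have "card (A - S) = Suc (card (A - {i} - S))"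
    using assms(1) by (simp add: card_insert_disjoint)
  then show "bernoulli_weight p A S = (1 - p) * bernoulli_weight p (A - {i}) S"
    by (simp add: bernoulli_weight_def)
  have "card (insert i S) = Suc (card S)"
    using assms finite_subset[OF assms(3)] by (intro card_insert_disjoint) auto
  moreover have "A - insert i S = A - {i} - S" by auto
  ultimately show "bernoulli_weight p A (insert i S) = p * bernoulli_weight p (A - {i}) S"
    by (simp add: bernoulli_weight_def)
qed

lemma bernoulli_upper_tail:
  fixes p \<epsilon> :: real
  assumes "finite A" "0 \<le> p" "p \<le> 1" "0 < \<epsilon>" "\<epsilon> \<le> 1" "p * card A \<le> (1 - \<epsilon>) * s"
  shows "(\<Sum>S | S \<subseteq> A \<and> s \<le> card S. bernoulli_weight p A S) \<le> exp (- (real s * \<epsilon>\<^sup>2 / 4))"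
proof -
  \<comment> \<open>With base 1 + \<epsilon>/2 and ln(1 + x) \<ge> x - x^2, the exponent is s(1 -
    \<epsilon>)\<epsilon>/2 - s(\<epsilon>/2 - \<epsilon>^2/4) = -s \<epsilon>^2/4.\<close>
  define l where "l = 1 + \<epsilon> / 2"
  have l: "1 \<le> l" using assms by (simp add: l_def)
  have fin: "finite {S. S \<subseteq> A \<and> s \<le> card S}" using assms(1) by simp
  have "(\<Sum>S | S \<subseteq> A \<and> s \<le> card S. bernoulli_weight p A S) * l ^ s
      = (\<Sum>S | S \<subseteq> A \<and> s \<le> card S. bernoulli_weight p A S * l ^ s)"
    by (rule sum_distrib_right)
  also have "\<dots> \<le> (\<Sum>S | S \<subseteq> A \<and> s \<le> card S. bernoulli_weight p A S * l ^ card S)"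
    using assms l by (intro sum_mono mult_left_mono power_increasing bernoulli_weight_nonneg) auto
  also have "\<dots> \<le> (\<Sum>S\<in>Pow A. bernoulli_weight p A S * l ^ card S)"
    using assms l by (intro sum_mono2) (auto intro!: mult_nonneg_nonneg bernoulli_weight_nonneg)
  also have "\<dots> = (1 + p * (\<epsilon> / 2)) ^ card A"
    unfolding sum_bernoulli_weight_power[OF assms(1)] by (simp add: l_def algebra_simps)
  also have "\<dots> \<le> exp (p * (\<epsilon> / 2)) ^ card A"
    using assms exp_ge_add_one_self[of "p * (\<epsilon> / 2)"] by (intro power_mono) auto
  also have "\<dots> = exp (p * card A * (\<epsilon> / 2))"
    by (simp add: exp_of_nat_mult[symmetric] mult_ac)
  also have "\<dots> \<le> exp ((1 - \<epsilon>) * s * (\<epsilon> / 2))"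
    using assms by (intro iffD2[OF exp_le_cancel_iff] mult_right_mono) auto
  also have "\<dots> \<le> exp (- (real s * \<epsilon>\<^sup>2 / 4)) * l ^ s"
  proof -
    have "\<epsilon> / 2 - (\<epsilon> / 2)\<^sup>2 \<le> ln l"
      unfolding l_def by (rule ln_one_plus_pos_lower_bound) (use assms in auto)
    then have "exp (s * (\<epsilon> / 2 - (\<epsilon> / 2)\<^sup>2)) \<le> exp (s * ln l)"
      by (intro iffD2[OF exp_le_cancel_iff] mult_left_mono) auto
    also have "\<dots> = l ^ s" using l by (simp add: exp_of_nat_mult)
    finally have "exp (- (real s * \<epsilon>\<^sup>2 / 4)) * exp (s * (\<epsilon> / 2 - (\<epsilon> / 2)\<^sup>2))
        \<le> exp (- (real s * \<epsilon>\<^sup>2 / 4)) * l ^ s"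
      by (rule mult_left_mono) simp
    moreover have "- (real s * \<epsilon>\<^sup>2 / 4) + s * (\<epsilon> / 2 - (\<epsilon> / 2)\<^sup>2) = (1 - \<epsilon>) * s * (\<epsilon> / 2)"
      by (simp add: field_simps power2_eq_square)
    ultimately show ?thesis by (simp only: exp_add[symmetric])
  qed
  finally show ?thesis
    by (rule mult_right_le_imp_le) (use l in simp)
qed

text \<open>Neyman--Pearson: below \<open>T\<close> the likelihood ratio of the shift by \<open>a\<close> stays under the prior odds.\<close>

lemma bayes_test_lower_bound:
  assumes p: "0 < p" "p < 1" and a: "0 < a" and [measurable]: "R \<in> sets borel"
  defines "r \<equiv> p * Phi_bar (ereal (a / 2 - ln ((1 - p) / p) / a))"
  shows "ennreal r \<le> ennreal (1 - p) * emeasure std_gauss R + ennreal p * emeasure std_gauss {y. a + y \<notin> R}"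
proof -
  \<comment> \<open>\<open>T\<close> is the Bayes threshold expressed in the noise of a signal: the
    observation is \<open>a + y\<close>, and up to \<open>y = T\<close> the weighted null density at
    that observation dominates the weighted signal density.\<close>
  define T where "T = ln ((1 - p) / p) / a - a / 2"
  have den: "p * std_normal_density y \<le> (1 - p) * std_normal_density (a + y)" if "y \<le> T" for y
  proof -
    have "a * y \<le> ln ((1 - p) / p) - a\<^sup>2 / 2"
    proof -
      have "a * T = ln ((1 - p) / p) - a\<^sup>2 / 2"
        using a by (simp add: T_def right_diff_distrib power2_eq_square)
      then show ?thesis using mult_left_mono[OF that, of a] a by simp
    qed
    then have "exp (- ln ((1 - p) / p)) \<le> exp (- a * y - a\<^sup>2 / 2)" by simp
    then have "p / (1 - p) \<le> exp (- a * y - a\<^sup>2 / 2)"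
      using p by (simp add: exp_minus)
    then have "p * exp (- y\<^sup>2 / 2) \<le> (1 - p) * exp (- a * y - a\<^sup>2 / 2) * exp (- y\<^sup>2 / 2)"
      using p by (intro mult_right_mono) (auto simp: field_simps)
    also have "exp (- a * y - a\<^sup>2 / 2) * exp (- y\<^sup>2 / 2) = exp (- (a + y)\<^sup>2 / 2)"
      by (simp add: power2_eq_square field_simps flip: exp_add)
    then have "(1 - p) * exp (- a * y - a\<^sup>2 / 2) * exp (- y\<^sup>2 / 2) = (1 - p) * exp (- (a + y)\<^sup>2 / 2)"
      by (simp add: mult.assoc)
    finally show ?thesis by (simp add: std_normal_density_def divide_right_mono)
  qed
  have "ennreal r = ennreal p * emeasure std_gauss {..T}"
    using p by (simp add: r_def std_gauss.emeasure_eq_measure Phi_bar_atMost T_def ennreal_mult)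
  \<comment> \<open>A signal with noise below \<open>T\<close> is either missed, or lies in the
    rejection region; the latter mass is charged to false rejections through the density
    comparison.\<close>
  also have "\<dots> \<le> ennreal p * (emeasure std_gauss {y. a + y \<notin> R} + emeasure std_gauss ({..T} \<inter> {y. a + y \<in> R}))"
    by (intro mult_left_mono order_trans[OF emeasure_mono emeasure_subadditive]) auto
  also have "\<dots> = ennreal p * emeasure std_gauss {y. a + y \<notin> R} + ennreal p * emeasure std_gauss ({..T} \<inter> {y. a + y \<in> R})"
    by (rule distrib_left)
  also have "ennreal p * emeasure std_gauss ({..T} \<inter> {y. a + y \<in> R})
      = (\<integral>\<^sup>+y. ennreal (p * std_normal_density y) * indicator ({..T} \<inter> {y. a + y \<in> R}) y \<partial>lborel)"
    using p by (simp add: emeasure_std_gauss nn_integral_cmult[symmetric] ennreal_mult mult.assoc)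
  also have "\<dots> \<le> (\<integral>\<^sup>+y. ennreal ((1 - p) * std_normal_density (a + y)) * indicator R (a + y) \<partial>lborel)"
    using den by (intro nn_integral_mono) (auto simp: indicator_def intro!: ennreal_leI)
  also have "\<dots> = (\<integral>\<^sup>+y. ennreal ((1 - p) * std_normal_density y) * indicator R y \<partial>lborel)"
    using nn_integral_real_affine[of "\<lambda>y. ennreal ((1 - p) * std_normal_density y) * indicator R y" 1 a] by simp
  also have "\<dots> = ennreal (1 - p) * emeasure std_gauss R"
    using p by (simp add: emeasure_std_gauss nn_integral_cmult[symmetric] ennreal_mult mult.assoc)
  finally show ?thesis by (simp add: add.commute)
qed

section \<open>From one-dimensional tests to arbitrary procedures\<close>

lemma sets_observe:
  assumes "{x \<in> {1..n} \<rightarrow>\<^sub>E UNIV. P x} \<in> sets (seq_space n)"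
  shows "{e \<in> {1..n} \<rightarrow>\<^sub>E UNIV. P (observe n \<theta> e)} \<in> sets (noise n)"
proof -
  have "observe n \<theta> -` {x \<in> {1..n} \<rightarrow>\<^sub>E UNIV. P x} \<inter> space (noise n)
      = {e \<in> {1..n} \<rightarrow>\<^sub>E UNIV. P (observe n \<theta> e)}"
    by (simp add: vimage_def Int_def conj_commute)
  from measurable_sets[OF measurable_observe assms, of \<theta>, unfolded this] show ?thesis .
qed

text \<open>Tonelli with coordinate \<open>i\<close> singled out. The decision on \<open>i\<close>
  may depend on all observations, but for frozen remaining noise it is an ordinary test based on one
  real number.\<close>

lemma emeasure_noise_split:
  assumes i: "i \<in> {1..n}" and E: "{e \<in> {1..n} \<rightarrow>\<^sub>E UNIV. P e} \<in> sets (noise n)"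
  shows "emeasure (noise n) {e \<in> {1..n} \<rightarrow>\<^sub>E UNIV. P e}
       = (\<integral>\<^sup>+e. emeasure std_gauss {y. P (e(i := y))} \<partial>(\<Pi>\<^sub>M j\<in>{1..n} - {i}. std_gauss))"
    and "(\<lambda>e. emeasure std_gauss {y. P (e(i := y))}) \<in> borel_measurable (\<Pi>\<^sub>M j\<in>{1..n} - {i}. std_gauss)"
    and "e \<in> space (\<Pi>\<^sub>M j\<in>{1..n} - {i}. std_gauss) \<Longrightarrow> {y. P (e(i := y))} \<in> sets borel"
proof -
  have ins: "insert i ({1..n} - {i}) = {1..n}" using i by auto
  let ?M = "\<Pi>\<^sub>M j\<in>{1..n} - {i}. std_gauss"
  let ?E = "{e \<in> {1..n} \<rightarrow>\<^sub>E UNIV. P e}"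
  have upd: "(\<lambda>(e, y). e(i := y)) \<in> measurable (?M \<Otimes>\<^sub>M std_gauss) (noise n)"
    using measurable_add_dim[of i "{1..n} - {i}" "\<lambda>_. std_gauss"] unfolding noise_def ins .
  have in_E: "e(i := y) \<in> ?E \<longleftrightarrow> P (e(i := y))" if "e \<in> space ?M" for e y
    using that i by (auto simp: space_PiM PiE_def extensional_def)
  have "(\<lambda>(e, y). indicator ?E (e(i := y)) :: ennreal) \<in> borel_measurable (?M \<Otimes>\<^sub>M std_gauss)"
    using measurable_compose[OF upd borel_measurable_indicator[OF E]] by (simp add: case_prod_beta')
  then have "(\<lambda>e. \<integral>\<^sup>+y. indicator ?E (e(i := y)) \<partial>std_gauss) \<in> borel_measurable ?M"
    by (intro std_gauss.borel_measurable_nn_integral)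
  moreover show sec: "{y. P (e(i := y))} \<in> sets borel" if e: "e \<in> space ?M" for e
  proof -
    have "(\<lambda>y. e(i := y)) \<in> measurable std_gauss (noise n)"
      using measurable_compose[OF measurable_Pair1'[OF e] upd] by simp
    from measurable_sets[OF this E] show ?thesis
      using in_E[OF e] by (simp add: vimage_def)
  qed
  have eq: "(\<integral>\<^sup>+y. indicator ?E (e(i := y)) \<partial>std_gauss) = emeasure std_gauss {y. P (e(i := y))}"
    if "e \<in> space ?M" for e
  proof -
    have "indicator ?E (e(i := y)) = (indicator {y. P (e(i := y))} y :: ennreal)" for y
      using in_E[OF that] by (auto simp: indicator_def)
    then show ?thesis using sec[OF that] by simp
  qed
  ultimately show "(\<lambda>e. emeasure std_gauss {y. P (e(i := y))}) \<in> borel_measurable ?M"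
    by (subst measurable_cong[symmetric, OF eq]) auto
  have "emeasure (noise n) ?E = (\<integral>\<^sup>+e. indicator ?E e \<partial>(\<Pi>\<^sub>M j\<in>insert i ({1..n} - {i}). std_gauss))"
    unfolding ins using E by (simp add: noise_def)
  also have "\<dots> = (\<integral>\<^sup>+e. (\<integral>\<^sup>+y. indicator ?E (e(i := y)) \<partial>std_gauss) \<partial>?M)"
    by (rule gauss_product.product_nn_integral_insert)
       (use E ins in \<open>auto simp: noise_def intro!: borel_measurable_indicator\<close>)
  also have "\<dots> = (\<integral>\<^sup>+e. emeasure std_gauss {y. P (e(i := y))} \<partial>?M)"
    by (rule nn_integral_cong) (rule eq)
  finally show "emeasure (noise n) ?E = (\<integral>\<^sup>+e. emeasure std_gauss {y. P (e(i := y))} \<partial>?M)" .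
qed

text \<open>For every frozen configuration of the other noise variables this is a simple test of 0
  against \<open>a\<close>. The one-dimensional bound does not depend on what is frozen, so it
  survives integration.\<close>

lemma coordinate_lower_bound:
  assumes \<phi>: "\<phi> \<in> procedures n" and i: "i \<in> {1..n}" and p: "0 < p" "p < 1" and a: "0 < a"
    and \<theta>: "\<theta> i = 0"
  shows "p * Phi_bar (ereal (a / 2 - ln ((1 - p) / p) / a))
       \<le> (1 - p) * reject_prob n \<theta> \<phi> i + p * accept_prob n (\<theta>(i := a)) \<phi> i" (is "?r \<le> _")
proof -
  interpret prob_space "noise n" by (rule prob_space_noise)
  let ?M = "\<Pi>\<^sub>M j\<in>{1..n} - {i}. std_gauss"
  interpret M: prob_space ?M by (rule prob_space_PiM) (rule prob_space_std_gauss)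
  let ?P = "\<lambda>e. \<phi> (observe n \<theta> e) i \<noteq> 0" and ?Q = "\<lambda>e. \<phi> (observe n (\<theta>(i := a)) e) i = 0"
  note P = sets_observe[OF sets_reject(1)[OF \<phi> i], of \<theta>]
  note Q = sets_observe[OF sets_reject(2)[OF \<phi> i], of "\<theta>(i := a)"]
  \<comment> \<open>Adding \<open>a\<close> to the mean is the same as adding \<open>a\<close> to
    the noise, so both error events are described by a single section of the rejection
    region.\<close>
  have shift: "observe n (\<theta>(i := a)) (e(i := y)) = observe n \<theta> (e(i := a + y))" for e y
    using \<theta> by (auto simp: observe_def fun_eq_iff restrict_def)
  have "ennreal ?r = (\<integral>\<^sup>+e. ennreal ?r \<partial>?M)" using M.emeasure_space_1 by simp
  also have "\<dots> \<le> (\<integral>\<^sup>+e. ennreal (1 - p) * emeasure std_gauss {y. ?P (e(i := y))}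
        + ennreal p * emeasure std_gauss {y. ?Q (e(i := y))} \<partial>?M)"
  proof (rule nn_integral_mono)
    fix e assume e: "e \<in> space ?M"
    from bayes_test_lower_bound[OF p a emeasure_noise_split(3)[OF i P e]]
    show "ennreal ?r \<le> ennreal (1 - p) * emeasure std_gauss {y. ?P (e(i := y))}
        + ennreal p * emeasure std_gauss {y. ?Q (e(i := y))}"
      by (simp add: shift)
  qed
  also have "\<dots> = ennreal (1 - p) * emeasure (noise n) {e \<in> {1..n} \<rightarrow>\<^sub>E UNIV. ?P e}
        + ennreal p * emeasure (noise n) {e \<in> {1..n} \<rightarrow>\<^sub>E UNIV. ?Q e}"
    by (simp only: emeasure_noise_split(1)[OF i P] emeasure_noise_split(1)[OF i Q]
        nn_integral_add nn_integral_cmult emeasure_noise_split(2)[OF i P] emeasure_noise_split(2)[OF i Q]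
        borel_measurable_times_ennreal borel_measurable_const)
  also have "\<dots> = ennreal ((1 - p) * reject_prob n \<theta> \<phi> i + p * accept_prob n (\<theta>(i := a)) \<phi> i)"
    using p unfolding reject_prob_def accept_prob_def
    by (simp add: measure_obs_law[OF sets_reject(1)[OF \<phi> i]] measure_obs_law[OF sets_reject(2)[OF \<phi> i]]
        emeasure_eq_measure ennreal_mult del: neq0_conv)
  finally show ?thesis using p by (subst (asm) ennreal_le_iff) auto
qed

section \<open>Averaging the risk over spike configurations\<close>

definition spike :: "nat \<Rightarrow> real \<Rightarrow> nat set \<Rightarrow> nat \<Rightarrow> real" where
  "spike n a S = (\<lambda>i\<in>{1..n}. if i \<in> S then a else 0)"

lemma signal_set_spike: "a \<noteq> 0 \<Longrightarrow> S \<subseteq> {1..n} \<Longrightarrow> signal_set n (spike n a S) = S"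
  by (auto simp: signal_set_def spike_def)

lemma spike_insert: "i \<in> {1..n} \<Longrightarrow> spike n a (insert i S) = (spike n a S)(i := a)"
  by (auto simp: spike_def fun_eq_iff restrict_def)

text \<open>The prior makes every coordinate a signal with probability \<open>p\<close>, independently. Discarding all
  configurations except the pairs \<open>S\<close>, \<open>insert i S\<close> with \<open>card S < s\<close> keeps it supported in the
  parameter set.\<close>

lemma sup_class_risk_lower_bound:
  assumes \<phi>: "\<phi> \<in> procedures n" and s: "0 < s" "s \<le> n" and \<epsilon>: "0 < \<epsilon>" "\<epsilon> < 1"
    and a: "0 < signal_bound n s b"
  defines "p \<equiv> (1 - \<epsilon>) * s / n" and "a \<equiv> signal_bound n s b"
  shows "(1 - \<epsilon>) * Phi_bar (ereal (a / 2 - ln ((1 - p) / p) / a)) * (1 - exp (- (real s * \<epsilon>\<^sup>2 / 4)))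
       \<le> sup_class_risk n s b \<phi>"
proof -
  define A where "A = {1..n}"
  have A[simp]: "finite A" "card A = n" by (auto simp: A_def)
  have "(1 - \<epsilon>) * s < 1 * real s" using s \<epsilon> by (intro mult_strict_right_mono) auto
  then have "(1 - \<epsilon>) * s < n" using s by linarith
  then have p: "0 < p" "p < 1" using s \<epsilon> by (auto simp: p_def)
  have a0: "0 < a" using a by (simp add: a_def)
  define r where "r = p * Phi_bar (ereal (a / 2 - ln ((1 - p) / p) / a))"
  have r: "0 \<le> r" using p by (simp add: r_def)
  \<comment> \<open>The share of coordinate \<open>i\<close> in the risk at the spike supported on
    \<open>S\<close>.\<close>
  define L where "L i S = (if i \<in> S then accept_prob n (spike n a S) \<phi> i else reject_prob n (spike n a S) \<phi> i)" for i S
  have L0: "0 \<le> L i S" for i S by (simp add: L_def)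
  let ?\<pi> = "bernoulli_weight p" and ?D = "{S. S \<subseteq> A \<and> card S \<le> s}"
  define t where "t = exp (- (real s * \<epsilon>\<^sup>2 / 4))"
  have risk: "(\<Sum>i\<in>A. L i S) \<le> s * sup_class_risk n s b \<phi>" if "S \<in> ?D" for S
  proof -
    have S: "signal_set n (spike n a S) = S" using that a0 by (intro signal_set_spike) (auto simp: A_def)
    have "spike n a S \<in> Theta' n s b"
      unfolding Theta'_iff S using that by (auto simp: spike_def a_def A_def)
    from class_risk_le_sup[OF \<phi> this] have "class_risk n (spike n a S) \<phi> \<le> s * sup_class_risk n s b \<phi>"
      using s by (simp add: field_simps)
    moreover have "class_risk n (spike n a S) \<phi> = (\<Sum>i\<in>A. L i S)"
      unfolding class_risk_eq[OF \<phi>] S A_def[symmetric]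
      using that by (subst sum.subset_diff[of S A]) (auto simp: L_def intro!: arg_cong2[where f="(+)"] sum.cong)
    ultimately show ?thesis by simp
  qed
  have coord: "r * (1 - t) \<le> (\<Sum>S\<in>?D. ?\<pi> A S * L i S)" if i: "i \<in> A" for i
  proof -
    let ?B = "{S. S \<subseteq> A - {i} \<and> card S < s}"
    have finB: "finite ?B" by simp
    have "1 = (\<Sum>S\<in>Pow (A - {i}). ?\<pi> (A - {i}) S)"
      by (simp add: sum_bernoulli_weight)
    also have "Pow (A - {i}) = ?B \<union> {S. S \<subseteq> A - {i} \<and> s \<le> card S}" by auto
    also have "(\<Sum>S\<in>\<dots>. ?\<pi> (A - {i}) S)
        = (\<Sum>S\<in>?B. ?\<pi> (A - {i}) S) + (\<Sum>S | S \<subseteq> A - {i} \<and> s \<le> card S. ?\<pi> (A - {i}) S)"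
      by (rule sum.union_disjoint) auto
    also have "(\<Sum>S | S \<subseteq> A - {i} \<and> s \<le> card S. ?\<pi> (A - {i}) S) \<le> t"
      unfolding t_def
    proof (rule bernoulli_upper_tail)
      have "p * card (A - {i}) \<le> p * n"
        using p i by (intro mult_left_mono) auto
      also have "\<dots> = (1 - \<epsilon>) * s" using s by (simp add: p_def)
      finally show "p * card (A - {i}) \<le> (1 - \<epsilon>) * s" .
    qed (use p \<epsilon> in auto)
    finally have "1 - t \<le> (\<Sum>S\<in>?B. ?\<pi> (A - {i}) S)" by simp
    then have "r * (1 - t) \<le> r * (\<Sum>S\<in>?B. ?\<pi> (A - {i}) S)" using r by (rule mult_left_mono)
    also have "\<dots> = (\<Sum>S\<in>?B. ?\<pi> (A - {i}) S * r)" by (simp add: sum_distrib_left mult.commute)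
    \<comment> \<open>The supports \<open>S\<close> and \<open>insert i S\<close> differ only at
      \<open>i\<close> and have prior masses in the ratio 1-p to p, so each pair poses a
      one-coordinate Bayes problem.\<close>
    also have "\<dots> \<le> (\<Sum>S\<in>?B. ?\<pi> A S * L i S + ?\<pi> A (insert i S) * L i (insert i S))"
    proof (rule sum_mono)
      fix S assume S: "S \<in> ?B"
      then have "i \<notin> S" by auto
      have "r \<le> (1 - p) * reject_prob n (spike n a S) \<phi> i + p * accept_prob n ((spike n a S)(i := a)) \<phi> i"
        unfolding r_def using i \<open>i \<notin> S\<close>
        by (intro coordinate_lower_bound \<phi> p a0) (auto simp: A_def spike_def)
      also have "\<dots> = (1 - p) * L i S + p * L i (insert i S)"
        using i \<open>i \<notin> S\<close> by (simp add: L_def spike_insert A_def)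
      finally have "?\<pi> (A - {i}) S * r \<le> ?\<pi> (A - {i}) S * ((1 - p) * L i S + p * L i (insert i S))"
        using p by (intro mult_left_mono bernoulli_weight_nonneg) auto
      also have "\<dots> = ?\<pi> A S * L i S + ?\<pi> A (insert i S) * L i (insert i S)"
        using S i by (simp add: bernoulli_weight_insert[of A i S] algebra_simps)
      finally show "?\<pi> (A - {i}) S * r \<le> \<dots>" .
    qed
    also have "\<dots> = (\<Sum>S\<in>?B. ?\<pi> A S * L i S) + (\<Sum>S\<in>insert i ` ?B. ?\<pi> A S * L i S)"
      unfolding sum.distrib
      by (subst sum.reindex) (auto simp: inj_on_def)
    also have "\<dots> = (\<Sum>S\<in>?B \<union> insert i ` ?B. ?\<pi> A S * L i S)"
      by (rule sum.union_disjoint[symmetric]) auto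
    also have "\<dots> \<le> (\<Sum>S\<in>?D. ?\<pi> A S * L i S)"
    proof (rule sum_mono2)
      show "?B \<union> insert i ` ?B \<subseteq> ?D"
      proof (intro Un_least subsetI)
        fix S assume "S \<in> insert i ` ?B"
        then obtain S' where S': "S = insert i S'" "S' \<subseteq> A - {i}" "card S' < s" by auto
        have "card S \<le> Suc (card S')" unfolding S'(1) by (rule card_insert_le_m1) auto
        then show "S \<in> ?D" using S' i by auto
      qed auto
    qed (use p L0 in \<open>auto intro!: mult_nonneg_nonneg bernoulli_weight_nonneg\<close>)
    finally show ?thesis .
  qed
  \<comment> \<open>Exchanging the sums turns the coordinatewise bounds into the risk averaged over
    the truncated prior. Its total mass is at most 1, so the average is at most the
    supremum.\<close>
  have "n * (r * (1 - t)) = (\<Sum>i\<in>A. r * (1 - t))" by simp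
  also have "\<dots> \<le> (\<Sum>i\<in>A. \<Sum>S\<in>?D. ?\<pi> A S * L i S)" by (intro sum_mono coord)
  also have "\<dots> = (\<Sum>S\<in>?D. ?\<pi> A S * (\<Sum>i\<in>A. L i S))"
    by (subst sum.swap) (simp add: sum_distrib_left)
  also have "\<dots> \<le> (\<Sum>S\<in>?D. ?\<pi> A S * (s * sup_class_risk n s b \<phi>))"
    using p by (intro sum_mono mult_left_mono risk bernoulli_weight_nonneg) auto
  also have "\<dots> = (\<Sum>S\<in>?D. ?\<pi> A S) * (s * sup_class_risk n s b \<phi>)"
    by (simp add: sum_distrib_right)
  also have "\<dots> \<le> 1 * (s * sup_class_risk n s b \<phi>)"
  proof (rule mult_right_mono)
    have "(\<Sum>S\<in>?D. ?\<pi> A S) \<le> (\<Sum>S\<in>Pow A. ?\<pi> A S)"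
      using p by (intro sum_mono2) (auto intro!: bernoulli_weight_nonneg)
    then show "(\<Sum>S\<in>?D. ?\<pi> A S) \<le> 1" by (simp add: sum_bernoulli_weight)
  qed (use sup_class_risk_nonneg[OF \<phi>] in simp)
  finally have bound: "n * (r * (1 - t)) \<le> s * sup_class_risk n s b \<phi>" by simp
  have eq: "n * (r * (1 - t)) = s * ((1 - \<epsilon>) * Phi_bar (ereal (a / 2 - ln ((1 - p) / p) / a)) * (1 - t))"
    using s by (simp add: r_def p_def)
  from bound[unfolded eq] show ?thesis unfolding t_def by (rule mult_left_le_imp_le) (use s in simp)
qed

lemma signal_bound_at_top:
  assumes sparse: "filterlim (\<lambda>n. real n / real (s n)) at_top sequentially"
  shows "filterlim (\<lambda>n. signal_bound n (s n) b) at_top sequentially"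
proof -
  have "filterlim (\<lambda>x::real. sqrt (2 * ln x) + b) at_top at_top" by real_asymp
  from filterlim_compose[OF this sparse] show ?thesis by (simp add: signal_bound_def)
qed

text \<open>The quantifier over procedures sits inside "eventually", so that the infimum can be
  taken for each \<open>n\<close> afterwards.\<close>

lemma minimax_lower_bound:
  assumes s_inf: "filterlim s at_top sequentially"
    and sparse: "filterlim (\<lambda>n. real n / real (s n)) at_top sequentially"
    and e: "0 < e"
  shows "\<forall>\<^sub>F n in sequentially. \<forall>\<phi>\<in>procedures n. Phi_bar (ereal b) - e \<le> sup_class_risk n (s n) b \<phi>"
proof -
  \<comment> \<open>Three losses of at most e/3: the thinning factor 1 - \<epsilon>, the truncated
    tail of the prior, and the convergence of the Gaussian level.\<close>
  define \<epsilon> where "\<epsilon> = min (e / 3) (1 / 2)"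
  have \<epsilon>: "0 < \<epsilon>" "\<epsilon> < 1" "\<epsilon> \<le> e / 3" "\<epsilon> \<le> 1/2" using e by (auto simp: \<epsilon>_def)
  \<comment> \<open>For a signal of size tau + b and log-odds tau^2/2, the argument in the Bayes
    bound is (2 b tau + b^2)/(2(tau + b)), which tends to b.\<close>
  have "((\<lambda>t::real. (t + b) / 2 - t\<^sup>2 / 2 / (t + b)) \<longlongrightarrow> b) at_top" by real_asymp
  then have "((\<lambda>t. Phi_bar (ereal ((t + b) / 2 - t\<^sup>2 / 2 / (t + b)))) \<longlongrightarrow> Phi_bar (ereal b)) at_top"
    by (rule isCont_tendsto_compose[OF isCont_Phi_bar])
  then have "\<forall>\<^sub>F t in at_top. Phi_bar (ereal b) - e / 3 < Phi_bar (ereal ((t + b) / 2 - t\<^sup>2 / 2 / (t + b)))"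
    by (rule order_tendstoD(1)) (use e in simp)
  then have ev1: "\<forall>\<^sub>F n in sequentially. Phi_bar (ereal b) - e / 3
      < Phi_bar (ereal ((signal_bound n (s n) 0 + b) / 2 - (signal_bound n (s n) 0)\<^sup>2 / 2 / (signal_bound n (s n) 0 + b)))"
    using signal_bound_at_top[OF sparse, of 0] by (rule eventually_compose_filterlim)
  have "((\<lambda>n. exp (- (real (s n) * \<epsilon>\<^sup>2 / 4))) \<longlongrightarrow> 0) sequentially"
    by (rule filterlim_compose[OF _ filterlim_compose[OF filterlim_real_sequentially s_inf]])
       (use \<epsilon> in real_asymp)
  then have ev2: "\<forall>\<^sub>F n in sequentially. exp (- (real (s n) * \<epsilon>\<^sup>2 / 4)) < e / 3"
    by (rule order_tendstoD(2)) (use e in simp)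
  have ev3: "\<forall>\<^sub>F n in sequentially. 0 < signal_bound n (s n) b"
    using signal_bound_at_top[OF sparse, of b] by (simp add: filterlim_at_top_dense)
  have ev4: "\<forall>\<^sub>F n in sequentially. 1 / \<epsilon> \<le> real n / real (s n)"
    using sparse by (simp add: filterlim_at_top)
  have ev5: "\<forall>\<^sub>F n in sequentially. 0 < s n"
    using s_inf eventually_gt_at_top[of 0] by (auto simp: filterlim_iff)
  show ?thesis using ev1 ev2 ev3 ev4 ev5
  proof eventually_elim
    case (elim n)
    have s: "0 < s n" by fact
    have "1 \<le> 1 / \<epsilon>" using \<epsilon> by simp
    then have ns: "1 \<le> real n / real (s n)" using elim(4) by linarith
    then have sn: "s n \<le> n" using s by (simp add: field_simps)
    define p where "p = (1 - \<epsilon>) * s n / n"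
    define \<tau> where "\<tau> = signal_bound n (s n) 0"
    have \<tau>: "signal_bound n (s n) b = \<tau> + b" "\<tau>\<^sup>2 / 2 = ln (real n / real (s n))"
      using ns by (auto simp: \<tau>_def signal_bound_def)
    have "s n / n \<le> \<epsilon>" using elim(4) s sn \<epsilon> by (simp add: field_simps)
    have p: "0 < p" using s sn \<epsilon> by (simp add: p_def)
    have "p \<le> 1 * \<epsilon>" unfolding p_def using \<open>s n / n \<le> \<epsilon>\<close> \<epsilon>
      by (simp only: times_divide_eq_right[symmetric]) (intro mult_mono, auto)
    \<comment> \<open>Thinning only raises the odds against a signal: (n/s_n) p = 1 - \<epsilon>
      \<le> 1 - p because p \<le> \<epsilon>.\<close>
    then have "real n / real (s n) \<le> (1 - p) / p"
    proof -
      have "real n / real (s n) * p = 1 - \<epsilon>" using s sn by (simp add: p_def)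
      with \<open>p \<le> 1 * \<epsilon>\<close> show ?thesis using p by (subst pos_le_divide_eq) auto
    qed
    then have "\<tau>\<^sup>2 / 2 \<le> ln ((1 - p) / p)" unfolding \<tau>(2) using ns by (intro ln_mono) auto
    then have "(\<tau> + b) / 2 - ln ((1 - p) / p) / (\<tau> + b) \<le> (\<tau> + b) / 2 - \<tau>\<^sup>2 / 2 / (\<tau> + b)"
      using elim(3) \<tau> by (intro diff_left_mono divide_right_mono) auto
    then have "Phi_bar (ereal b) - e / 3 \<le> Phi_bar (ereal ((\<tau> + b) / 2 - ln ((1 - p) / p) / (\<tau> + b)))"
      using elim(1) unfolding \<tau>_def[symmetric] by (intro order_trans[OF less_imp_le Phi_bar_antimono]) auto
    moreover define q where "q = Phi_bar (ereal ((\<tau> + b) / 2 - ln ((1 - p) / p) / (\<tau> + b)))"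
    moreover define u where "u = exp (- (real (s n) * \<epsilon>\<^sup>2 / 4))"
    moreover have "q - e / 3 - e / 3 \<le> (1 - \<epsilon>) * q * (1 - u)"
    proof -
      have q: "0 \<le> q" "q \<le> 1" by (auto simp: q_def)
      have "0 \<le> u" "u \<le> e / 3" using elim(2) by (auto simp: u_def)
      have "q - \<epsilon> * 1 - 1 * u \<le> q - \<epsilon> * q - ((1 - \<epsilon>) * q) * u"
        using q \<epsilon> \<open>0 \<le> u\<close> by (intro diff_mono mult_left_mono mult_right_mono mult_le_one) auto
      also have "\<dots> = (1 - \<epsilon>) * q * (1 - u)" by (simp add: algebra_simps)
      finally show ?thesis using \<epsilon>(3) \<open>u \<le> e / 3\<close> by simp
    qed
    ultimately have *: "Phi_bar (ereal b) - e \<le> (1 - \<epsilon>) * q * (1 - u)" by simp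
    show ?case
    proof
      fix \<phi> assume \<phi>: "\<phi> \<in> procedures n"
      from sup_class_risk_lower_bound[OF \<phi> s sn \<epsilon>(1,2) elim(3)] *
      show "Phi_bar (ereal b) - e \<le> sup_class_risk n (s n) b \<phi>"
        unfolding q_def u_def p_def \<tau>(1) by linarith
    qed
  qed
qed

subsection \<open>Thresholding at the detection level\<close>

lemma of_bool_in_procedures:
  assumes "\<And>i. i \<in> {1..n} \<Longrightarrow> {x \<in> {1..n} \<rightarrow>\<^sub>E UNIV. P x i} \<in> sets (seq_space n)"
  shows "(\<lambda>x. \<lambda>i\<in>{1..n}. of_bool (P x i)) \<in> procedures n"
  unfolding procedures_def
proof (rule measurable_restrict)
  fix i assume "i \<in> {1..n}"
  from assms[OF this] have "(\<lambda>x. if P x i then 1 else (0::nat)) \<in> measurable (seq_space n) (count_space {0, 1})"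
    by (intro measurable_If) auto
  then show "(\<lambda>x. of_bool (P x i)) \<in> measurable (seq_space n) (count_space {0::nat, 1})"
    by (simp add: of_bool_def)
qed

lemma exp_signal_bound:
  assumes "0 < s" "s \<le> n"
  shows "exp (- (signal_bound n s 0)\<^sup>2 / 2) = real s / real n"
  using assms by (simp add: signal_bound_def exp_minus field_simps)

lemma Mills_exp:
  assumes "0 < t"
  shows "2 * Phi_bar (ereal t) \<le> exp (- t\<^sup>2 / 2) / t"
proof -
  have "2 \<le> sqrt (2 * pi)" using pi_gt3 by (intro real_le_rsqrt) simp
  then have "2 / sqrt (2 * pi) * (exp (- t\<^sup>2 / 2) / t) \<le> 1 * (exp (- t\<^sup>2 / 2) / t)"
    using assms by (intro mult_right_mono) auto
  then show ?thesis
    using Mills_upper[OF assms] by (simp add: std_normal_density_def)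
qed

definition threshold_procedure :: "real \<Rightarrow> nat \<Rightarrow> (nat \<Rightarrow> real) \<Rightarrow> (nat \<Rightarrow> nat)" where
  "threshold_procedure \<tau> n x = (\<lambda>i\<in>{1..n}. of_bool (\<tau> \<le> \<bar>x i\<bar>))"

lemma threshold_procedure_in_procedures: "threshold_procedure \<tau> n \<in> procedures n"
proof -
  have "{x \<in> {1..n} \<rightarrow>\<^sub>E UNIV. \<tau> \<le> \<bar>x i\<bar>} \<in> sets (seq_space n)" if "i \<in> {1..n}" for i
  proof -
    have "{x \<in> space (seq_space n). \<tau> \<le> \<bar>x i\<bar>} \<in> sets (seq_space n)" using that by measurable
    then show ?thesis by simp
  qed
  from of_bool_in_procedures[OF this] show ?thesis
    unfolding threshold_procedure_def[abs_def] by simp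
qed

lemma measure_obs_null:
  assumes "i \<in> {1..n}" "\<theta> i = 0" "A \<in> sets borel"
  shows "measure (obs_law n \<theta>) {x \<in> {1..n} \<rightarrow>\<^sub>E UNIV. x i \<in> A} = measure std_gauss A"
proof -
  have "{x \<in> space (seq_space n). x i \<in> A} \<in> sets (seq_space n)"
    using assms by measurable
  then show ?thesis
    using assms by (simp add: measure_obs_law measure_noise_component)
qed

text \<open>By Mills' bound a null is rejected with probability at most (s_n/n)/tau, which sums to
  s_n/tau = o(s_n). This rule uses the known s_n and supplies the upper half of the minimax
  statement.\<close>

lemma threshold_procedure_adaptive:
  assumes s_inf: "filterlim s at_top sequentially"
    and sparse: "filterlim (\<lambda>n. real n / real (s n)) at_top sequentially"
  shows "adaptive_procedure s (\<lambda>n. threshold_procedure (signal_bound n (s n) 0) n)"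
proof
  fix \<eta> :: real assume "0 < \<eta>"
  have "\<forall>\<^sub>F n in sequentially. 0 < s n"
    using s_inf eventually_gt_at_top[of 0] by (auto simp: filterlim_iff)
  moreover have "\<forall>\<^sub>F n in sequentially. 1 \<le> real n / real (s n)"
    using sparse by (simp add: filterlim_at_top)
  moreover have "\<forall>\<^sub>F n in sequentially. 1 / \<eta> \<le> signal_bound n (s n) 0"
    using signal_bound_at_top[OF sparse, of 0] by (simp add: filterlim_at_top)
  ultimately show "\<forall>\<^sub>F n in sequentially. \<forall>\<theta>. card (signal_set n \<theta>) \<le> s n \<longrightarrow>
      false_positives n \<theta> (threshold_procedure (signal_bound n (s n) 0) n) \<le> \<eta> * real (s n)"
  proof eventually_elim
    case (elim n)
    define \<tau> where "\<tau> = signal_bound n (s n) 0"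
    have sn: "0 < s n" "s n \<le> n" using elim by (auto simp: field_simps)
    have "0 < 1 / \<eta>" using \<open>0 < \<eta>\<close> by simp
    then have \<tau>: "0 < \<tau>" using elim(3) unfolding \<tau>_def by linarith
    have "reject_prob n \<theta> (threshold_procedure \<tau> n) i \<le> s n / n * \<eta>"
      if "i \<in> {1..n} - signal_set n \<theta>" for \<theta> i
    proof -
      have i: "i \<in> {1..n}" "\<theta> i = 0" using that by (auto simp: signal_set_def)
      have "reject_prob n \<theta> (threshold_procedure \<tau> n) i = 2 * Phi_bar (ereal \<tau>)"
        using measure_obs_null[where A = "{e. \<tau> \<le> \<bar>e\<bar>}" and i = i and \<theta> = \<theta> and n = n] gauss_two_sided[OF \<tau>] i
        by (simp add: reject_prob_def threshold_procedure_def)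
      also have "\<dots> \<le> exp (- \<tau>\<^sup>2 / 2) / \<tau>" by (rule Mills_exp[OF \<tau>])
      also have "\<dots> = s n / n * (1 / \<tau>)" using exp_signal_bound[OF sn] by (simp add: \<tau>_def)
      also have "\<dots> \<le> s n / n * \<eta>"
      proof (rule mult_left_mono)
        show "1 / \<tau> \<le> \<eta>" using elim(3) \<tau> \<open>0 < \<eta>\<close> by (simp add: \<tau>_def field_simps)
      qed simp
      finally show ?thesis .
    qed
    then have "false_positives n \<theta> (threshold_procedure \<tau> n) \<le> card ({1..n} - signal_set n \<theta>) * (s n / n * \<eta>)" for \<theta>
      unfolding false_positives_def by (intro sum_bounded_above) auto
    also have "\<dots> \<theta> \<le> n * (s n / n * \<eta>)" for \<theta>
      using \<open>0 < \<eta>\<close> card_mono[of "{1..n}" "{1..n} - signal_set n \<theta>"] by (intro mult_right_mono) auto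
    also have "n * (s n / n * \<eta>) = \<eta> * s n" using sn by simp
    finally show ?case by (simp add: \<tau>_def)
  qed
next
  fix \<kappa> \<epsilon> :: real assume "0 < \<kappa>" "0 < \<epsilon>"
  then show "\<forall>\<^sub>F n in sequentially. \<forall>x. \<kappa> * real (s n) \<le> real (card {i \<in> {1..n}. signal_bound n (s n) \<epsilon> \<le> \<bar>x i\<bar>}) \<longrightarrow>
      (\<forall>i\<in>{1..n}. signal_bound n (s n) \<epsilon> \<le> \<bar>x i\<bar> \<longrightarrow> threshold_procedure (signal_bound n (s n) 0) n x i \<noteq> 0)"
    by (auto simp: threshold_procedure_def signal_bound_def)
qed (use assms threshold_procedure_in_procedures in auto)

subsection \<open>The Benjamini--Hochberg procedure\<close>

definition exceedances :: "nat \<Rightarrow> (nat \<Rightarrow> real) \<Rightarrow> ereal \<Rightarrow> nat" where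
  "exceedances n x t = card {i \<in> {1..n}. t \<le> ereal \<bar>x i\<bar>}"

definition BH_feasible :: "real \<Rightarrow> nat \<Rightarrow> (nat \<Rightarrow> real) \<Rightarrow> ereal \<Rightarrow> bool" where
  "BH_feasible \<alpha> n x t \<longleftrightarrow> t \<noteq> -\<infinity> \<and> real (exceedances n x t) / real n \<ge> 2 * Phi_bar t / \<alpha>"

lemma exceedances_le: "exceedances n x t \<le> n"
proof -
  have "exceedances n x t \<le> card {1..n}" unfolding exceedances_def by (rule card_mono) auto
  then show ?thesis by simp
qed

lemma exceedances_antimono: "t \<le> u \<Longrightarrow> exceedances n x u \<le> exceedances n x t"
  unfolding exceedances_def by (intro card_mono) (auto intro: order_trans)

lemma BH_threshold_alt: "BH_threshold \<alpha> n x = (LEAST t. BH_feasible \<alpha> n x t)"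
proof -
  have "(\<Sum>i\<in>{1..n}. of_bool (t \<le> ereal \<bar>x i\<bar>)) = real (exceedances n x t)" for t
    unfolding exceedances_def by (subst sum_of_bool_eq) (auto intro!: arg_cong[where f = card])
  then show ?thesis by (simp only: BH_threshold_def BH_feasible_def)
qed

text \<open>A feasible point with \<open>k\<close> exceedances can be lowered to the solution of
  $2\overline\Phi(t)/\alpha = k/n$, so only finitely many candidates compete for the minimum.\<close>

lemma BH_threshold_least:
  assumes \<alpha>: "0 < \<alpha>" "\<alpha> < 1" and n: "0 < n"
  shows "BH_feasible \<alpha> n x (BH_threshold \<alpha> n x)"
    and "\<And>t. BH_feasible \<alpha> n x t \<Longrightarrow> BH_threshold \<alpha> n x \<le> t"
proof -
  define z where "z k = (SOME z. Phi_bar (ereal z) = \<alpha> * real k / (2 * real n))" for k :: nat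
  have z: "Phi_bar (ereal (z k)) = \<alpha> * real k / (2 * real n)" if "k \<in> {1..n}" for k
  proof -
    have "\<alpha> * real k \<le> 1 * real k" using \<alpha> by (intro mult_right_mono) auto
    moreover have "real k \<le> real n" "0 < real k" using that by auto
    ultimately have "\<alpha> * real k < 2 * real n" by linarith
    then have "0 < \<alpha> * real k / (2 * real n)" "\<alpha> * real k / (2 * real n) < 1"
      using \<open>0 < real k\<close> \<alpha> n by auto
    then obtain y where "Phi_bar (ereal y) = \<alpha> * real k / (2 * real n)" by (rule Phi_bar_surj)
    then show ?thesis unfolding z_def by (rule someI)
  qed
  define C where "C = {t \<in> insert \<infinity> ((\<lambda>k. ereal (z k)) ` {1..n}). BH_feasible \<alpha> n x t}"
  \<comment> \<open>Both sides compare trivially at infinity, where the tail vanishes; this keeps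
    the candidate set nonempty even when no real point is feasible.\<close>
  have top: "BH_feasible \<alpha> n x \<infinity>" by (simp add: BH_feasible_def Phi_bar_PInf)
  have C: "finite C" "C \<noteq> {}" using top by (auto simp: C_def)
  have below: "\<exists>c\<in>C. c \<le> t" if t: "BH_feasible \<alpha> n x t" for t
  proof (cases t)
    case (real r)
    define k where "k = exceedances n x t"
    have kt: "2 * Phi_bar (ereal r) / \<alpha> \<le> real k / real n"
      using t real by (simp add: BH_feasible_def k_def)
    then have "0 < real k / real n"
      using Phi_bar_pos[of r] \<alpha> by (intro less_le_trans[OF _ kt]) simp
    then have k: "k \<in> {1..n}" using exceedances_le[of n x t] by (auto simp: k_def Suc_le_eq One_nat_def zero_less_divide_iff)
    have "Phi_bar (ereal r) \<le> Phi_bar (ereal (z k))"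
      using kt \<alpha> n by (simp add: z[OF k] field_simps)
    then have zr: "ereal (z k) \<le> t" using real by (simp add: Phi_bar_le_iff)
    have "2 * Phi_bar (ereal (z k)) / \<alpha> = real k / real n" using \<alpha> by (simp add: z[OF k])
    also have "\<dots> \<le> real (exceedances n x (ereal (z k))) / real n"
      using exceedances_antimono[OF zr, of n x] by (simp add: k_def divide_right_mono)
    finally have "ereal (z k) \<in> C" using k by (simp add: C_def BH_feasible_def)
    then show ?thesis using zr by blast
  next
    case PInf
    then show ?thesis using top by (auto simp: C_def)
  next
    case MInf
    then show ?thesis using t by (simp add: BH_feasible_def)
  qed
  have feas: "BH_feasible \<alpha> n x (Min C)" using Min_in[OF C] by (simp add: C_def)
  have least: "Min C \<le> t" if "BH_feasible \<alpha> n x t" for t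
  proof -
    from below[OF that] obtain c where "c \<in> C" "c \<le> t" by blast
    with Min_le[OF C(1)] show ?thesis using order_trans by blast
  qed
  have eq: "BH_threshold \<alpha> n x = Min C"
    unfolding BH_threshold_alt using feas least by (rule Least_equality)
  show "BH_feasible \<alpha> n x (BH_threshold \<alpha> n x)" unfolding eq by (rule feas)
  show "BH_threshold \<alpha> n x \<le> t" if "BH_feasible \<alpha> n x t" for t
    unfolding eq using that by (rule least)
qed

text \<open>Replaces a minimum over the extended reals by a finite search over the observations,
  from which measurability can be read off.\<close>

lemma BH_reject_iff:
  assumes \<alpha>: "0 < \<alpha>" "\<alpha> < 1" and i: "i \<in> {1..n}"
  shows "BH_threshold \<alpha> n x \<le> ereal \<bar>x i\<bar> \<longleftrightarrow>
    (\<exists>j\<in>{1..n}. \<bar>x j\<bar> \<le> \<bar>x i\<bar> \<and> 2 * Phi_bar (ereal \<bar>x j\<bar>) / \<alpha> \<le> real (card {k \<in> {1..n}. \<bar>x j\<bar> \<le> \<bar>x k\<bar>}) / real n)"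
proof -
  have n: "0 < n" using i by simp
  note least = BH_threshold_least[OF \<alpha> n, of x]
  let ?T = "BH_threshold \<alpha> n x"
  have feas: "BH_feasible \<alpha> n x (ereal \<bar>x j\<bar>) \<longleftrightarrow>
      2 * Phi_bar (ereal \<bar>x j\<bar>) / \<alpha> \<le> real (card {k \<in> {1..n}. \<bar>x j\<bar> \<le> \<bar>x k\<bar>}) / real n" for j
    by (simp add: BH_feasible_def exceedances_def)
  show ?thesis unfolding feas[symmetric]
  proof
    assume T: "?T \<le> ereal \<bar>x i\<bar>"
    define R where "R = {j \<in> {1..n}. ?T \<le> ereal \<bar>x j\<bar>}"
    have R: "finite R" "i \<in> R" using i T by (auto simp: R_def)
    \<comment> \<open>Raising the threshold to the smallest rejected observation loses no exceedance
      and only lowers the tail, so feasibility persists there.\<close>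
    define j where "j = arg_min_on (\<lambda>j. \<bar>x j\<bar>) R"
    have j: "j \<in> R" "\<And>k. k \<in> R \<Longrightarrow> \<bar>x j\<bar> \<le> \<bar>x k\<bar>"
      using arg_min_if_finite[OF R(1), of "\<lambda>j. \<bar>x j\<bar>"] R(2) unfolding j_def
      by (auto simp: not_less)
    have "BH_feasible \<alpha> n x (ereal \<bar>x j\<bar>)"
    proof -
      have "exceedances n x ?T \<le> exceedances n x (ereal \<bar>x j\<bar>)"
        unfolding exceedances_def by (rule card_mono) (use j in \<open>auto simp: R_def\<close>)
      moreover have "Phi_bar (ereal \<bar>x j\<bar>) \<le> Phi_bar ?T"
        using j(1) by (intro Phi_bar_antimono) (simp add: R_def)
      ultimately have "2 * Phi_bar (ereal \<bar>x j\<bar>) / \<alpha> \<le> 2 * Phi_bar ?T / \<alpha>"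
        "real (exceedances n x ?T) / real n \<le> real (exceedances n x (ereal \<bar>x j\<bar>)) / real n"
        using \<alpha> by (auto intro!: divide_right_mono)
      with least(1) show ?thesis unfolding BH_feasible_def by auto
    qed
    then show "\<exists>j\<in>{1..n}. \<bar>x j\<bar> \<le> \<bar>x i\<bar> \<and> BH_feasible \<alpha> n x (ereal \<bar>x j\<bar>)"
      using j R(2) by (intro bexI[of _ j]) (auto simp: R_def)
  next
    assume "\<exists>j\<in>{1..n}. \<bar>x j\<bar> \<le> \<bar>x i\<bar> \<and> BH_feasible \<alpha> n x (ereal \<bar>x j\<bar>)"
    then obtain j where "\<bar>x j\<bar> \<le> \<bar>x i\<bar>" "?T \<le> ereal \<bar>x j\<bar>" using least(2) by blast
    then show "?T \<le> ereal \<bar>x i\<bar>" by (meson ereal_less_eq(3) order_trans)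
  qed
qed

lemma BH_in_procedures:
  assumes \<alpha>: "0 < \<alpha>" "\<alpha> < 1"
  shows "BH_procedure \<alpha> n \<in> procedures n"
proof -
  have "{x \<in> {1..n} \<rightarrow>\<^sub>E UNIV. BH_threshold \<alpha> n x \<le> ereal \<bar>x i\<bar>} \<in> sets (seq_space n)" if i: "i \<in> {1..n}" for i
  proof -
    have card_eq: "real (card {k \<in> {1..n}. \<bar>x j\<bar> \<le> \<bar>x k\<bar>}) = (\<Sum>k\<in>{1..n}. if \<bar>x j\<bar> \<le> \<bar>x k\<bar> then 1 else 0)"
      for x :: "nat \<Rightarrow> real" and j
      by (simp add: sum.If_cases Int_def)
    have [measurable]: "(\<lambda>x. \<Sum>k\<in>{1..n}. if \<bar>x j\<bar> \<le> \<bar>x k\<bar> then 1 else 0 :: real) \<in> borel_measurable (seq_space n)" for j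
      by (intro borel_measurable_sum) measurable
    have "{x \<in> space (seq_space n). \<exists>j\<in>{1..n}. \<bar>x j\<bar> \<le> \<bar>x i\<bar> \<and>
        2 * Phi_bar (ereal \<bar>x j\<bar>) / \<alpha> \<le> (\<Sum>k\<in>{1..n}. if \<bar>x j\<bar> \<le> \<bar>x k\<bar> then 1 else 0) / real n} \<in> sets (seq_space n)"
    proof (rule sets.sets_Collect_finite_Ex)
      fix j
      show "{x \<in> space (seq_space n). \<bar>x j\<bar> \<le> \<bar>x i\<bar> \<and>
        2 * Phi_bar (ereal \<bar>x j\<bar>) / \<alpha> \<le> (\<Sum>k\<in>{1..n}. if \<bar>x j\<bar> \<le> \<bar>x k\<bar> then 1 else 0) / real n} \<in> sets (seq_space n)"
        by (intro sets.sets_Collect_conj; measurable)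
    qed simp
    then show ?thesis by (simp only: BH_reject_iff[OF \<alpha> i] card_eq space_seq_space)
  qed
  from of_bool_in_procedures[OF this] show ?thesis
    unfolding BH_procedure_def[abs_def] by simp
qed

section \<open>False discoveries of the Benjamini--Hochberg procedure\<close>

lemma false_positives_eq_nn_integral:
  assumes \<phi>: "\<phi> \<in> procedures n"
  shows "ennreal (false_positives n \<theta> \<phi>)
    = (\<integral>\<^sup>+e. ennreal (real (card {i \<in> {1..n} - signal_set n \<theta>. \<phi> (observe n \<theta> e) i \<noteq> 0})) \<partial>noise n)"
proof -
  interpret prob_space "noise n" by (rule prob_space_noise)
  let ?N = "{1..n} - signal_set n \<theta>"
  let ?E = "\<lambda>i. {e \<in> {1..n} \<rightarrow>\<^sub>E UNIV. \<phi> (observe n \<theta> e) i \<noteq> 0}"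
  have E: "?E i \<in> sets (noise n)" if "i \<in> ?N" for i
    using that by (intro sets_observe sets_reject \<phi>) auto
  have "(\<integral>\<^sup>+e. ennreal (real (card {i \<in> ?N. \<phi> (observe n \<theta> e) i \<noteq> 0})) \<partial>noise n)
      = (\<integral>\<^sup>+e. (\<Sum>i\<in>?N. indicator (?E i) e) \<partial>noise n)"
  proof (rule nn_integral_cong)
    fix e assume "e \<in> space (noise n)"
    then have "(\<Sum>i\<in>?N. indicator (?E i) e) = (\<Sum>i\<in>?N. if \<phi> (observe n \<theta> e) i \<noteq> 0 then 1 else 0 :: ennreal)"
      by (intro sum.cong) (auto simp: indicator_def)
    then show "ennreal (real (card {i \<in> ?N. \<phi> (observe n \<theta> e) i \<noteq> 0})) = (\<Sum>i\<in>?N. indicator (?E i) e)"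
      by (simp add: sum.If_cases Int_def ennreal_of_nat_eq_real_of_nat del: neq0_conv)
  qed
  also have "\<dots> = (\<Sum>i\<in>?N. emeasure (noise n) (?E i))"
    using E by (subst nn_integral_sum) (auto simp del: neq0_conv)
  also have "\<dots> = (\<Sum>i\<in>?N. ennreal (reject_prob n \<theta> \<phi> i))"
    unfolding reject_prob_def
    by (intro sum.cong refl, subst measure_obs_law) (auto intro!: sets_reject \<phi> simp: emeasure_eq_measure simp del: neq0_conv)
  also have "\<dots> = ennreal (false_positives n \<theta> \<phi>)"
    unfolding false_positives_def by (rule sum_ennreal) simp
  finally show ?thesis ..
qed

text \<open>If \<open>v\<close> nulls are rejected, at least \<open>v\<close> null p-values fall below $\alpha(s+v)/n$. For
  \<open>v\<close> beyond \<open>\<eta> * s\<close> this has probability exponentially small in \<open>v\<close>, so a union bound over \<open>v\<close> suffices.\<close>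

lemma BH_false_positives:
  assumes \<alpha>: "0 < \<alpha>" "\<alpha> < 1" and \<eta>: "0 < \<eta>" and small: "7 * \<alpha> * (1 + 1 / \<eta>) \<le> 1 / 2"
    and n: "0 < n" and card_S: "card (signal_set n \<theta>) \<le> s"
  shows "false_positives n \<theta> (BH_procedure \<alpha> n) \<le> \<eta> * s + 1"
proof -
  interpret prob_space "noise n" by (rule prob_space_noise)
  let ?N = "{1..n} - signal_set n \<theta>" and ?\<phi> = "BH_procedure \<alpha> n"
  define q where "q v = \<alpha> * (s + v) / n" for v :: nat
  define B where "B v = {e. 2 * Phi_bar (ereal \<bar>e\<bar>) \<le> q v}" for v
  have [measurable]: "B v \<in> sets borel" for v unfolding B_def by measurable
  define cnt where "cnt v e = card {i \<in> ?N. e i \<in> B v}" for v and e :: "nat \<Rightarrow> real"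
  define W where "W = {v \<in> {1..n}. \<eta> * s < v}"
  have q0: "0 \<le> q v" for v using \<alpha> by (simp add: q_def)
  \<comment> \<open>A factor 8 for each small null p-value: its mean 1 + 7q \<le> exp(7q) is the
    origin of the 7 in the smallness condition.\<close>
  define f where "f v y = ennreal (1 + 7 * indicator (B v) y)" for v y
  have [measurable]: "f v \<in> borel_measurable borel" for v unfolding f_def by measurable
  have Ef: "(\<integral>\<^sup>+y. f v y \<partial>std_gauss) \<le> ennreal (exp (7 * q v))" for v
  proof -
    have "(\<integral>\<^sup>+y. f v y \<partial>std_gauss) = ennreal (\<integral>y. 1 + 7 * indicator (B v) y \<partial>std_gauss)"
      unfolding f_def
      by (intro nn_integral_eq_integral Bochner_Integration.integrable_add
          integrable_mult_right integrable_real_indicator)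
        (auto simp: indicator_def std_gauss.emeasure_eq_measure)
    also have "(\<integral>y. 1 + 7 * indicator (B v) y \<partial>std_gauss) = 1 + 7 * measure std_gauss (B v)"
      by (subst Bochner_Integration.integral_add)
        (auto intro!: integrable_real_indicator simp: std_gauss.emeasure_eq_measure)
    also have "\<dots> \<le> 1 + 7 * q v"
      using gauss_p_value[OF q0[of v]] by (simp add: B_def)
    also have "\<dots> \<le> exp (7 * q v)" by (rule exp_ge_add_one_self)
    finally show ?thesis by (simp add: ennreal_leI)
  qed
  have prod_eq: "(\<Prod>i\<in>?N. f v (e i)) = ennreal (8 ^ cnt v e)" for v e
  proof -
    have "(\<Prod>i\<in>?N. f v (e i)) = ennreal (\<Prod>i\<in>?N. 1 + 7 * indicator (B v) (e i))"
      unfolding f_def by (rule prod_ennreal) auto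
    also have "(\<Prod>i\<in>?N. 1 + 7 * indicator (B v) (e i) :: real) = (\<Prod>i\<in>?N. if e i \<in> B v then 8 else 1)"
      by (intro prod.cong) (auto simp: indicator_def)
    also have "\<dots> = 8 ^ cnt v e"
      by (simp add: prod.If_cases Int_def cnt_def)
    finally show ?thesis .
  qed
  \<comment> \<open>The weight \<open>v * (1/8) ^ v\<close> times 8 to the count is at least
    \<open>v\<close> as soon as the count reaches \<open>v\<close>, while its mean is at most 2^v
    8^(-v) 2^v = 2^(-v), which is summable.\<close>
  have E8: "(\<integral>\<^sup>+e. ennreal (v * (1/8) ^ v) * (\<Prod>i\<in>?N. f v (e i)) \<partial>noise n) \<le> ennreal ((1/2) ^ v)"
    if v: "v \<in> W" for v
  proof -
    have "(\<integral>\<^sup>+e. ennreal (v * (1/8) ^ v) * (\<Prod>i\<in>?N. f v (e i)) \<partial>noise n)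
        = ennreal (v * (1/8) ^ v) * (\<Prod>i\<in>?N. \<integral>\<^sup>+y. f v y \<partial>std_gauss)"
      unfolding noise_def
      by (subst nn_integral_cmult, measurable) (simp add: nn_integral_gauss_prod[of _ _ "\<lambda>_. f v"])
    also have "\<dots> \<le> ennreal (v * (1/8) ^ v) * (\<Prod>i\<in>?N. ennreal (exp (7 * q v)))"
      by (intro mult_left_mono prod_mono_ennreal Ef) auto
    also have "\<dots> = ennreal (v * (1/8) ^ v * exp (card ?N * (7 * q v)))"
      by (simp add: ennreal_power ennreal_mult exp_of_nat_mult)
    also have "\<dots> \<le> ennreal ((1/2) ^ v)"
    proof (rule ennreal_leI)
      have "real (card ?N) * (7 * q v) \<le> n * (7 * q v)"
        using card_mono[of "{1..n}" ?N] q0[of v] by (intro mult_right_mono) auto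
      also have "\<dots> = 7 * \<alpha> * (s + v)" using n by (simp add: q_def)
      \<comment> \<open>On \<open>W\<close> the signals are outnumbered up to a factor, s \<le>
        v/\<eta>, so the whole exponent becomes proportional to v.\<close>
      also have "\<dots> \<le> 7 * \<alpha> * (v / \<eta> + v)"
        using v \<eta> \<alpha> by (intro mult_left_mono add_mono) (auto simp: W_def field_simps)
      also have "\<dots> = 7 * \<alpha> * (1 + 1 / \<eta>) * v" by (simp add: field_simps)
      also have "\<dots> \<le> 1 / 2 * v" using small by (intro mult_right_mono) auto
      finally have "exp (real (card ?N) * (7 * q v)) \<le> exp (real v * (1 / 2))" by simp
      also have "\<dots> = exp (1 / 2) ^ v" by (rule exp_of_nat_mult)
      also have "\<dots> \<le> 2 ^ v" using exp_half_le2 by (intro power_mono) auto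
      finally have "v * (1/8) ^ v * exp (card ?N * (7 * q v)) \<le> 2 ^ v * (1/8) ^ v * 2 ^ v"
        using of_nat_less_two_power[of v, where 'a=real] by (intro mult_mono) (auto simp: less_imp_le)
      also have "\<dots> = (2 * (1/8) * 2) ^ v" by (simp only: power_mult_distrib)
      finally show "v * (1/8) ^ v * exp (card ?N * (7 * q v)) \<le> (1/2) ^ v" by simp
    qed
    finally show ?thesis .
  qed
  have det: "real (card {i \<in> ?N. ?\<phi> (observe n \<theta> e) i \<noteq> 0}) \<le> \<eta> * s + (\<Sum>v\<in>W. v * (1/8) ^ v * 8 ^ cnt v e)" for e
  proof -
    define x where "x = observe n \<theta> e"
    define R where "R = {i \<in> ?N. ?\<phi> x i \<noteq> 0}"
    define v where "v = card R"
    let ?T = "BH_threshold \<alpha> n x"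
    have R: "R = {i \<in> ?N. ?T \<le> ereal \<bar>x i\<bar>}" by (auto simp: R_def BH_procedure_def)
    have nonneg: "0 \<le> (\<Sum>v\<in>W. v * (1/8) ^ v * 8 ^ cnt v e)" by (intro sum_nonneg) auto
    show ?thesis
    proof (cases "v \<in> W")
      case False
      have "v \<le> card {1..n}" unfolding v_def R by (rule card_mono) auto
      then have "v \<le> n" by simp
      with False have "v \<le> \<eta> * s" using \<eta> by (cases "v = 0") (auto simp: W_def Suc_le_eq One_nat_def)
      then show ?thesis using nonneg by (simp add: v_def R_def x_def)
    next
      case True
      have "exceedances n x ?T \<le> card (signal_set n \<theta> \<union> R)"
        unfolding exceedances_def by (rule card_mono) (auto simp: R)
      also have "\<dots> \<le> s + v" using card_Un_le[of "signal_set n \<theta>" R] card_S by (simp add: v_def)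
      finally have "real (exceedances n x ?T) / n \<le> (s + v) / n" by (simp add: divide_right_mono)
      with BH_threshold_least(1)[OF \<alpha> n, of x] have "2 * Phi_bar ?T / \<alpha> \<le> (s + v) / n"
        by (auto simp: BH_feasible_def)
      then have T: "2 * Phi_bar ?T \<le> q v" using \<alpha> by (simp add: q_def field_simps)
      have "v \<le> cnt v e"
        unfolding cnt_def v_def
      proof (rule card_mono)
        show "R \<subseteq> {i \<in> ?N. e i \<in> B (card R)}"
        proof
          fix i assume i: "i \<in> R"
          then have "i \<in> {1..n}" "\<theta> i = 0" by (auto simp: R signal_set_def)
          then have "x i = e i" by (simp add: x_def)
          moreover have "Phi_bar (ereal \<bar>x i\<bar>) \<le> Phi_bar ?T" using i by (intro Phi_bar_antimono) (simp add: R)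
          ultimately show "i \<in> {i \<in> ?N. e i \<in> B (card R)}"
            using i T by (auto simp: B_def v_def R)
        qed
      qed simp
      then have "(8::real) ^ v \<le> 8 ^ cnt v e" by (intro power_increasing) auto
      then have "v * (1/8) ^ v * 8 ^ v \<le> v * (1/8) ^ v * 8 ^ cnt v e"
        by (intro mult_left_mono) auto
      then have "v \<le> v * (1/8) ^ v * 8 ^ cnt v e" by (simp add: mult.assoc flip: power_mult_distrib)
      also have "\<dots> \<le> (\<Sum>v\<in>W. v * (1/8) ^ v * 8 ^ cnt v e)"
        by (rule member_le_sum[OF True]) (auto simp: W_def)
      finally show ?thesis using \<eta> by (simp add: v_def R_def x_def add_increasing)
    qed
  qed
  have "ennreal (false_positives n \<theta> ?\<phi>)
      \<le> (\<integral>\<^sup>+e. ennreal (\<eta> * s) + (\<Sum>v\<in>W. ennreal (v * (1/8) ^ v) * (\<Prod>i\<in>?N. f v (e i))) \<partial>noise n)"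
    unfolding false_positives_eq_nn_integral[OF BH_in_procedures[OF \<alpha>]]
  proof (rule nn_integral_mono)
    fix e
    have "ennreal (\<eta> * s) + (\<Sum>v\<in>W. ennreal (v * (1/8) ^ v) * (\<Prod>i\<in>?N. f v (e i)))
        = ennreal (\<eta> * s + (\<Sum>v\<in>W. v * (1/8) ^ v * 8 ^ cnt v e))"
      using \<eta> by (simp add: prod_eq ennreal_mult[symmetric] sum_ennreal ennreal_plus[symmetric] sum_nonneg del: ennreal_plus)
    then show "ennreal (real (card {i \<in> ?N. ?\<phi> (observe n \<theta> e) i \<noteq> 0}))
        \<le> ennreal (\<eta> * s) + (\<Sum>v\<in>W. ennreal (v * (1/8) ^ v) * (\<Prod>i\<in>?N. f v (e i)))"
      using det[of e] by (simp only: ennreal_leI)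
  qed
  also have "\<dots> = ennreal (\<eta> * s) + (\<Sum>v\<in>W. \<integral>\<^sup>+e. ennreal (v * (1/8) ^ v) * (\<Prod>i\<in>?N. f v (e i)) \<partial>noise n)"
    unfolding f_def using emeasure_space_1
    by (subst nn_integral_add) (auto simp: nn_integral_sum)
  also have "\<dots> \<le> ennreal (\<eta> * s) + (\<Sum>v\<in>W. ennreal ((1/2) ^ v))"
    by (intro add_left_mono sum_mono E8)
  also have "\<dots> = ennreal (\<eta> * s + (\<Sum>v\<in>W. (1/2) ^ v))"
    using \<eta> by (simp add: sum_ennreal ennreal_plus[symmetric] sum_nonneg del: ennreal_plus)
  also have "\<dots> \<le> ennreal (\<eta> * s + 1)"
  proof (intro ennreal_leI add_left_mono)
    have "(\<Sum>v\<in>W. (1/2) ^ v) \<le> (\<Sum>v\<in>{1..n}. (1/2::real) ^ v)"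
      by (rule sum_mono2) (auto simp: W_def)
    also have "\<dots> = (\<Sum>v<n. (1/2::real) ^ Suc v)"
      using sum.atLeast1_atMost_eq[of "\<lambda>v. (1/2::real) ^ v" n] by (simp add: One_nat_def)
    also have "\<dots> = 1 - (1/2) ^ n"
      by (induction n) (auto simp: field_simps)
    also have "\<dots> \<le> 1" by simp
    finally show "(\<Sum>v\<in>W. (1/2::real) ^ v) \<le> 1" .
  qed
  finally show ?thesis using \<eta> by (subst (asm) ennreal_le_iff) auto
qed

text \<open>Since Phi_bar(tau + \<epsilon>) \<le> (s_n/n) exp(-\<epsilon> tau), the level tau +
  \<epsilon> becomes feasible with \<kappa> s_n exceedances once exp(-\<epsilon> tau) \<le> \<alpha>
  \<kappa>/2. This asks for log(1/\<alpha>) to be small against tau, and polynomial sparsity makes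
  tau at least of order sqrt(log n).\<close>

lemma BH_adaptive:
  assumes s_inf: "filterlim s at_top sequentially"
    and sparse: "filterlim (\<lambda>n. real n / real (s n)) at_top sequentially"
    and \<alpha>: "\<And>n. 0 < \<alpha> n" "\<And>n. \<alpha> n < 1" and \<alpha>0: "\<alpha> \<in> o(\<lambda>_. 1)"
    and \<alpha>_log: "(\<lambda>n. - ln (\<alpha> n)) \<in> o(\<lambda>n. sqrt (ln (real n)))"
    and c: "c < 1" "(\<lambda>n. real (s n)) \<in> O(\<lambda>n. real n powr c)"
  shows "adaptive_procedure s (\<lambda>n. BH_procedure (\<alpha> n) n)"
proof
  have s_pos: "\<forall>\<^sub>F n in sequentially. 0 < s n"
    using s_inf eventually_gt_at_top[of 0] by (auto simp: filterlim_iff)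
  {
    fix \<eta> :: real assume \<eta>: "0 < \<eta>"
    have "(\<alpha> \<longlongrightarrow> 0) sequentially" using \<alpha>0 by (rule smalloD_tendsto[where g="\<lambda>_. 1", simplified])
    \<comment> \<open>The false discovery bound is applied with \<eta>/2; the other half absorbs its
      additive 1 because s_n \<ge> 2/\<eta>.\<close>
    then have "\<forall>\<^sub>F n in sequentially. \<alpha> n < 1 / (14 * (1 + 2 / \<eta>))"
      by (rule order_tendstoD(2)) (use \<eta> in \<open>simp add: add_pos_pos\<close>)
    moreover have "\<forall>\<^sub>F n in sequentially. 2 / \<eta> \<le> real (s n)"
      using filterlim_compose[OF filterlim_real_sequentially s_inf] by (simp add: filterlim_at_top)
    ultimately show "\<forall>\<^sub>F n in sequentially. \<forall>\<theta>. card (signal_set n \<theta>) \<le> s n \<longrightarrow>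
        false_positives n \<theta> (BH_procedure (\<alpha> n) n) \<le> \<eta> * real (s n)"
      using eventually_gt_at_top[of 0]
    proof eventually_elim
      case (elim n)
      have pos: "0 < 1 + 2 / \<eta>" using \<eta> by (simp add: add_pos_pos)
      have "false_positives n \<theta> (BH_procedure (\<alpha> n) n) \<le> \<eta> / 2 * s n + 1"
        if "card (signal_set n \<theta>) \<le> s n" for \<theta>
      proof (rule BH_false_positives[OF \<alpha> _ _ _ that])
        have "\<alpha> n * (14 * (1 + 2 / \<eta>)) < 1" using elim(1) pos by (simp add: pos_less_divide_eq)
        then have "\<alpha> n * (14 * (1 + 2 / \<eta>)) / 2 \<le> 1 / 2" by (intro divide_right_mono less_imp_le) auto
        moreover have "7 * \<alpha> n * (1 + 1 / (\<eta> / 2)) = \<alpha> n * (14 * (1 + 2 / \<eta>)) / 2" by simp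
        ultimately show "7 * \<alpha> n * (1 + 1 / (\<eta> / 2)) \<le> 1 / 2" by (simp only:)
      qed (use \<eta> elim in auto)
      moreover have "\<eta> / 2 * s n + 1 \<le> \<eta> * s n" using elim(2) \<eta> by (simp add: field_simps)
      ultimately show ?case by force
    qed
  next
    fix \<kappa> \<epsilon> :: real assume \<kappa>: "0 < \<kappa>" and \<epsilon>: "0 < \<epsilon>"
    define \<tau> where "\<tau> n = signal_bound n (s n) 0" for n
    have \<tau>_inf: "filterlim \<tau> at_top sequentially"
      unfolding \<tau>_def by (rule signal_bound_at_top[OF sparse])
    obtain C where C: "0 < C" "\<forall>\<^sub>F n in sequentially. norm (real (s n)) \<le> C * norm (real n powr c)"
      using c(2) by (rule landau_o.bigE)
    \<comment> \<open>The margin \<epsilon> tau is shared equally between log(1/\<alpha>) and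
      log(2/\<kappa>).\<close>
    have ev_log: "\<forall>\<^sub>F n in sequentially. norm (- ln (\<alpha> n)) \<le> \<epsilon> / 2 * sqrt (1 - c) * norm (sqrt (ln (real n)))"
      by (rule landau_o.smallD[OF \<alpha>_log]) (use \<epsilon> c in simp)
    \<comment> \<open>Half of (1 - c) log n is given up to absorb the constant of the polynomial
      bound, leaving tau^2 \<ge> (1 - c) log n.\<close>
    have "filterlim (\<lambda>n. (1 - c) / 2 * ln (real n) - ln C) at_top sequentially"
      using c by real_asymp
    then have ev_C: "\<forall>\<^sub>F n in sequentially. 0 \<le> (1 - c) / 2 * ln (real n) - ln C"
      unfolding filterlim_at_top by (rule spec)
    have ev_\<tau>: "\<forall>\<^sub>F n in sequentially. max 1 (2 / \<epsilon> * ln (2 / \<kappa>)) \<le> \<tau> n"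
      using \<tau>_inf unfolding filterlim_at_top by (rule spec)
    have ev_1: "\<forall>\<^sub>F n in sequentially. 1 \<le> real n / real (s n)"
      using sparse by (simp add: filterlim_at_top)
    show "\<forall>\<^sub>F n in sequentially. \<forall>x. \<kappa> * real (s n) \<le> real (card {i \<in> {1..n}. signal_bound n (s n) \<epsilon> \<le> \<bar>x i\<bar>}) \<longrightarrow>
        (\<forall>i\<in>{1..n}. signal_bound n (s n) \<epsilon> \<le> \<bar>x i\<bar> \<longrightarrow> BH_procedure (\<alpha> n) n x i \<noteq> 0)"
      using C(2) ev_log ev_C ev_\<tau> ev_1 s_pos
    proof eventually_elim
      case (elim n)
      have sn: "0 < s n" "s n \<le> n" using elim by (auto simp: field_simps)
      then have n: "0 < n" by simp
      have ln_n: "0 \<le> ln (real n)" using n by simp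
      define t where "t = signal_bound n (s n) \<epsilon>"
      have t: "t = \<tau> n + \<epsilon>" by (simp add: t_def \<tau>_def signal_bound_def)
      have \<tau>1: "1 \<le> \<tau> n" using elim by simp
      have "ln (real (s n)) \<le> ln (C * real n powr c)"
        using elim(1) sn by (intro ln_mono) auto
      also have "\<dots> = ln C + c * ln n" using C(1) n by (simp add: ln_mult ln_powr)
      finally have "(1 - c) / 2 * ln n \<le> ln (real n / real (s n))"
        using elim(3) n sn by (simp add: ln_div field_simps)
      then have "(1 - c) * ln n \<le> 2 * ln (real n / real (s n))" by simp
      then have "sqrt (1 - c) * sqrt (ln n) \<le> \<tau> n"
        by (simp add: \<tau>_def signal_bound_def flip: real_sqrt_mult)
      then have "\<epsilon> / 2 * (sqrt (1 - c) * sqrt (ln n)) \<le> \<epsilon> / 2 * \<tau> n"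
        using \<epsilon> by (intro mult_left_mono) auto
      then have "- ln (\<alpha> n) \<le> \<epsilon> / 2 * \<tau> n" using elim(2) ln_n by (simp add: mult.assoc)
      moreover have "ln (2 / \<kappa>) \<le> \<epsilon> / 2 * \<tau> n"
      proof -
        have "\<epsilon> / 2 * (2 / \<epsilon> * ln (2 / \<kappa>)) \<le> \<epsilon> / 2 * \<tau> n" using elim(4) \<epsilon> by (intro mult_left_mono) auto
        then show ?thesis using \<epsilon> by simp
      qed
      ultimately have "- \<epsilon> * \<tau> n \<le> ln (\<alpha> n) - ln (2 / \<kappa>)" by simp
      then have "exp (- \<epsilon> * \<tau> n) \<le> exp (ln (\<alpha> n) - ln (2 / \<kappa>))" by simp
      also have "\<dots> = \<alpha> n * \<kappa> / 2" using \<alpha>(1)[of n] \<kappa> by (simp add: exp_diff)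
      finally have e: "exp (- \<epsilon> * \<tau> n) \<le> \<alpha> n * \<kappa> / 2" .
      have "Phi_bar (ereal t) \<le> exp (- t\<^sup>2 / 2)" by (rule Phi_bar_le_exp) (use t \<tau>1 \<epsilon> in simp)
      also have "\<dots> \<le> exp (- (\<tau> n)\<^sup>2 / 2 + - \<epsilon> * \<tau> n)"
      proof -
        have "- t\<^sup>2 / 2 = - (\<tau> n)\<^sup>2 / 2 + - \<epsilon> * \<tau> n - \<epsilon>\<^sup>2 / 2"
          by (simp add: t power2_eq_square field_simps)
        moreover have "0 \<le> \<epsilon>\<^sup>2 / 2" by simp
        ultimately have "- t\<^sup>2 / 2 \<le> - (\<tau> n)\<^sup>2 / 2 + - \<epsilon> * \<tau> n" by linarith
        then show ?thesis by (rule iffD2[OF exp_le_cancel_iff])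
      qed
      also have "\<dots> = s n / n * exp (- \<epsilon> * \<tau> n)"
        by (simp only: exp_add \<tau>_def exp_signal_bound[OF sn])
      also have "\<dots> \<le> s n / n * (\<alpha> n * \<kappa> / 2)" by (intro mult_left_mono e) simp
      finally have "2 * Phi_bar (ereal t) / \<alpha> n \<le> \<kappa> * s n / n"
        using \<alpha>(1)[of n] n by (simp add: field_simps)
      then have feas: "BH_feasible (\<alpha> n) n x (ereal t)" if "\<kappa> * s n \<le> real (card {i \<in> {1..n}. t \<le> \<bar>x i\<bar>})" for x
      proof -
        have "\<kappa> * s n / n \<le> real (card {i \<in> {1..n}. t \<le> \<bar>x i\<bar>}) / n"
          by (rule divide_right_mono[OF that]) simp
        with \<open>2 * Phi_bar (ereal t) / \<alpha> n \<le> \<kappa> * s n / n\<close> show ?thesis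
          unfolding BH_feasible_def exceedances_def by simp
      qed
      show ?case unfolding t_def[symmetric]
      proof (intro allI impI ballI)
        fix x i assume a: "\<kappa> * real (s n) \<le> real (card {i \<in> {1..n}. t \<le> \<bar>x i\<bar>})" "i \<in> {1..n}" "t \<le> \<bar>x i\<bar>"
        have "BH_threshold (\<alpha> n) n x \<le> ereal t"
          by (rule BH_threshold_least(2)[OF \<alpha> n feas[OF a(1)]])
        also have "\<dots> \<le> ereal \<bar>x i\<bar>" using a by simp
        finally show "BH_procedure (\<alpha> n) n x i \<noteq> 0" using a by (simp add: BH_procedure_def)
      qed
    qed
  }
qed (use assms BH_in_procedures in auto)

subsection \<open>The slab density and its likelihood ratio\<close>

definition slab_ratio :: "real \<Rightarrow> real" where
  "slab_ratio x = slab_g x / std_normal_density x"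

lemma slab_beta_eq: "slab_beta x = slab_ratio x - 1"
  by (simp add: slab_beta_def slab_ratio_def)

lemma slab_g_eq: "slab_g x = slab_ratio x * std_normal_density x"
  using normal_density_pos[of 1 0 x] by (simp add: slab_ratio_def)

lemma slab_ratio_0: "slab_ratio 0 = 1 / 2"
  by (simp add: slab_ratio_def slab_g_def std_normal_density_def field_simps)

lemma slab_ratio_nz: "x \<noteq> 0 \<Longrightarrow> slab_ratio x = (exp (x\<^sup>2 / 2) - 1) / x\<^sup>2"
  by (simp add: slab_ratio_def slab_g_def std_normal_density_def field_simps flip: exp_add)

lemma slab_ratio_abs: "slab_ratio \<bar>x\<bar> = slab_ratio x"
  by (cases "x = 0") (auto simp: slab_ratio_nz)

lemma measurable_slab_g [measurable]: "slab_g \<in> borel_measurable borel"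
  unfolding slab_g_def[abs_def] by measurable

lemma measurable_slab_ratio [measurable]: "slab_ratio \<in> borel_measurable borel"
  unfolding slab_ratio_def[abs_def] by measurable

lemma measurable_slab_beta [measurable]: "slab_beta \<in> borel_measurable borel"
  unfolding slab_beta_def[abs_def] by measurable

lemma slab_ratio_gt_half:
  assumes "x \<noteq> 0"
  shows "1 / 2 < slab_ratio x"
proof -
  have "1 + x\<^sup>2 / 2 < exp (x\<^sup>2 / 2)"
    using exp_minus_greater[of "- (x\<^sup>2 / 2)"] assms by simp
  then show ?thesis using assms by (simp add: slab_ratio_nz field_simps)
qed

text \<open>In z = x^2/2 the ratio is (exp z - 1)/(2z), with a derivative that is positive because
  (1 - z) exp z < 1.\<close>

lemma slab_ratio_strict_mono:
  assumes "\<bar>x\<bar> < \<bar>y\<bar>"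
  shows "slab_ratio x < slab_ratio y"
proof (cases "x = 0")
  case True
  then show ?thesis using assms slab_ratio_gt_half[of y] by (simp add: slab_ratio_0)
next
  case False
  let ?h = "\<lambda>z::real. (exp z - 1) / z"
  have "?h (x\<^sup>2 / 2) < ?h (y\<^sup>2 / 2)"
  proof (rule DERIV_pos_imp_increasing[where f = ?h])
    show "x\<^sup>2 / 2 < y\<^sup>2 / 2" using assms by (simp add: abs_le_square_iff not_le[symmetric])
    fix z assume "x\<^sup>2 / 2 \<le> z"
    moreover have "0 < x\<^sup>2 / 2" using False by simp
    ultimately have z: "0 < z" by linarith
    have "DERIV ?h z :> (exp z * z - (exp z - 1)) / z\<^sup>2"
      using z by (auto intro!: derivative_eq_intros simp: power2_eq_square)
    moreover have "0 < (exp z * z - (exp z - 1)) / z\<^sup>2"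
    proof -
      have "(1 - z) * exp z < exp (- z) * exp z"
        using exp_minus_greater[of z] z by (intro mult_strict_right_mono) auto
      also have "\<dots> = 1" by (simp flip: exp_add)
      finally show ?thesis using z by (intro divide_pos_pos) (auto simp: algebra_simps)
    qed
    ultimately show "\<exists>d. DERIV ?h z :> d \<and> 0 < d" by blast
  qed
  moreover have "y \<noteq> 0" using assms by auto
  ultimately show ?thesis using False by (simp add: slab_ratio_nz field_simps)
qed

lemma slab_ratio_mono:
  assumes "\<bar>x\<bar> \<le> \<bar>y\<bar>"
  shows "slab_ratio x \<le> slab_ratio y"
proof (cases "\<bar>x\<bar> = \<bar>y\<bar>")
  case True
  then show ?thesis using slab_ratio_abs[of x] slab_ratio_abs[of y] by simp
next
  case False
  then show ?thesis using slab_ratio_strict_mono[of x y] assms by simp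
qed

lemma slab_ratio_ge_half: "1 / 2 \<le> slab_ratio x"
  using slab_ratio_gt_half[of x] slab_ratio_0 by (cases "x = 0") auto

lemma slab_ratio_nonneg: "0 \<le> slab_ratio x"
  using slab_ratio_ge_half[of x] by linarith

lemma slab_beta_ge: "- 1 / 2 \<le> slab_beta x"
  using slab_ratio_ge_half[of x] by (simp add: slab_beta_eq)

lemma slab_g_nonneg: "0 \<le> slab_g x"
  using slab_ratio_ge_half[of x] by (simp add: slab_g_eq)

text \<open>Strict monotonicity in the absolute value allows at most two zeros. They are the only
  observations for which the likelihood ignores the weight, hence the only source of non-unique
  maximisers.\<close>

lemma finite_slab_beta_zeros: "finite {x. slab_beta x = 0}"
proof (cases "\<exists>y. slab_beta y = 0")
  case True
  then obtain y where y: "slab_beta y = 0" by blast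
  have "{x. slab_beta x = 0} \<subseteq> {y, - y}"
  proof
    fix x assume "x \<in> {x. slab_beta x = 0}"
    with y have "slab_ratio x = slab_ratio y" by (simp add: slab_beta_eq)
    then have "\<bar>x\<bar> = \<bar>y\<bar>"
      using slab_ratio_strict_mono[of x y] slab_ratio_strict_mono[of y x] by linarith
    then show "x \<in> {y, - y}" by auto
  qed
  then show ?thesis by (rule finite_subset) simp
qed simp

text \<open>Neither density has an elementary antiderivative, but integrating x^(-2) by parts in the
  slab reproduces the Gaussian, so their difference has one.\<close>

lemma slab_minus_gauss_has_integral:
  assumes "0 < R"
  shows "((\<lambda>x. slab_g x - std_normal_density x) has_integral
      - (2 * (1 - exp (- (R\<^sup>2) / 2)) / (R * sqrt (2 * pi)))) {- R..R}"
proof -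
  \<comment> \<open>The value 0 is the continuous extension at the origin. Differentiability is
    checked only elsewhere; the fundamental theorem tolerates one exceptional point.\<close>
  define H where "H x = (if x = 0 then 0 else - (1 - exp (- (x\<^sup>2) / 2)) / (x * sqrt (2 * pi)))" for x :: real
  have cont0: "isCont H 0"
  proof -
    have "((\<lambda>x::real. (1 - exp (- (x\<^sup>2) / 2)) / x) \<longlongrightarrow> 0) (at 0)" by real_asymp
    note tendsto_mult_left[OF this, of "- 1 / sqrt (2 * pi)"]
    moreover have "- 1 / sqrt (2 * pi) * ((1 - exp (- (x\<^sup>2) / 2)) / x) = - (1 - exp (- (x\<^sup>2) / 2)) / (x * sqrt (2 * pi))"
      for x :: real by (cases "x = 0") (auto simp: field_simps)
    ultimately have "((\<lambda>x::real. - (1 - exp (- (x\<^sup>2) / 2)) / (x * sqrt (2 * pi))) \<longlongrightarrow> 0) (at 0)"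
      by simp
    then have "(H \<longlongrightarrow> 0) (at 0)"
      by (rule Lim_transform_eventually) (auto simp: H_def eventually_at_filter)
    then show ?thesis by (simp add: isCont_def H_def)
  qed
  have der: "DERIV H x :> slab_g x - std_normal_density x" if "x \<noteq> 0" for x
  proof -
    have "DERIV (\<lambda>x. - (1 - exp (- (x\<^sup>2) / 2)) / (x * sqrt (2 * pi))) x :> slab_g x - std_normal_density x"
      using that unfolding slab_g_def std_normal_density_def
      by (auto intro!: derivative_eq_intros simp: field_simps power2_eq_square)
    moreover have ev: "\<forall>\<^sub>F z in nhds x. - (1 - exp (- (z\<^sup>2) / 2)) / (z * sqrt (2 * pi)) = H z"
      using t1_space_nhds[OF that] by (rule eventually_mono) (simp add: H_def)
    have "DERIV (\<lambda>x. - (1 - exp (- (x\<^sup>2) / 2)) / (x * sqrt (2 * pi))) x :> d \<longleftrightarrow> DERIV H x :> d" for d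
      by (rule DERIV_cong_ev[OF refl ev refl])
    ultimately show ?thesis by simp
  qed
  have "((\<lambda>x. slab_g x - std_normal_density x) has_integral (H R - H (- R))) {- R..R}"
  proof (rule fundamental_theorem_of_calculus_interior_strong[where S = "{0}"])
    show "(H has_vector_derivative slab_g x - std_normal_density x) (at x)" if "x \<in> {- R<..<R} - {0}" for x
      using der[of x] that by (simp add: has_real_derivative_iff_has_vector_derivative)
    show "continuous_on {- R..R} H"
      using cont0 DERIV_isCont[OF der] by (intro continuous_at_imp_continuous_on ballI) metis
  qed (use assms in auto)
  moreover have "H R - H (- R) = - (2 * (1 - exp (- (R\<^sup>2) / 2)) / (R * sqrt (2 * pi)))"
    using assms by (simp add: H_def field_simps)
  ultimately show ?thesis by simp
qed

text \<open>On each symmetric interval the slab has no more mass than the Gaussian, by the sign of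
  the explicit difference; monotone convergence gives the whole line.\<close>

lemma slab_mass_le_1: "(\<integral>\<^sup>+x. ennreal (slab_g x) \<partial>lborel) \<le> 1"
proof -
  have part: "(\<integral>\<^sup>+x. ennreal (slab_g x) * indicator {- R..R} x \<partial>lborel) \<le> 1" if R: "0 < R" for R :: real
  proof -
    obtain I where I: "(std_normal_density has_integral I) {- R..R}"
    proof -
      have "continuous_on {- R..R} std_normal_density"
        unfolding std_normal_density_def by (intro continuous_intros) auto
      from integrable_integral[OF integrable_continuous_interval[OF this]] that show ?thesis by blast
    qed
    define D where "D = 2 * (1 - exp (- (R\<^sup>2) / 2)) / (R * sqrt (2 * pi))"
    have D: "0 \<le> D" using R by (auto simp: D_def intro!: divide_nonneg_nonneg)
    have "((\<lambda>x. slab_g x - std_normal_density x + std_normal_density x) has_integral (- D + I)) {- R..R}"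
      unfolding D_def by (intro has_integral_add slab_minus_gauss_has_integral R I)
    then have S: "(slab_g has_integral (I - D)) {- R..R}" by simp
    have nn: "(\<integral>\<^sup>+x. ennreal (h x) * indicator {- R..R} x \<partial>lborel) = ennreal J"
      if "(h has_integral J) {- R..R}" "\<And>x. 0 \<le> h x" "h \<in> borel_measurable borel" for h :: "real \<Rightarrow> real" and J
    proof -
      have "((\<lambda>x. h x * indicator {- R..R} x) has_integral J) UNIV"
      proof -
        have "(\<lambda>x. h x * indicator {- R..R} x) = (\<lambda>x. if x \<in> {- R..R} then h x else 0)"
          by (auto simp: fun_eq_iff)
        then show ?thesis using has_integral_restrict_UNIV[of "{- R..R}" h J] that(1) by simp
      qed
      from nn_integral_has_integral_lborel[OF _ _ this]
      have "(\<integral>\<^sup>+x. ennreal (h x * indicator {- R..R} x) \<partial>lborel) = ennreal J"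
        using that by simp
      then show ?thesis by (simp add: ennreal_mult' ennreal_indicator that(2))
    qed
    have "(\<integral>\<^sup>+x. ennreal (slab_g x) * indicator {- R..R} x \<partial>lborel) = ennreal (I - D)"
      by (rule nn[OF S slab_g_nonneg measurable_slab_g])
    also have "\<dots> \<le> ennreal I" using D by (intro ennreal_leI) simp
    also have "\<dots> = (\<integral>\<^sup>+x. ennreal (std_normal_density x) * indicator {- R..R} x \<partial>lborel)"
      by (rule nn[OF I, symmetric]) auto
    also have "\<dots> = emeasure std_gauss {- R..R}" by (simp add: emeasure_std_gauss)
    also have "\<dots> \<le> 1" by (rule std_gauss.emeasure_le_1)
    finally show ?thesis .
  qed
  have "(\<lambda>k. \<integral>\<^sup>+x. ennreal (slab_g x) * indicator {- real (Suc k)..real (Suc k)} x \<partial>lborel)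
      \<longlonglongrightarrow> (\<integral>\<^sup>+x. ennreal (slab_g x) \<partial>lborel)"
  proof (rule nn_integral_LIMSEQ)
    show "incseq (\<lambda>k x. ennreal (slab_g x) * indicator {- real (Suc k)..real (Suc k)} x)"
      by (auto simp: incseq_def le_fun_def indicator_def)
    fix x :: real
    obtain m :: nat where m: "\<bar>x\<bar> \<le> real m" using real_arch_simple by blast
    have "\<forall>\<^sub>F k in sequentially. ennreal (slab_g x) * indicator {- real (Suc k)..real (Suc k)} x = ennreal (slab_g x)"
      using eventually_ge_at_top[of m] by eventually_elim (use m in \<open>auto simp: indicator_def\<close>)
    then show "(\<lambda>k. ennreal (slab_g x) * indicator {- real (Suc k)..real (Suc k)} x) \<longlonglongrightarrow> ennreal (slab_g x)"
      by (rule tendsto_eventually)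
  qed measurable
  then show ?thesis
    by (rule LIMSEQ_le_const2) (intro exI[of _ 0] allI impI part, simp)
qed

lemma nn_integral_slab_ratio: "(\<integral>\<^sup>+y. ennreal (slab_ratio y) \<partial>std_gauss) \<le> 1"
proof -
  have "(\<integral>\<^sup>+y. ennreal (slab_ratio y) \<partial>std_gauss) = (\<integral>\<^sup>+y. ennreal (slab_g y) \<partial>lborel)"
    by (subst nn_integral_std_gauss)
       (auto intro!: nn_integral_cong simp: slab_g_eq ennreal_mult slab_ratio_nonneg mult.commute)
  then show ?thesis using slab_mass_le_1 by simp
qed

text \<open>One coordinate's factor in the likelihood ratio of weight \<open>w\<close> against
  \<open>w / 2\<close>. Against weight 0 the factor would be unbounded; here it is at most
  2.\<close>

definition weight_ratio :: "real \<Rightarrow> real \<Rightarrow> real" where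
  "weight_ratio w x = (1 + w * slab_beta x) / (1 + w / 2 * slab_beta x)"

text \<open>Because \<open>slab_beta\<close> is at least -1/2, the mixture stays above half of the
  null density, which keeps logarithms and quotients safe for all weights.\<close>

lemma mixture_pos:
  assumes "0 \<le> w" "w \<le> 1"
  shows "1 / 2 \<le> 1 + w * slab_beta x"
proof -
  have "w * (- 1 / 2) \<le> w * slab_beta x" using assms slab_beta_ge by (intro mult_left_mono) auto
  then show ?thesis using assms by simp
qed

lemma weight_ratio_bounds:
  assumes "0 \<le> w" "w \<le> 1"
  shows "0 \<le> weight_ratio w x" "weight_ratio w x \<le> 2"
  using mixture_pos[OF assms, of x] mixture_pos[of "w / 2" x] assms
  by (auto simp: weight_ratio_def pos_divide_le_eq)

lemma slab_g_lower:
  assumes "2 \<le> x"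
  shows "1 / (6 * x\<^sup>2) \<le> slab_g x"
proof -
  have "x\<^sup>2 \<ge> 2\<^sup>2" using assms by (intro power_mono) auto
  then have "exp (- (x\<^sup>2) / 2) \<le> exp (- 2)" by simp
  also have "exp (- 2 :: real) \<le> 1 / 2"
    using exp_ge_add_one_self[of "2::real"] by (simp add: exp_minus field_simps)
  finally have e: "1 / 2 \<le> 1 - exp (- (x\<^sup>2) / 2)" by simp
  have "sqrt (2 * pi) \<le> 3" using pi_less_4 by (intro real_le_lsqrt) auto
  then have "1 / 3 \<le> 1 / sqrt (2 * pi)" by (simp add: frac_le)
  then have "1 / 3 * (1 / 2) / x\<^sup>2 \<le> 1 / sqrt (2 * pi) * (1 - exp (- (x\<^sup>2) / 2)) / x\<^sup>2"
    using e by (intro divide_right_mono mult_mono) auto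
  then show ?thesis using assms by (simp add: slab_g_def)
qed

text \<open>Since \<open>slab_beta\<close> integrates to at most \<open>0\<close>, the deficit of the mean ratio below \<open>1\<close> is the
  integral of $(w^2/4)\beta^2/(1+w\beta/2)$, bounded below by its part over \<open>{T..2*T}\<close>.\<close>

lemma nn_integral_weight_ratio:
  assumes w: "0 < w" "w \<le> 1" and T: "2 \<le> T" and large: "2 \<le> w * slab_beta T"
  shows "(\<integral>\<^sup>+y. ennreal (weight_ratio w y) \<partial>std_gauss) \<le> ennreal (exp (- (w / (192 * T))))"
proof -
  \<comment> \<open>The bonus has height w/(192 T^2) on an interval of length T and integrates to
    w/(192 T). Here 192 = 8 * 24, and 24 comes from the slab bound 1/(6 x^2) at x \<le> 2T.\<close>
  have pt: "std_normal_density x * weight_ratio w x + w / (192 * T\<^sup>2) * indicator {T..2 * T} x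
      \<le> (1 - w / 2) * std_normal_density x + w / 2 * slab_g x" for x
  proof -
    let ?\<beta> = "slab_beta x" and ?d = "std_normal_density x"
    have d: "0 < ?d" by (simp add: normal_density_pos)
    have pos: "1 / 2 \<le> 1 + w / 2 * ?\<beta>" using mixture_pos[of "w / 2" x] w by simp
    \<comment> \<open>With u = w \<beta>/2 this is (1 + 2u)/(1 + u) = 1 + u - u^2/(1 + u): a linear
      part that integrates to at most 1, and a deficit.\<close>
    have "weight_ratio w x = 1 + w / 2 * ?\<beta> - w\<^sup>2 / 4 * ?\<beta>\<^sup>2 / (1 + w / 2 * ?\<beta>)"
      using pos unfolding weight_ratio_def by (simp add: field_simps power2_eq_square)
    then have "?d * weight_ratio w x = ?d * (1 + w / 2 * ?\<beta>) - ?d * (w\<^sup>2 / 4 * ?\<beta>\<^sup>2 / (1 + w / 2 * ?\<beta>))"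
      by (simp only: right_diff_distrib)
    also have "?d * (1 + w / 2 * ?\<beta>) = (1 - w / 2) * ?d + w / 2 * slab_g x"
      by (simp add: slab_g_eq slab_beta_eq field_simps)
    finally have eq: "?d * weight_ratio w x
        = (1 - w / 2) * ?d + w / 2 * slab_g x - ?d * (w\<^sup>2 / 4 * ?\<beta>\<^sup>2 / (1 + w / 2 * ?\<beta>))" .
    have "w / (192 * T\<^sup>2) * indicator {T..2 * T} x \<le> ?d * (w\<^sup>2 / 4 * ?\<beta>\<^sup>2 / (1 + w / 2 * ?\<beta>))"
    proof (cases "x \<in> {T..2 * T}")
      case True
      have "slab_beta T \<le> ?\<beta>"
        using True T slab_ratio_mono[of T x] by (simp add: slab_beta_eq)
      then have wb: "2 \<le> w * ?\<beta>" using w large by (meson mult_left_mono less_imp_le order_trans)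
      have b0: "0 < ?\<beta>"
        using wb w by (metis less_le_trans zero_less_mult_pos zero_less_numeral)
      have "w * ?\<beta> \<le> 1 * ?\<beta>" using w b0 by (intro mult_right_mono) auto
      with wb have b2: "2 \<le> ?\<beta>" by linarith
      have x: "2 \<le> x" "x \<le> 2 * T" using True T by auto
      have "x\<^sup>2 \<le> (2 * T)\<^sup>2" using x by (intro power_mono) auto
      then have "1 / (24 * T\<^sup>2) \<le> 1 / (6 * x\<^sup>2)" using x by (intro divide_left_mono) (auto simp: power2_eq_square)
      also have "\<dots> \<le> slab_g x" by (rule slab_g_lower[OF x(1)])
      also have "\<dots> = (1 + ?\<beta>) * ?d" by (simp add: slab_g_eq slab_beta_eq)
      also have "\<dots> \<le> (2 * ?\<beta>) * ?d" using b2 d by (intro mult_right_mono) auto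
      finally have "1 / (24 * T\<^sup>2) \<le> 2 * ?\<beta> * ?d" .
      then have "w / 8 * (1 / (24 * T\<^sup>2)) \<le> w / 8 * (2 * ?\<beta> * ?d)" using w by (intro mult_left_mono) auto
      also have "\<dots> = ?d * (w / 4 * ?\<beta>)" by simp
      also have "\<dots> \<le> ?d * (w\<^sup>2 / 4 * ?\<beta>\<^sup>2 / (1 + w / 2 * ?\<beta>))"
      proof (rule mult_left_mono)
        \<comment> \<open>Once w \<beta> \<ge> 2 the denominator is at most w \<beta>, so the
          quadratic deficit is at least linear in \<beta> and thus comparable to the slab.\<close>
        have "w / 4 * ?\<beta> * (1 + w / 2 * ?\<beta>) \<le> w / 4 * ?\<beta> * (w * ?\<beta>)"
          using w b0 wb by (intro mult_left_mono) auto
        also have "\<dots> = w\<^sup>2 / 4 * ?\<beta>\<^sup>2" by (simp add: power2_eq_square)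
        finally show "w / 4 * ?\<beta> \<le> w\<^sup>2 / 4 * ?\<beta>\<^sup>2 / (1 + w / 2 * ?\<beta>)"
          using pos by (subst pos_le_divide_eq) auto
      qed (use d in simp)
      finally show ?thesis using True by simp
    next
      case False
      have "0 \<le> ?d * (w\<^sup>2 / 4 * ?\<beta>\<^sup>2 / (1 + w / 2 * ?\<beta>))"
        using d pos by (intro mult_nonneg_nonneg divide_nonneg_nonneg) auto
      then show ?thesis using False by simp
    qed
    then show ?thesis using eq by linarith
  qed
  have [measurable]: "weight_ratio w \<in> borel_measurable borel" unfolding weight_ratio_def[abs_def] by measurable
  have wr: "0 \<le> weight_ratio w x" for x using weight_ratio_bounds(1) w by simp
  \<comment> \<open>The deficit is added on the left instead of being subtracted on the right, since
    extended nonnegative integrals do not subtract well.\<close>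
  have "(\<integral>\<^sup>+y. ennreal (weight_ratio w y) \<partial>std_gauss) + ennreal (w / (192 * T))
      = (\<integral>\<^sup>+x. ennreal (std_normal_density x) * ennreal (weight_ratio w x) \<partial>lborel)
        + (\<integral>\<^sup>+x. ennreal (w / (192 * T\<^sup>2)) * indicator {T..2 * T} x \<partial>lborel)"
  proof -
    have "(\<integral>\<^sup>+x. ennreal (w / (192 * T\<^sup>2)) * indicator {T..2 * T} x \<partial>lborel) = ennreal (w / (192 * T\<^sup>2)) * ennreal T"
      using T by (subst nn_integral_cmult_indicator) auto
    also have "\<dots> = ennreal (w / (192 * T))"
      using T w by (simp add: ennreal_mult[symmetric] power2_eq_square)
    finally show ?thesis by (simp add: nn_integral_std_gauss)
  qed
  also have "\<dots> = (\<integral>\<^sup>+x. ennreal (std_normal_density x * weight_ratio w x + w / (192 * T\<^sup>2) * indicator {T..2 * T} x) \<partial>lborel)"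
  proof (subst nn_integral_add[symmetric], measurable, rule nn_integral_cong)
    fix x
    have "ennreal (w / (192 * T\<^sup>2)) * indicator {T..2 * T} x = ennreal (w / (192 * T\<^sup>2) * indicator {T..2 * T} x)"
      by (simp add: indicator_def)
    moreover have "ennreal (std_normal_density x) * ennreal (weight_ratio w x) = ennreal (std_normal_density x * weight_ratio w x)"
      using wr by (simp add: ennreal_mult)
    ultimately show "ennreal (std_normal_density x) * ennreal (weight_ratio w x) + ennreal (w / (192 * T\<^sup>2)) * indicator {T..2 * T} x
        = ennreal (std_normal_density x * weight_ratio w x + w / (192 * T\<^sup>2) * indicator {T..2 * T} x)"
      using w wr by (simp only:) (intro ennreal_plus[symmetric] mult_nonneg_nonneg; simp)
  qed
  also have "\<dots> \<le> (\<integral>\<^sup>+x. ennreal ((1 - w / 2) * std_normal_density x + w / 2 * slab_g x) \<partial>lborel)"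
    by (intro nn_integral_mono ennreal_leI pt)
  also have "\<dots> = (\<integral>\<^sup>+x. ennreal (1 - w / 2) * ennreal (std_normal_density x) + ennreal (w / 2) * ennreal (slab_g x) \<partial>lborel)"
    using w slab_g_nonneg by (intro nn_integral_cong)
      (simp add: ennreal_mult[symmetric] ennreal_plus[symmetric] del: ennreal_plus)
  also have "\<dots> = ennreal (1 - w / 2) * (\<integral>\<^sup>+x. ennreal (std_normal_density x) \<partial>lborel)
      + ennreal (w / 2) * (\<integral>\<^sup>+x. ennreal (slab_g x) \<partial>lborel)"
    by (simp add: nn_integral_add nn_integral_cmult)
  also have "(\<integral>\<^sup>+x. ennreal (std_normal_density x) \<partial>lborel) = 1"
    using emeasure_std_gauss[of UNIV] std_gauss.emeasure_space_1 by simp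
  also have "ennreal (1 - w / 2) * 1 + ennreal (w / 2) * (\<integral>\<^sup>+x. ennreal (slab_g x) \<partial>lborel)
      \<le> ennreal (1 - w / 2) * 1 + ennreal (w / 2) * 1"
    by (intro add_left_mono mult_left_mono slab_mass_le_1) auto
  also have "\<dots> = 1" using w by (simp flip: ennreal_plus)
  finally have sum_le: "(\<integral>\<^sup>+y. ennreal (weight_ratio w y) \<partial>std_gauss) + ennreal (w / (192 * T)) \<le> 1" .
  then have "(\<integral>\<^sup>+y. ennreal (weight_ratio w y) \<partial>std_gauss) \<le> 1 - ennreal (w / (192 * T))"
    by (subst ennreal_le_minus_iff) (auto simp: add.commute intro: order_trans[rotated])
  also have "\<dots> = ennreal (1 - w / (192 * T))"
    using w T by (simp add: ennreal_minus flip: ennreal_1)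
  also have "\<dots> \<le> ennreal (exp (- (w / (192 * T))))"
    using exp_ge_add_one_self[of "- (w / (192 * T))"] by (intro ennreal_leI) simp
  finally show ?thesis .
qed

subsection \<open>Empirical Bayes weights\<close>

text \<open>The derivative of the log-likelihood in the weight.\<close>

definition score :: "nat \<Rightarrow> (nat \<Rightarrow> real) \<Rightarrow> real \<Rightarrow> real" where
  "score n x w = (\<Sum>i\<in>{1..n}. slab_beta (x i) / (1 + w * slab_beta (x i)))"

lemma log_marginal_tangent_term:
  assumes "0 \<le> v" "v \<le> 1" "0 \<le> w" "w \<le> 1"
  shows "ln (1 + v * slab_beta y) - ln (1 + w * slab_beta y) \<le> (v - w) * (slab_beta y / (1 + w * slab_beta y))"
proof -
  have pos: "0 < 1 + v * slab_beta y" "0 < 1 + w * slab_beta y"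
    using mixture_pos[of v y] mixture_pos[of w y] assms by linarith+
  have "ln (1 + v * slab_beta y) - ln (1 + w * slab_beta y)
      \<le> (1 + v * slab_beta y - (1 + w * slab_beta y)) / (1 + w * slab_beta y)"
    by (rule ln_diff_le[OF pos])
  also have "1 + v * slab_beta y - (1 + w * slab_beta y) = (v - w) * slab_beta y" by (simp add: algebra_simps)
  finally show ?thesis by simp
qed

lemma log_marginal_tangent_term_strict:
  assumes "0 \<le> v" "v \<le> 1" "0 \<le> w" "w \<le> 1" "v \<noteq> w" "slab_beta y \<noteq> 0"
  shows "ln (1 + v * slab_beta y) - ln (1 + w * slab_beta y) < (v - w) * (slab_beta y / (1 + w * slab_beta y))"
proof -
  let ?r = "(1 + v * slab_beta y) / (1 + w * slab_beta y)"
  have pos: "0 < 1 + v * slab_beta y" "0 < 1 + w * slab_beta y"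
    using mixture_pos[of v y] mixture_pos[of w y] assms by linarith+
  then have r: "0 < ?r" by simp
  have "?r \<noteq> 1" using pos assms by simp
  then have "ln ?r < ?r - 1" using ln_le_minus_one[OF r] ln_eq_minus_one[OF r] by linarith
  moreover have "ln ?r = ln (1 + v * slab_beta y) - ln (1 + w * slab_beta y)" using pos by (simp add: ln_div)
  moreover have "?r - 1 = (v - w) * (slab_beta y / (1 + w * slab_beta y))"
    using pos by (simp add: field_simps)
  ultimately show ?thesis by simp
qed

text \<open>Concavity in the weight, in tangent-line form: the sign of the score at one point
  locates the maximiser relative to it.\<close>

lemma log_marginal_tangent:
  assumes "0 \<le> v" "v \<le> 1" "0 \<le> w" "w \<le> 1"
  shows "log_marginal n x v - log_marginal n x w \<le> (v - w) * score n x w"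
  unfolding log_marginal_def score_def sum_subtractf[symmetric] sum_distrib_left
  by (intro sum_mono log_marginal_tangent_term assms)

lemma log_marginal_tangent_strict:
  assumes "0 \<le> v" "v \<le> 1" "0 \<le> w" "w \<le> 1" "v \<noteq> w" "i \<in> {1..n}" "slab_beta (x i) \<noteq> 0"
  shows "log_marginal n x v - log_marginal n x w < (v - w) * score n x w"
  unfolding log_marginal_def score_def sum_subtractf[symmetric] sum_distrib_left
proof (rule sum_strict_mono_ex1)
  show "\<forall>j\<in>{1..n}. ln (1 + v * slab_beta (x j)) - ln (1 + w * slab_beta (x j))
      \<le> (v - w) * (slab_beta (x j) / (1 + w * slab_beta (x j)))"
    by (intro ballI log_marginal_tangent_term assms)
  show "\<exists>j\<in>{1..n}. ln (1 + v * slab_beta (x j)) - ln (1 + w * slab_beta (x j))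
      < (v - w) * (slab_beta (x j) / (1 + w * slab_beta (x j)))"
    using assms by (intro bexI[of _ i] log_marginal_tangent_term_strict) auto
qed simp

text \<open>\<open>critical_weight\<close> is the weight at which the \<open>l\<close>-value crosses the threshold
  \<open>t\<close>, where \<open>\<rho> = (1 - t) / t\<close>.\<close>

definition critical_weight :: "real \<Rightarrow> real \<Rightarrow> real" where
  "critical_weight \<rho> y = \<rho> / (\<rho> + slab_ratio y)"

lemma measurable_critical_weight [measurable]: "critical_weight \<rho> \<in> borel_measurable borel"
  unfolding critical_weight_def[abs_def] by measurable

lemma critical_weight_bounds:
  assumes "0 < \<rho>"
  shows "0 < critical_weight \<rho> y" "critical_weight \<rho> y < 1"
  using slab_ratio_ge_half[of y] assms by (auto simp: critical_weight_def)

lemma critical_weight_less_iff: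
  assumes "0 < \<rho>"
  shows "critical_weight \<rho> y < w \<longleftrightarrow> \<rho> < w * (\<rho> + slab_ratio y)"
proof -
  have "0 < \<rho> + slab_ratio y" using slab_ratio_ge_half[of y] assms by linarith
  then show ?thesis by (simp add: critical_weight_def pos_divide_less_eq)
qed

lemma ell_value_less_iff:
  assumes t: "0 < t" "t < 1" and w: "0 < w" "w \<le> 1"
  shows "ell_value w y < t \<longleftrightarrow> critical_weight ((1 - t) / t) y < w"
proof -
  let ?\<rho> = "(1 - t) / t" and ?d = "std_normal_density y" and ?u = "slab_ratio y"
  have d: "0 < ?d" by (simp add: normal_density_pos)
  have u: "1 / 2 \<le> ?u" by (rule slab_ratio_ge_half)
  have den: "0 < (1 - w) + w * ?u" using w u by (intro add_nonneg_pos mult_pos_pos) auto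
  have "(1 - w) * ?d + w * slab_g y = ((1 - w) + w * ?u) * ?d" by (simp add: slab_g_eq algebra_simps)
  then have "ell_value w y = (1 - w) / ((1 - w) + w * ?u)"
    using d by (simp add: ell_value_def)
  then have "ell_value w y < t \<longleftrightarrow> 1 - w < t * ((1 - w) + w * ?u)"
    using den by (simp add: pos_divide_less_eq)
  also have "\<dots> \<longleftrightarrow> t * ?\<rho> < t * (w * (?\<rho> + ?u))"
  proof -
    have "t * ?\<rho> = 1 - t" using t by simp
    moreover from this have "t * (w * (?\<rho> + ?u)) = w * (1 - t) + t * (w * ?u)"
      by (metis distrib_left mult.left_commute)
    ultimately show ?thesis by (simp only:) (auto simp: algebra_simps)
  qed
  also have "\<dots> \<longleftrightarrow> ?\<rho> < w * (?\<rho> + ?u)" by (rule mult_less_cancel_left_pos[OF t(1)])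
  also have "\<dots> \<longleftrightarrow> critical_weight ?\<rho> y < w" using t by (intro critical_weight_less_iff[symmetric]) simp
  finally show ?thesis .
qed

section \<open>The maximising weight: location, measurability, detection and null rejections\<close>

locale mml =
  fixes w :: "nat \<Rightarrow> (nat \<Rightarrow> real) \<Rightarrow> real" and t \<rho> :: real
  assumes mml: "mml_weight w" and t: "0 < t" "t < 1" and rho: "\<rho> = (1 - t) / t"
begin

lemma rho_pos: "0 < \<rho>"
  using t by (simp add: rho)

lemma weight_range: "1 \<le> n \<Longrightarrow> 1 / real n \<le> w n x" "1 \<le> n \<Longrightarrow> w n x \<le> 1"
  using mml by (auto simp: mml_weight_def is_arg_max_def)

lemma weight_maximal: "1 \<le> n \<Longrightarrow> 1 / real n \<le> v \<Longrightarrow> v \<le> 1 \<Longrightarrow> log_marginal n x v \<le> log_marginal n x (w n x)"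
  using mml by (force simp: mml_weight_def is_arg_max_def not_less)

lemma weight_pos: "1 \<le> n \<Longrightarrow> 0 < w n x"
  using weight_range(1)[of n x] by (rule less_le_trans[rotated]) auto

lemma reject_iff:
  assumes "i \<in> {1..n}"
  shows "ell_procedure w t n x i \<noteq> 0 \<longleftrightarrow> critical_weight \<rho> (x i) < w n x"
proof -
  have "1 \<le> n" using assms by simp
  then show ?thesis
    using assms ell_value_less_iff[OF t weight_pos weight_range(2), of n x "x i"]
    by (simp add: ell_procedure_def rho)
qed

lemma weight_ge_if_score_pos:
  assumes "1 \<le> n" "1 / real n \<le> v" "v \<le> 1" "0 < score n x v"
  shows "v \<le> w n x"
proof (rule ccontr)
  assume "\<not> v \<le> w n x"
  then have "(w n x - v) * score n x v < 0" using assms by (intro mult_neg_pos) auto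
  moreover have "0 \<le> v" using assms(2) by (rule order_trans[rotated]) simp
  then have "log_marginal n x (w n x) - log_marginal n x v \<le> (w n x - v) * score n x v"
    using weight_pos[OF assms(1), of x] weight_range(2)[OF assms(1), of x] assms
    by (intro log_marginal_tangent) auto
  ultimately show False using weight_maximal[OF assms(1-3), of x] by linarith
qed

text \<open>Strict concavity is essential: if all \<open>slab_beta (x j)\<close> vanish, the score
  is 0 everywhere while the chosen maximiser may lie anywhere.\<close>

lemma score_pos_if_less_weight:
  assumes "i \<in> {1..n}" "slab_beta (x i) \<noteq> 0" "1 / real n \<le> v" "v < w n x"
  shows "0 < score n x v"
proof -
  have n: "1 \<le> n" using assms(1) by simp
  have v: "0 \<le> v" "v \<le> 1" using assms(3) order_trans[of 0 "1 / real n" v] assms(4) weight_range(2)[OF n, of x] by auto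
  have "log_marginal n x (w n x) - log_marginal n x v < (w n x - v) * score n x v"
    using weight_pos[OF n, of x] weight_range(2)[OF n, of x] assms v
    by (intro log_marginal_tangent_strict[where i = i]) auto
  then have "0 < (w n x - v) * score n x v" using weight_maximal[OF n assms(3) v(2), of x] by linarith
  then show ?thesis using assms(4) by (simp add: zero_less_mult_iff)
qed

text \<open>Where every \<open>slab_beta (x j)\<close> vanishes the maximiser is an arbitrary choice, but this
  happens only on a finite set of data vectors, all of whose subsets are measurable.\<close>

lemma procedure_measurable:
  assumes "1 \<le> n"
  shows "ell_procedure w t n \<in> procedures n"
proof -
  have "{x \<in> {1..n} \<rightarrow>\<^sub>E UNIV. ell_value (w n x) (x i) < t} \<in> sets (seq_space n)" if i: "i \<in> {1..n}" for i
  proof -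
    define Z where "Z = ({1..n} \<rightarrow>\<^sub>E {y. slab_beta y = 0})"
    have finZ: "finite Z" unfolding Z_def by (intro finite_PiE finite_slab_beta_zeros) auto
    have singleton: "{x} \<in> sets (seq_space n)" if "x \<in> Z" for x
    proof -
      have "x \<in> extensional {1..n}" using that by (auto simp: Z_def PiE_def)
      then have "{x} = (\<Pi>\<^sub>E j\<in>{1..n}. {x j})" by (simp add: PiE_singleton)
      also have "\<dots> \<in> sets (seq_space n)" unfolding seq_space_def by (rule sets_PiM_I_finite) auto
      finally show ?thesis .
    qed
    have sub: "A \<in> sets (seq_space n)" if "A \<subseteq> Z" for A
      by (rule sets.countable) (use that singleton finite_subset[OF that finZ] in \<open>auto intro: countable_finite\<close>)
    \<comment> \<open>A rational weight strictly between the critical weight and the maximiser has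
      positive score. This turns the comparison with the maximiser into countably many conditions on
      scores, each measurable in the data.\<close>
    define D where "D x \<longleftrightarrow> critical_weight \<rho> (x i) < 1 / n \<or>
        (\<exists>r::rat. critical_weight \<rho> (x i) < of_rat r \<and> 1 / n \<le> real_of_rat r \<and> real_of_rat r \<le> 1 \<and> 0 < score n x (of_rat r))" for x
    have score_meas [measurable]: "(\<lambda>x. score n x v) \<in> borel_measurable (seq_space n)" for v
    proof -
      have "(\<lambda>x. slab_beta (x j) / (1 + v * slab_beta (x j))) \<in> borel_measurable (seq_space n)" for j
        by measurable
      then show ?thesis unfolding score_def by (intro borel_measurable_sum)
    qed
    have crit [measurable]: "(\<lambda>x. critical_weight \<rho> (x i)) \<in> borel_measurable (seq_space n)" by measurable
    have "{x \<in> space (seq_space n). D x} \<in> sets (seq_space n)"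
      unfolding D_def
      by (intro sets.sets_Collect_disj sets.sets_Collect_countable_Ex sets.sets_Collect_conj; measurable)
    then have D_meas: "{x \<in> {1..n} \<rightarrow>\<^sub>E UNIV. D x} \<in> sets (seq_space n)" by simp
    have D_iff: "critical_weight \<rho> (x i) < w n x \<longleftrightarrow> D x" if x: "x \<in> {1..n} \<rightarrow>\<^sub>E UNIV" "x \<notin> Z" for x
    proof
      obtain j where j: "j \<in> {1..n}" "slab_beta (x j) \<noteq> 0" using x by (auto simp: Z_def PiE_iff)
      assume less: "critical_weight \<rho> (x i) < w n x"
      show "D x"
      proof (cases "critical_weight \<rho> (x i) < 1 / n")
        case False
        from of_rat_dense[OF less] obtain r where r: "critical_weight \<rho> (x i) < of_rat r" "real_of_rat r < w n x" by blast
        have "1 / n \<le> real_of_rat r" using False r(1) by linarith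
        moreover from score_pos_if_less_weight[OF j this r(2)] have "0 < score n x (of_rat r)" .
        moreover have "real_of_rat r \<le> 1" using r(2) weight_range(2)[OF assms, of x] by linarith
        ultimately show ?thesis unfolding D_def using r(1) by blast
      qed (simp add: D_def)
    next
      assume "D x"
      then show "critical_weight \<rho> (x i) < w n x"
        unfolding D_def using weight_range(1)[OF assms, of x] weight_ge_if_score_pos[OF assms, of _ x]
        by (meson less_le_trans)
    qed
    have "{x \<in> {1..n} \<rightarrow>\<^sub>E UNIV. critical_weight \<rho> (x i) < w n x}
        = ({x \<in> {1..n} \<rightarrow>\<^sub>E UNIV. D x} - Z) \<union> ({x \<in> {1..n} \<rightarrow>\<^sub>E UNIV. critical_weight \<rho> (x i) < w n x} \<inter> Z)"
      using D_iff by blast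
    also have "\<dots> \<in> sets (seq_space n)"
      by (intro sets.Un sets.Diff D_meas sub) auto
    finally show ?thesis
      using assms by (simp add: ell_value_less_iff[OF t weight_pos weight_range(2)] rho)
  qed
  from of_bool_in_procedures[OF this] show ?thesis
    unfolding ell_procedure_def[abs_def] by simp
qed

text \<open>At v = \<kappa> s/(4n) each of the at least \<kappa> s large observations adds 1/(2v) or
  more to the score, in total 2n, while every other term is at least -1. The score is positive, so
  the maximiser is at least \<open>v\<close>, and at \<open>T\<close> the critical weight is already
  below \<open>v\<close>.\<close>

lemma detect_fixed:
  fixes s :: nat and \<kappa> :: real
  assumes \<kappa>: "0 < \<kappa>" and large: "4 \<le> \<kappa> * s"
    and T: "0 \<le> T" "1 + 4 * real n / (\<kappa> * s) \<le> slab_ratio T" "\<rho> * (4 * real n / (\<kappa> * s)) < slab_ratio T"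
    and count: "\<kappa> * s \<le> real (card {i \<in> {1..n}. T \<le> \<bar>x i\<bar>})" and i: "i \<in> {1..n}" "T \<le> \<bar>x i\<bar>"
  shows "ell_procedure w t n x i \<noteq> 0"
proof -
  have n: "1 \<le> n" using i by simp
  define A where "A = {i \<in> {1..n}. T \<le> \<bar>x i\<bar>}"
  define v where "v = \<kappa> * s / (4 * n)"
  have A: "A \<subseteq> {1..n}" "finite A" by (auto simp: A_def)
  have "card A \<le> card {1..n}" using A by (intro card_mono) auto
  then have "\<kappa> * s \<le> n" using count by (simp add: A_def)
  then have v: "1 / real n \<le> v" "0 < v" "v \<le> 1" using large n by (auto simp: v_def field_simps)
  have "s \<noteq> 0" using large by (cases "s = 0") auto
  have inv_v: "4 * real n / (\<kappa> * s) = 1 / v" using large n by (simp add: v_def)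
  have big: "1 / v \<le> slab_beta (x j)" if "j \<in> A" for j
  proof -
    have "slab_ratio T \<le> slab_ratio (x j)"
      using that T(1) by (intro slab_ratio_mono) (simp add: A_def)
    with T(2)[unfolded inv_v] show ?thesis by (simp add: slab_beta_eq)
  qed
  have small: "- 1 \<le> slab_beta y / (1 + v * slab_beta y)" for y
  proof -
    have "1 / 2 \<le> 1 + v * slab_beta y" using mixture_pos[of v y] v by simp
    moreover have "- (1 + v * slab_beta y) \<le> slab_beta y"
    proof (cases "0 \<le> slab_beta y")
      case True
      then have "0 \<le> v * slab_beta y" using v by simp
      then show ?thesis using True by simp
    next
      case False
      then show ?thesis using \<open>1 / 2 \<le> 1 + v * slab_beta y\<close> slab_beta_ge[of y] by linarith
    qed
    ultimately show ?thesis by (subst pos_le_divide_eq) auto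
  qed
  have large_term: "1 / (2 * v) \<le> slab_beta (x j) / (1 + v * slab_beta (x j))" if "j \<in> A" for j
  proof -
    have "1 \<le> v * slab_beta (x j)" using big[OF that] v by (simp add: field_simps)
    then show ?thesis using v by (simp add: field_simps)
  qed
  have "n = 2 * n - real n" by simp
  also have "\<dots> \<le> card A * (1 / (2 * v)) - n"
  proof -
    have "\<kappa> * s * (1 / (2 * v)) \<le> card A * (1 / (2 * v))" using count v by (intro mult_right_mono) (auto simp: A_def)
    moreover have "\<kappa> * s * (1 / (2 * v)) = 2 * n"
      using \<open>s \<noteq> 0\<close> \<kappa> n by (simp add: v_def)
    ultimately show ?thesis by simp
  qed
  also have "\<dots> \<le> (\<Sum>j\<in>A. 1 / (2 * v)) + (\<Sum>j\<in>{1..n} - A. - 1)"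
  proof -
    have "real (card ({1..n} - A)) \<le> real (card {1..n})" using card_mono[of "{1..n}" "{1..n} - A"] by force
    then show ?thesis by simp
  qed
  also have "\<dots> \<le> (\<Sum>j\<in>A. slab_beta (x j) / (1 + v * slab_beta (x j))) + (\<Sum>j\<in>{1..n} - A. slab_beta (x j) / (1 + v * slab_beta (x j)))"
    by (intro add_mono sum_mono large_term small)
  also have "\<dots> = score n x v"
    unfolding score_def by (subst sum.subset_diff[OF A(1)]) auto
  finally have "0 < score n x v" using n by simp
  from weight_ge_if_score_pos[OF n v(1,3) this] have vw: "v \<le> w n x" .
  have "\<rho> / v < slab_ratio T" using T(3)[unfolded inv_v] by simp
  also have "\<dots> \<le> slab_ratio (x i)" using slab_ratio_mono[of T "x i"] i T by simp
  finally have "\<rho> < v * slab_ratio (x i)" using v by (simp add: field_simps)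
  then have "\<rho> < v * (\<rho> + slab_ratio (x i))" using v rho_pos by (simp add: distrib_left add_strict_increasing)
  then have "critical_weight \<rho> (x i) < v" by (simp add: critical_weight_less_iff[OF rho_pos])
  then show ?thesis using vw i(1) by (simp add: reject_iff del: neq0_conv)
qed

text \<open>By concavity, \<open>v < w n x\<close> forces the likelihood at \<open>v\<close> to exceed that at \<open>v / 2\<close>; the
  expectation of the likelihood ratio then bounds the probability of this event.\<close>

lemma weight_ratio_prod_ge_1:
  assumes n: "1 \<le> n" and v: "2 / real n \<le> v" "v < w n x"
  shows "1 \<le> (\<Prod>j\<in>{1..n}. weight_ratio v (x j))"
proof -
  have "0 < 2 / real n" using n by simp
  then have v0: "0 < v" using v(1) by linarith
  have v1: "v \<le> 1" using v weight_range(2)[OF n, of x] by linarith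
  have ratio_pos: "0 < weight_ratio v y" for y
  proof -
    have "0 < 1 + v * slab_beta y" "0 < 1 + v / 2 * slab_beta y"
      using mixture_pos[of v y] mixture_pos[of "v / 2" y] v0 v1 by linarith+
    then show ?thesis by (simp add: weight_ratio_def)
  qed
  have "log_marginal n x (v / 2) \<le> log_marginal n x v"
  proof (rule ccontr)
    assume less: "\<not> log_marginal n x (v / 2) \<le> log_marginal n x v"
    \<comment> \<open>A decrease between \<open>v / 2\<close> and \<open>v\<close> forces a negative
      slope at \<open>v\<close>, and concavity then forbids a maximiser beyond
      \<open>v\<close>.\<close>
    have "log_marginal n x (v / 2) - log_marginal n x v \<le> (v / 2 - v) * score n x v"
      using v0 v1 by (intro log_marginal_tangent) auto
    with less have "0 < (v / 2 - v) * score n x v" by linarith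
    moreover have "(v / 2 - v) * score n x v = - (v * score n x v) / 2" by (simp add: field_simps)
    ultimately have "v * score n x v < 0" by linarith
    then have S: "score n x v < 0" using v0 by (simp add: mult_less_0_iff)
    have "log_marginal n x (w n x) - log_marginal n x v \<le> (w n x - v) * score n x v"
      using v0 v1 v weight_range(2)[OF n, of x] by (intro log_marginal_tangent) auto
    also have "\<dots> < 0" using S v(2) by (intro mult_pos_neg) auto
    finally have "log_marginal n x (w n x) < log_marginal n x v" by simp
    moreover have "1 / real n \<le> 2 / real n" by (simp add: divide_right_mono)
    then have "log_marginal n x v \<le> log_marginal n x (w n x)" using v v1 by (intro weight_maximal n) auto
    ultimately show False by simp
  qed
  then have "0 \<le> log_marginal n x v - log_marginal n x (v / 2)" by simp
  also have "\<dots> = (\<Sum>j\<in>{1..n}. ln (weight_ratio v (x j)))"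
    unfolding log_marginal_def sum_subtractf[symmetric]
  proof (rule sum.cong)
    fix j
    have "0 < 1 + v * slab_beta (x j)" "0 < 1 + v / 2 * slab_beta (x j)"
      using mixture_pos[of v "x j"] mixture_pos[of "v / 2" "x j"] v0 v1 by linarith+
    then show "ln (1 + v * slab_beta (x j)) - ln (1 + v / 2 * slab_beta (x j)) = ln (weight_ratio v (x j))"
      by (simp add: weight_ratio_def ln_div)
  qed simp
  also have "\<dots> = ln (\<Prod>j\<in>{1..n}. weight_ratio v (x j))"
  proof (rule ln_prod[symmetric])
    show "weight_ratio v (x j) \<noteq> 0" for j using ratio_pos[of "x j"] by simp
  qed simp
  finally show ?thesis
  proof (rule contrapos_pp)
    assume "\<not> 1 \<le> (\<Prod>j\<in>{1..n}. weight_ratio v (x j))"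
    moreover have "0 < (\<Prod>j\<in>{1..n}. weight_ratio v (x j))"
      by (intro prod_pos ratio_pos)
    ultimately show "\<not> 0 \<le> ln (\<Prod>j\<in>{1..n}. weight_ratio v (x j))" by simp
  qed
qed

text \<open>Small critical weights are given up in the first term. Otherwise the factor of
  \<open>i\<close> and those of the signals cost at most 2^(s+1) \<le> exp(c K/2), and at least n/2
  null factors, independent of X_i, contribute exp(-c K), where c is the critical weight of X_i.
  What remains, exp(-c K/2), is integrated over X_i.\<close>

lemma null_rejection_bound:
  fixes s :: nat
  assumes i: "i \<in> {1..n}" "\<theta> i = 0" and card_S: "card (signal_set n \<theta>) \<le> s"
    and v: "2 / real n \<le> v" and T: "2 \<le> T" "2 \<le> v * slab_beta T"
    and K: "K = n / (384 * T)" and sn: "2 * (s + 1) \<le> n" and sK: "s + 1 \<le> v * K / 2"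
  shows "reject_prob n \<theta> (ell_procedure w t n) i
      \<le> measure std_gauss {y. critical_weight \<rho> y < v} + 8 * (1 + 1 / \<rho>) / (v * K\<^sup>2)"
proof -
  interpret prob_space "noise n" by (rule prob_space_noise)
  have n: "1 \<le> n" using i by simp
  have "0 < 2 / real n" using n by simp
  then have v0: "0 < v" using v by linarith
  have K0: "0 < K" using n T by (simp add: K)
  let ?\<phi> = "ell_procedure w t n" and ?c = "critical_weight \<rho>"
  define J where "J = {1..n} - signal_set n \<theta> - {i}"
  have J: "J \<subseteq> {1..n} - {i}" "finite J" by (auto simp: J_def)
  define E where "E = {e \<in> {1..n} \<rightarrow>\<^sub>E UNIV. ?\<phi> (observe n \<theta> e) i \<noteq> 0}"
  define B where "B = {e \<in> {1..n} \<rightarrow>\<^sub>E UNIV. e i \<in> {y. ?c y < v}}"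
  define F where "F y e = (if v \<le> ?c y then ennreal (2 ^ (s + 1)) * (\<Prod>j\<in>J. ennreal (weight_ratio (?c y) (e j))) else 0)"
    for y and e :: "nat \<Rightarrow> real"
  have mE: "E \<in> events"
    unfolding E_def by (intro sets_observe sets_reject procedure_measurable n i)
  have mB: "B \<in> events"
  proof -
    have "{e \<in> space (noise n). ?c (e i) < v} \<in> events" by measurable
    then show ?thesis by (simp add: B_def)
  qed
  have cnn: "0 \<le> ?c y" "?c y \<le> 1" for y using critical_weight_bounds[OF rho_pos, of y] by auto
  have wr_meas [measurable]: "weight_ratio a \<in> borel_measurable borel" for a
    unfolding weight_ratio_def[abs_def] by measurable
  have mF: "(\<lambda>e. F (e i) e) \<in> borel_measurable (noise n)"
  proof -
    have "(\<lambda>e. ennreal (weight_ratio (?c (e i)) (e j))) \<in> borel_measurable (noise n)" for j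
      unfolding weight_ratio_def by measurable
    then have "(\<lambda>e. \<Prod>j\<in>J. ennreal (weight_ratio (?c (e i)) (e j))) \<in> borel_measurable (noise n)"
      by (intro borel_measurable_prod_ennreal)
    moreover have "{e \<in> space (noise n). v \<le> ?c (e i)} \<in> events" by measurable
    ultimately show ?thesis unfolding F_def
      by (intro measurable_If borel_measurable_times_ennreal borel_measurable_const) auto
  qed
  have pointwise: "indicator E e \<le> indicator B e + F (e i) e" for e
  proof (cases "e \<in> E \<and> e \<notin> B")
    case True
    define x where "x = observe n \<theta> e"
    let ?v = "?c (e i)"
    have xi: "x i = e i" using i by (simp add: x_def)
    have ge: "v \<le> ?v" using True by (auto simp: B_def E_def)
    have less: "?v < w n x" using True xi reject_iff[OF i(1), of x] by (simp add: E_def x_def del: neq0_conv)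
    have "1 \<le> (\<Prod>j\<in>{1..n}. weight_ratio ?v (x j))"
      by (rule weight_ratio_prod_ge_1[OF n order_trans[OF v ge] less])
    also have "\<dots> = (\<Prod>j\<in>{1..n} - J. weight_ratio ?v (x j)) * (\<Prod>j\<in>J. weight_ratio ?v (x j))"
      by (rule prod.subset_diff) (use J in auto)
    also have "(\<Prod>j\<in>J. weight_ratio ?v (x j)) = (\<Prod>j\<in>J. weight_ratio ?v (e j))"
      by (intro prod.cong) (auto simp: J_def signal_set_def x_def)
    also have "(\<Prod>j\<in>{1..n} - J. weight_ratio ?v (x j)) * (\<Prod>j\<in>J. weight_ratio ?v (e j))
        \<le> 2 ^ (s + 1) * (\<Prod>j\<in>J. weight_ratio ?v (e j))"
    proof (rule mult_right_mono)
      have "(\<Prod>j\<in>{1..n} - J. weight_ratio ?v (x j)) \<le> (\<Prod>j\<in>{1..n} - J. 2)"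
        using weight_ratio_bounds[OF cnn] by (intro prod_mono) auto
      also have "\<dots> = 2 ^ card ({1..n} - J)" by simp
      also have "\<dots> \<le> 2 ^ (s + 1)"
      proof (rule power_increasing)
        have "card ({1..n} - J) \<le> card (insert i (signal_set n \<theta>))"
          by (rule card_mono) (auto simp: J_def)
        also have "\<dots> \<le> Suc (card (signal_set n \<theta>))" by (rule card_insert_le_m1) auto
        finally show "card ({1..n} - J) \<le> s + 1" using card_S by simp
      qed simp
      finally show "(\<Prod>j\<in>{1..n} - J. weight_ratio ?v (x j)) \<le> 2 ^ (s + 1)" .
    qed (use weight_ratio_bounds[OF cnn] in \<open>auto intro!: prod_nonneg\<close>)
    finally have "1 \<le> 2 ^ (s + 1) * (\<Prod>j\<in>J. weight_ratio ?v (e j))" .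
    then have "ennreal 1 \<le> ennreal (2 ^ (s + 1) * (\<Prod>j\<in>J. weight_ratio ?v (e j)))" by (rule ennreal_leI)
    also have "\<dots> = F (e i) e"
      using ge weight_ratio_bounds(1)[OF cnn] by (simp add: F_def ennreal_mult prod_ennreal prod_nonneg del: power_Suc)
    finally show ?thesis using True by simp
  qed (auto simp: indicator_def)
  have inner: "(\<integral>\<^sup>+e. F y e \<partial>(\<Pi>\<^sub>M j\<in>{1..n} - {i}. std_gauss)) \<le> ennreal (8 / (v * K\<^sup>2)) * ennreal (1 / ?c y)" for y
  proof (cases "v \<le> ?c y")
    case False
    then show ?thesis by (simp add: F_def)
  next
    case True
    let ?v = "?c y"
    have c0: "0 < ?v" using critical_weight_bounds[OF rho_pos, of y] by simp
    have "0 < slab_beta T" using T v0 by (metis less_le_trans zero_less_mult_pos zero_less_numeral)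
    then have "v * slab_beta T \<le> ?v * slab_beta T" using True by (intro mult_right_mono) auto
    then have large: "2 \<le> ?v * slab_beta T" using T(2) by linarith
    have "(\<integral>\<^sup>+e. F y e \<partial>(\<Pi>\<^sub>M j\<in>{1..n} - {i}. std_gauss))
        = ennreal (2 ^ (s + 1)) * (\<Prod>j\<in>J. \<integral>\<^sup>+z. ennreal (weight_ratio ?v z) \<partial>std_gauss)"
    proof -
      have "(\<lambda>e. \<Prod>j\<in>J. ennreal (weight_ratio ?v (e j))) \<in> borel_measurable (\<Pi>\<^sub>M j\<in>{1..n} - {i}. std_gauss)"
      proof (rule borel_measurable_prod_ennreal)
        fix j assume "j \<in> J"
        then have "(\<lambda>e. e j) \<in> measurable (\<Pi>\<^sub>M j\<in>{1..n} - {i}. std_gauss) std_gauss"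
          using J by (intro measurable_component_singleton) auto
        from measurable_compose[OF this] show "(\<lambda>e. ennreal (weight_ratio ?v (e j))) \<in> borel_measurable (\<Pi>\<^sub>M j\<in>{1..n} - {i}. std_gauss)"
          by (rule measurable_compose) measurable
      qed
      then show ?thesis
        unfolding F_def using True J
        by (simp add: nn_integral_cmult nn_integral_gauss_prod[of _ _ "\<lambda>_ z. ennreal (weight_ratio ?v z)"] del: prod_constant power_Suc)
    qed
    also have "\<dots> \<le> ennreal (2 ^ (s + 1)) * (\<Prod>j\<in>J. ennreal (exp (- (?v / (192 * T)))))"
      by (intro mult_left_mono prod_mono_ennreal nn_integral_weight_ratio c0 cnn T large) auto
    also have "\<dots> = ennreal (2 ^ (s + 1) * exp (- (?v / (192 * T))) ^ card J)"
      by (simp add: ennreal_mult ennreal_power del: power_Suc)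
    also have "\<dots> \<le> ennreal (8 / (v * K\<^sup>2) * (1 / ?v))"
    proof (rule ennreal_leI)
      have "(2::real) ^ (s + 1) \<le> exp 1 ^ (s + 1)"
        using exp_ge_add_one_self[of "1::real"] by (intro power_mono) auto
      also have "\<dots> = exp (real (s + 1))" by (simp only: exp_of_nat_mult[symmetric] mult_1_right)
      also have "\<dots> \<le> exp (?v * K / 2)"
      proof (rule iffD2[OF exp_le_cancel_iff])
        have "v * K / 2 \<le> ?v * K / 2" using True K0 by (intro divide_right_mono mult_right_mono) auto
        then show "real (s + 1) \<le> ?v * K / 2" using sK by simp
      qed
      finally have two: "(2::real) ^ (s + 1) \<le> exp (?v * K / 2)" .
      have cardJ: "n \<le> 2 * card J"
      proof -
        have "{1..n} = J \<union> insert i (signal_set n \<theta>)"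
          using i signal_set_subset[of n \<theta>] by (auto simp: J_def)
        then have "card {1..n} \<le> card J + card (insert i (signal_set n \<theta>))"
          by (metis card_Un_le)
        also have "card (insert i (signal_set n \<theta>)) \<le> Suc (card (signal_set n \<theta>))"
          by (rule card_insert_le_m1) auto
        finally show ?thesis using card_S sn by simp
      qed
      have "exp (- (?v / (192 * T))) ^ card J = exp (real (card J) * (- (?v / (192 * T))))"
        by (rule exp_of_nat_mult[symmetric])
      also have "\<dots> \<le> exp (- (?v * K))"
      proof (rule iffD2[OF exp_le_cancel_iff])
        have "?v * K = real n / 2 * (?v / (192 * T))" by (simp add: K)
        also have "\<dots> \<le> real (card J) * (?v / (192 * T))"
          using cardJ c0 T by (intro mult_right_mono) auto
        finally show "real (card J) * (- (?v / (192 * T))) \<le> - (?v * K)" by simp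
      qed
      finally have "2 ^ (s + 1) * exp (- (?v / (192 * T))) ^ card J \<le> exp (?v * K / 2) * exp (- (?v * K))"
        using two by (intro mult_mono) auto
      also have "\<dots> = exp (- (?v * K / 2))" by (simp flip: exp_add)
      \<comment> \<open>A quadratic decay in c suffices: one factor 1/c is bounded through v \<le>
        c, and the other is kept because it is integrable under the null law.\<close>
      also have "\<dots> \<le> 2 / (?v * K / 2)\<^sup>2"
      proof -
        have z: "0 < ?v * K / 2" using c0 K0 by simp
        then have "(?v * K / 2)\<^sup>2 / 2 \<le> exp (?v * K / 2)"
          using exp_lower_Taylor_quadratic[of "?v * K / 2"] by linarith
        then show ?thesis using z c0 K0 by (simp add: exp_minus field_simps)
      qed
      also have "\<dots> = 8 / (?v * K\<^sup>2) * (1 / ?v)" by (simp add: power2_eq_square)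
      also have "\<dots> \<le> 8 / (v * K\<^sup>2) * (1 / ?v)"
        using True v0 c0 K0 by (intro mult_right_mono divide_left_mono) auto
      finally show "2 ^ (s + 1) * exp (- (?v / (192 * T))) ^ card J \<le> 8 / (v * K\<^sup>2) * (1 / ?v)" .
    qed
    also have "\<dots> = ennreal (8 / (v * K\<^sup>2)) * ennreal (1 / ?v)"
      using v0 c0 by (intro ennreal_mult) auto
    finally show ?thesis .
  qed
  have "ennreal (reject_prob n \<theta> ?\<phi> i) = emeasure (noise n) E"
    unfolding reject_prob_def E_def
    by (subst measure_obs_law) (auto intro!: sets_reject procedure_measurable n i simp: emeasure_eq_measure simp del: neq0_conv)
  also have "\<dots> = (\<integral>\<^sup>+e. indicator E e \<partial>noise n)" by (simp add: mE)
  also have "\<dots> \<le> (\<integral>\<^sup>+e. indicator B e + F (e i) e \<partial>noise n)"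
    by (intro nn_integral_mono pointwise)
  also have "\<dots> = emeasure (noise n) B + (\<integral>\<^sup>+e. F (e i) e \<partial>noise n)"
    using mB mF by (subst nn_integral_add) auto
  \<comment> \<open>Coordinate \<open>i\<close> is integrated last, so that inside the inner
    integral the critical weight is a constant.\<close>
  also have "(\<integral>\<^sup>+e. F (e i) e \<partial>noise n)
      = (\<integral>\<^sup>+y. (\<integral>\<^sup>+e. F ((e(i := y)) i) (e(i := y)) \<partial>(\<Pi>\<^sub>M j\<in>{1..n} - {i}. std_gauss)) \<partial>std_gauss)"
  proof -
    have ins: "insert i ({1..n} - {i}) = {1..n}" using i by auto
    have "(\<lambda>e. F (e i) e) \<in> borel_measurable (\<Pi>\<^sub>M j\<in>insert i ({1..n} - {i}). std_gauss)"
      using mF unfolding ins noise_def .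
    from gauss_product.product_nn_integral_insert_rev[OF _ _ this] show ?thesis
      unfolding ins noise_def by simp
  qed
  also have "\<dots> = (\<integral>\<^sup>+y. (\<integral>\<^sup>+e. F y e \<partial>(\<Pi>\<^sub>M j\<in>{1..n} - {i}. std_gauss)) \<partial>std_gauss)"
  proof -
    have "F ((e(i := y)) i) (e(i := y)) = F y e" for e y
    proof -
      have "(\<Prod>j\<in>J. ennreal (weight_ratio (?c y) ((e(i := y)) j))) = (\<Prod>j\<in>J. ennreal (weight_ratio (?c y) (e j)))"
        by (intro prod.cong) (auto simp: J_def)
      then show ?thesis by (simp add: F_def)
    qed
    then show ?thesis by simp
  qed
  also have "\<dots> \<le> (\<integral>\<^sup>+y. ennreal (8 / (v * K\<^sup>2)) * ennreal (1 / ?c y) \<partial>std_gauss)"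
    by (intro nn_integral_mono inner)
  \<comment> \<open>The reciprocal critical weight is 1 plus the slab ratio over \<rho>, and the
    slab ratio integrates under the null law to the mass of the slab.\<close>
  also have "\<dots> = ennreal (8 / (v * K\<^sup>2)) * (\<integral>\<^sup>+y. ennreal 1 + ennreal (1 / \<rho>) * ennreal (slab_ratio y) \<partial>std_gauss)"
  proof -
    have "ennreal (1 / ?c y) = ennreal 1 + ennreal (1 / \<rho>) * ennreal (slab_ratio y)" for y
    proof -
      have "1 / ?c y = 1 + 1 / \<rho> * slab_ratio y"
        using rho_pos slab_ratio_ge_half[of y] by (simp add: critical_weight_def field_simps)
      then show ?thesis
        using rho_pos slab_ratio_nonneg[of y]
        by (simp add: ennreal_mult[symmetric] ennreal_plus[symmetric] del: ennreal_plus ennreal_1)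
    qed
    then show ?thesis by (subst nn_integral_cmult[symmetric]) (auto intro!: nn_integral_cong)
  qed
  also have "(\<integral>\<^sup>+y. ennreal 1 + ennreal (1 / \<rho>) * ennreal (slab_ratio y) \<partial>std_gauss)
      = ennreal 1 + ennreal (1 / \<rho>) * (\<integral>\<^sup>+y. ennreal (slab_ratio y) \<partial>std_gauss)"
    using std_gauss.emeasure_space_1 by (subst nn_integral_add) (auto simp: nn_integral_cmult)
  also have "\<dots> \<le> ennreal 1 + ennreal (1 / \<rho>) * 1"
    by (intro add_left_mono mult_left_mono nn_integral_slab_ratio) auto
  also have "\<dots> = ennreal (1 + 1 / \<rho>)" using rho_pos by (simp add: ennreal_plus[symmetric] del: ennreal_plus ennreal_1)
  also have "emeasure (noise n) B = ennreal (measure std_gauss {y. ?c y < v})"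
    unfolding B_def by (subst measure_noise_component[OF i(1), symmetric]) (auto simp: emeasure_eq_measure)
  finally have "ennreal (reject_prob n \<theta> ?\<phi> i)
      \<le> ennreal (measure std_gauss {y. ?c y < v}) + ennreal (8 / (v * K\<^sup>2)) * ennreal (1 + 1 / \<rho>)"
    by (simp add: add_left_mono mult_left_mono)
  also have "\<dots> = ennreal (measure std_gauss {y. ?c y < v} + 8 / (v * K\<^sup>2) * (1 + 1 / \<rho>))"
    using rho_pos v0 by (simp add: ennreal_mult[symmetric] ennreal_plus[symmetric] del: ennreal_plus)
  finally show ?thesis using rho_pos v0 by (subst (asm) ennreal_le_iff) auto
qed

text \<open>The critical weight decreases in \<open>\<bar>y\<bar>\<close>, so a small one means a
  two-sided tail event.\<close>

lemma critical_weight_tail: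
  assumes "0 < T" "v * (\<rho> + slab_ratio T) \<le> \<rho>" "0 < v"
  shows "measure std_gauss {y. critical_weight \<rho> y < v} \<le> exp (- T\<^sup>2 / 2) / T"
proof -
  have "T \<le> \<bar>y\<bar>" if "critical_weight \<rho> y < v" for y
  proof (rule ccontr)
    assume "\<not> T \<le> \<bar>y\<bar>"
    then have "slab_ratio y \<le> slab_ratio T" using assms(1) by (intro slab_ratio_mono) auto
    then have "v * (\<rho> + slab_ratio y) \<le> v * (\<rho> + slab_ratio T)" using assms(3) by (intro mult_left_mono) auto
    then show False using that assms(2) by (simp add: critical_weight_less_iff[OF rho_pos])
  qed
  then have "measure std_gauss {y. critical_weight \<rho> y < v} \<le> measure std_gauss {y. T \<le> \<bar>y\<bar>}"
    by (intro std_gauss.finite_measure_mono) auto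
  also have "\<dots> \<le> exp (- T\<^sup>2 / 2) / T"
    using Mills_exp[OF assms(1)] by (simp add: gauss_two_sided[OF assms(1)])
  finally show ?thesis .
qed

text \<open>The cutoff v = tau^2 s_n/n balances two demands. It makes v K of order s_n tau, which
  beats the factor 2^(s_n+1); and a critical weight below v needs an observation beyond sqrt(tau^2 -
  2C), which has null probability of order (s_n/n)/tau.\<close>

lemma adaptive:
  assumes s_inf: "filterlim s at_top sequentially"
    and sparse: "filterlim (\<lambda>n. real n / real (s n)) at_top sequentially"
  shows "adaptive_procedure s (ell_procedure w t)"
proof
  have s_pos: "\<forall>\<^sub>F n in sequentially. 0 < s n"
    using s_inf eventually_gt_at_top[of 0] by (auto simp: filterlim_iff)
  have n_pos: "\<forall>\<^sub>F n in sequentially. 1 \<le> (n::nat)" by (rule eventually_ge_at_top)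
  define \<tau> where "\<tau> n = signal_bound n (s n) 0" for n
  have \<tau>_inf: "filterlim \<tau> at_top sequentially"
    unfolding \<tau>_def by (rule signal_bound_at_top[OF sparse])
  have \<tau>_ev: "\<forall>\<^sub>F n in sequentially. P (\<tau> n)" if "\<forall>\<^sub>F x in at_top. P x" for P
    using that \<tau>_inf by (rule eventually_compose_filterlim)
  have s_ev: "\<forall>\<^sub>F n in sequentially. a \<le> real (s n)" for a
    using filterlim_compose[OF filterlim_real_sequentially s_inf] by (simp add: filterlim_at_top)
  have ns_ev: "\<forall>\<^sub>F n in sequentially. a \<le> real n / real (s n)" for a
    using sparse by (simp add: filterlim_at_top)
  have \<tau>_exp: "exp ((\<tau> n)\<^sup>2 / 2) = real n / real (s n)" if "1 \<le> real n / real (s n)" for n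
    using that by (simp add: \<tau>_def signal_bound_def)
  show "\<forall>\<^sub>F n in sequentially. ell_procedure w t n \<in> procedures n"
    using n_pos by eventually_elim (rule procedure_measurable)
  {
    fix \<eta> :: real assume \<eta>: "0 < \<eta>"
    \<comment> \<open>Chosen so that the limit exp(-C) in \<open>a2\<close> equals \<rho>/2,
      strictly below \<rho>.\<close>
    define C where "C = ln (2 / \<rho>)"
    \<comment> \<open>Since v K^2 = s_n n/768^2, this is the size of s_n at which the remainder
      drops below \<eta>/(2n).\<close>
    define C' where "C' = 16 * (1 + 1 / \<rho>) * 768\<^sup>2 / \<eta>"
    \<comment> \<open>The mean of the null factors is estimated from 2 tau on: there the slab ratio
      far exceeds 1/v, at the price of a mere factor 2 in K.\<close>
    have a1: "\<forall>\<^sub>F x::real in at_top. 2 \<le> x\<^sup>2 * exp (- (x\<^sup>2 / 2)) * ((exp ((2 * x)\<^sup>2 / 2) - 1) / (2 * x)\<^sup>2 - 1)"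
      by real_asymp
    have a2: "\<forall>\<^sub>F x in at_top. x\<^sup>2 * exp (- (x\<^sup>2 / 2)) * (\<rho> + (exp ((x\<^sup>2 - 2 * C) / 2) - 1) / (x\<^sup>2 - 2 * C)) < \<rho>"
    proof (rule order_tendstoD(2))
      show "((\<lambda>x. x\<^sup>2 * exp (- (x\<^sup>2 / 2)) * (\<rho> + (exp ((x\<^sup>2 - 2 * C) / 2) - 1) / (x\<^sup>2 - 2 * C))) \<longlongrightarrow> exp (- C)) at_top"
        by real_asymp
      show "exp (- C) < \<rho>" using rho_pos by (simp add: C_def exp_minus)
    qed
    have a3: "\<forall>\<^sub>F x in at_top. exp C * 2 / \<eta> \<le> sqrt (x\<^sup>2 - 2 * C)"
    proof -
      have "filterlim (\<lambda>x::real. sqrt (x\<^sup>2 - 2 * C)) at_top at_top" by real_asymp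
      then show ?thesis unfolding filterlim_at_top by (rule spec)
    qed
    \<comment> \<open>With v K/2 = s_n tau/1536, twice 1536 ensures v K/2 \<ge> 2 s_n \<ge> s_n +
      1.\<close>
    have a4: "\<forall>\<^sub>F x in at_top. 3072 \<le> (x::real)" by (rule eventually_ge_at_top)
    show "\<forall>\<^sub>F n in sequentially. \<forall>\<theta>. card (signal_set n \<theta>) \<le> s n \<longrightarrow>
        false_positives n \<theta> (ell_procedure w t n) \<le> \<eta> * real (s n)"
      using \<tau>_ev[OF a1] \<tau>_ev[OF a2] \<tau>_ev[OF a3] \<tau>_ev[OF a4] s_ev[of "max 1 C'"] ns_ev[of 4] n_pos
    proof eventually_elim
      case (elim n)
      let ?x = "\<tau> n"
      have s1: "1 \<le> real (s n)" "C' \<le> real (s n)" using elim(5) by auto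
      have n: "0 < n" using elim(7) by simp
      have e: "exp (?x\<^sup>2 / 2) = real n / real (s n)" by (rule \<tau>_exp) (use elim(6) in linarith)
      have e': "exp (- (?x\<^sup>2 / 2)) = real (s n) / real n" using e by (simp add: exp_minus)
      define v where "v = ?x\<^sup>2 * exp (- (?x\<^sup>2 / 2))"
      have x0: "0 < ?x" "3072 \<le> ?x" using elim(4) by auto
      have v: "0 < v" using x0 by (simp add: v_def)
      have v_eq: "v = ?x\<^sup>2 * (real (s n) / real n)" unfolding v_def e' ..
      define T where "T = sqrt (?x\<^sup>2 - 2 * C)"
      have "0 < exp C * 2 / \<eta>" using \<eta> by simp
      then have T0: "0 < T" using elim(3) unfolding T_def by linarith
      then have T2: "T\<^sup>2 = ?x\<^sup>2 - 2 * C" by (simp add: T_def)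
      define K where "K = n / (384 * (2 * ?x))"
      have "reject_prob n \<theta> (ell_procedure w t n) i \<le> s n / n * \<eta>"
        if S: "card (signal_set n \<theta>) \<le> s n" and i: "i \<in> {1..n} - signal_set n \<theta>" for \<theta> i
      proof -
        have "reject_prob n \<theta> (ell_procedure w t n) i
          \<le> measure std_gauss {y. critical_weight \<rho> y < v} + 8 * (1 + 1 / \<rho>) / (v * K\<^sup>2)"
        proof (rule null_rejection_bound[OF _ _ S])
          show "i \<in> {1..n}" "\<theta> i = 0" using i by (auto simp: signal_set_def)
          have "2 \<le> ?x\<^sup>2" using x0 mult_mono[of 2 ?x 1 ?x] by (simp add: power2_eq_square)
          then have "2 * 1 \<le> ?x\<^sup>2 * real (s n)" using s1 by (intro mult_mono) auto
          then show "2 / real n \<le> v" using n by (simp add: v_def e' divide_right_mono)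
          show "2 \<le> 2 * ?x" using x0 by simp
          show "2 \<le> v * slab_beta (2 * ?x)"
            using elim(1) x0 by (simp add: v_def slab_beta_eq slab_ratio_nz)
          show "K = n / (384 * (2 * ?x))" by (rule K_def)
          have "4 * real (s n) \<le> n" using elim(6) s1 by (simp add: field_simps)
          then have "real (2 * (s n + 1)) \<le> real n" using s1 by simp
          then show "2 * (s n + 1) \<le> n" by (simp only: of_nat_le_iff)
          have "v * K / 2 = real (s n) * ?x / 1536"
            using n x0 by (simp add: v_eq K_def power2_eq_square)
          moreover have "real (s n) * 3072 \<le> real (s n) * ?x" using x0 by (intro mult_left_mono) auto
          ultimately show "real (s n + 1) \<le> v * K / 2"
            using s1(1) by (simp only: of_nat_add of_nat_1)
        qed
        also have "\<dots> \<le> s n / n * (\<eta> / 2) + s n / n * (\<eta> / 2)"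
        proof (rule add_mono)
          have "measure std_gauss {y. critical_weight \<rho> y < v} \<le> exp (- T\<^sup>2 / 2) / T"
          proof (rule critical_weight_tail[OF T0 _ v])
            have "v * (\<rho> + slab_ratio T) < \<rho>"
              using elim(2) T0 by (simp add: v_def slab_ratio_nz T2)
            then show "v * (\<rho> + slab_ratio T) \<le> \<rho>" by simp
          qed
          also have "exp (- T\<^sup>2 / 2) = exp (- (?x\<^sup>2 / 2)) * exp C"
            by (simp add: T2 field_simps flip: exp_add)
          also have "exp (- (?x\<^sup>2 / 2)) * exp C / T = s n / n * (exp C / T)" by (simp add: e')
          also have "\<dots> \<le> s n / n * (\<eta> / 2)"
          proof (rule mult_left_mono)
            show "exp C / T \<le> \<eta> / 2"
              using elim(3) T0 \<eta> unfolding T_def[symmetric] by (simp add: field_simps)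
          qed simp
          finally show "measure std_gauss {y. critical_weight \<rho> y < v} \<le> s n / n * (\<eta> / 2)" .
          have "C' * \<eta> \<le> real (s n) * \<eta>" using s1 \<eta> by (intro mult_right_mono) auto
          then have c': "16 * (1 + 1 / \<rho>) * 768\<^sup>2 \<le> real (s n) * \<eta>" using \<eta> by (simp add: C'_def)
          have "v * K\<^sup>2 = real (s n) * n / 768\<^sup>2"
            using n x0 by (simp add: v_eq K_def power2_eq_square field_simps)
          then have "8 * (1 + 1 / \<rho>) / (v * K\<^sup>2) = 8 * (1 + 1 / \<rho>) / (real (s n) * n / 768\<^sup>2)"
            by (simp only:)
          also have "\<dots> = 16 * (1 + 1 / \<rho>) * 768\<^sup>2 / (2 * (real (s n) * n))"
          proof -
            have "8 * a / (b / c) = 16 * a * c / (2 * b)" for a b c :: real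
              by (cases "b = 0"; cases "c = 0") (auto simp: field_simps)
            then show ?thesis .
          qed
          also have "\<dots> \<le> real (s n) * \<eta> / (2 * (real (s n) * n))"
            by (rule divide_right_mono[OF c']) simp
          also have "\<dots> = 1 / n * (\<eta> / 2)" using s1 by simp
          also have "\<dots> \<le> s n / n * (\<eta> / 2)" using s1 \<eta> by (intro mult_right_mono divide_right_mono) auto
          finally show "8 * (1 + 1 / \<rho>) / (v * K\<^sup>2) \<le> s n / n * (\<eta> / 2)" .
        qed
        also have "\<dots> = s n / n * \<eta>" by simp
        finally show ?thesis .
      qed
      then have "false_positives n \<theta> (ell_procedure w t n) \<le> card ({1..n} - signal_set n \<theta>) * (s n / n * \<eta>)"
        if "card (signal_set n \<theta>) \<le> s n" for \<theta>
        unfolding false_positives_def using that by (intro sum_bounded_above) auto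
      moreover have "card ({1..n} - signal_set n \<theta>) * (s n / n * \<eta>) \<le> \<eta> * s n" for \<theta>
      proof -
        have "real (card ({1..n} - signal_set n \<theta>)) \<le> real (card {1..n})"
          by (intro of_nat_mono card_mono) auto
        then have "card ({1..n} - signal_set n \<theta>) * (s n / n * \<eta>) \<le> n * (s n / n * \<eta>)"
          using \<eta> by (intro mult_right_mono) auto
        then show ?thesis using n by (simp add: mult.commute)
      qed
      ultimately show ?case by (meson order_trans)
    qed
  next
    fix \<kappa> \<epsilon> :: real assume \<kappa>: "0 < \<kappa>" and \<epsilon>: "0 < \<epsilon>"
    \<comment> \<open>Large enough to meet both slab-ratio requirements of
      \<open>detect_fixed\<close> at once. The ratio at tau + \<epsilon> exceeds n/s_n by
      exp(\<epsilon> tau) up to a polynomial, hence by any constant.\<close>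
    define A where "A = 2 + 4 / \<kappa> + \<rho> * (4 / \<kappa>)"
    have lim: "\<forall>\<^sub>F x in at_top. A \<le> (exp ((x + \<epsilon>)\<^sup>2 / 2) - 1) / (x + \<epsilon>)\<^sup>2 / exp (x\<^sup>2 / 2)"
    proof -
      have "filterlim (\<lambda>x. (exp ((x + \<epsilon>)\<^sup>2 / 2) - 1) / (x + \<epsilon>)\<^sup>2 / exp (x\<^sup>2 / 2)) at_top at_top"
        using \<epsilon> by real_asymp
      then show ?thesis unfolding filterlim_at_top by (rule spec)
    qed
    show "\<forall>\<^sub>F n in sequentially. \<forall>x. \<kappa> * real (s n) \<le> real (card {i \<in> {1..n}. signal_bound n (s n) \<epsilon> \<le> \<bar>x i\<bar>}) \<longrightarrow>
        (\<forall>i\<in>{1..n}. signal_bound n (s n) \<epsilon> \<le> \<bar>x i\<bar> \<longrightarrow> ell_procedure w t n x i \<noteq> 0)"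
      using \<tau>_ev[OF lim] \<tau>_ev[OF eventually_ge_at_top[of 0]] ns_ev[of 1] s_ev[of "4 / \<kappa>"]
    proof eventually_elim
      case (elim n)
      define T where "T = signal_bound n (s n) \<epsilon>"
      have T: "T = \<tau> n + \<epsilon>" by (simp add: T_def \<tau>_def signal_bound_def)
      have T0: "0 < T" using elim(2) \<epsilon> by (simp add: T)
      define R where "R = real n / real (s n)"
      have R: "1 \<le> R" using elim(3) by (simp add: R_def)
      have "A \<le> slab_ratio T / R"
        using elim(1) T0 \<tau>_exp[OF elim(3)] by (simp add: T slab_ratio_nz R_def)
      then have AR: "A * R \<le> slab_ratio T" using R by (simp add: pos_le_divide_eq)
      have eq: "4 * real n / (\<kappa> * real (s n)) = 4 / \<kappa> * R" by (simp add: R_def)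
      have pos: "0 \<le> 4 / \<kappa> * R" "0 \<le> \<rho> * (4 / \<kappa> * R)" using \<kappa> R rho_pos by auto
      have split: "A * R = 2 * R + 4 / \<kappa> * R + \<rho> * (4 / \<kappa> * R)" by (simp add: A_def algebra_simps)
      show ?case unfolding T_def[symmetric]
      proof (intro allI impI ballI)
        fix x i assume a: "\<kappa> * real (s n) \<le> real (card {i \<in> {1..n}. T \<le> \<bar>x i\<bar>})" "i \<in> {1..n}" "T \<le> \<bar>x i\<bar>"
        show "ell_procedure w t n x i \<noteq> 0"
        proof (rule detect_fixed[OF \<kappa> _ _ _ _ a])
          show "4 \<le> \<kappa> * real (s n)" using elim(4) \<kappa> by (simp add: field_simps)
          show "1 + 4 * real n / (\<kappa> * real (s n)) \<le> slab_ratio T"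
            unfolding eq using AR split pos R by linarith
          show "\<rho> * (4 * real n / (\<kappa> * real (s n))) < slab_ratio T"
            unfolding eq using AR split pos R by linarith
        qed (use T0 in simp)
      qed
    qed
  }
qed (use assms in auto)

end

subsection \<open>Asymptotics of the risk\<close>

text \<open>Stated for an abstract \<open>R\<close> because it serves both the risk of one procedure
  and the minimax risk. For \<open>b\<close> tending to plus infinity the risk is squeezed between 0
  and its value at a fixed level; towards minus infinity, between its value at a fixed level and the
  uniform bound.\<close>

lemma tracks_Phi_bar:
  fixes R :: "nat \<Rightarrow> real \<Rightarrow> real"
  assumes lower: "\<And>c e. 0 < e \<Longrightarrow> \<forall>\<^sub>F n in sequentially. Phi_bar (ereal c) - e \<le> R n c"
    and upper: "\<And>c e. 0 < e \<Longrightarrow> \<forall>\<^sub>F n in sequentially. R n c \<le> Phi_bar (ereal c) + e"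
    and upper_1: "\<And>e. 0 < e \<Longrightarrow> \<forall>\<^sub>F n in sequentially. \<forall>c. R n c \<le> 1 + e"
    and nonneg: "\<forall>\<^sub>F n in sequentially. \<forall>c. 0 \<le> R n c"
    and antimono: "\<forall>\<^sub>F n in sequentially. \<forall>c d. c \<le> d \<longrightarrow> R n d \<le> R n c"
    and b: "(\<exists>c. \<forall>n. b n = c) \<or> filterlim b at_top sequentially \<or> filterlim b at_bot sequentially"
  shows "(\<lambda>n. R n (b n) - Phi_bar (ereal (b n))) \<in> o(\<lambda>_. 1)"
proof -
  have close: "\<forall>\<^sub>F n in sequentially. \<bar>R n (b n) - Phi_bar (ereal (b n))\<bar> \<le> e" if e: "0 < e" for e
  proof -
    have d: "0 < e / 2" using e by simp
    consider c where "\<And>n. b n = c" | "filterlim b at_top sequentially" | "filterlim b at_bot sequentially"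
      using b by blast
    then show ?thesis
    proof cases
      case 1
      show ?thesis using lower[OF e, of c] upper[OF e, of c] unfolding 1 by eventually_elim auto
    next
      case 2
      from eventually_happens[OF order_tendstoD(2)[OF Phi_bar_at_top d]]
      obtain c where c: "Phi_bar (ereal c) < e / 2" by auto
      have "\<forall>\<^sub>F n in sequentially. c \<le> b n" using 2 by (simp add: filterlim_at_top)
      then show ?thesis using upper[OF d, of c] nonneg antimono
      proof eventually_elim
        case (elim n)
        have "0 \<le> R n (b n)" "R n (b n) \<le> R n c" using elim by auto
        moreover have "Phi_bar (ereal (b n)) \<le> Phi_bar (ereal c)" using elim(1) by (intro Phi_bar_antimono) simp
        ultimately show ?case using elim(2) c Phi_bar_nonneg[of "ereal (b n)"] by linarith
      qed
    next
      case 3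
      have "1 - e / 2 < 1" using e by simp
      from eventually_happens[OF order_tendstoD(1)[OF Phi_bar_at_bot this]]
      obtain c where c: "1 - e / 2 < Phi_bar (ereal c)" by auto
      have "\<forall>\<^sub>F n in sequentially. b n \<le> c" using 3 by (simp add: filterlim_at_bot)
      then show ?thesis using lower[OF d, of c] upper_1[OF d] antimono
      proof eventually_elim
        case (elim n)
        have "R n (b n) \<le> 1 + e / 2" "R n c \<le> R n (b n)" using elim by auto
        moreover have "Phi_bar (ereal c) \<le> Phi_bar (ereal (b n))" using elim(1) by (intro Phi_bar_antimono) simp
        ultimately show ?case using elim(2) c Phi_bar_le_1[of "ereal (b n)"] by linarith
      qed
    qed
  qed
  have "(\<lambda>n. R n (b n) - Phi_bar (ereal (b n))) \<longlonglongrightarrow> 0"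
  proof (rule tendstoI)
    fix e :: real assume "0 < e"
    then have "0 < e / 2" by simp
    from close[OF this] show "\<forall>\<^sub>F n in sequentially. dist (R n (b n) - Phi_bar (ereal (b n))) 0 < e"
      by eventually_elim (use \<open>0 < e\<close> in \<open>auto simp: dist_real_def\<close>)
  qed
  then show ?thesis by (intro smalloI_tendsto) auto
qed

lemma (in adaptive_procedure) risk_asymptotics:
  assumes b: "(\<exists>c. \<forall>n. b n = c) \<or> filterlim b at_top sequentially \<or> filterlim b at_bot sequentially"
  shows "(\<lambda>n. sup_class_risk n (s n) (b n) (\<phi> n) - Phi_bar (ereal (b n))) \<in> o(\<lambda>_. 1)"
proof (rule tracks_Phi_bar[where R = "\<lambda>n c. sup_class_risk n (s n) c (\<phi> n)", OF _ sup_class_risk_le sup_class_risk_le_1 _ _ b])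
  show "\<forall>\<^sub>F n in sequentially. Phi_bar (ereal c) - e \<le> sup_class_risk n (s n) c (\<phi> n)" if "0 < e" for c e
    using minimax_lower_bound[OF s_inf sparse that, of c] procedure by eventually_elim blast
  show "\<forall>\<^sub>F n in sequentially. \<forall>c. 0 \<le> sup_class_risk n (s n) c (\<phi> n)"
    using procedure by eventually_elim (simp add: sup_class_risk_nonneg)
  show "\<forall>\<^sub>F n in sequentially. \<forall>c d. c \<le> d \<longrightarrow> sup_class_risk n (s n) d (\<phi> n) \<le> sup_class_risk n (s n) c (\<phi> n)"
    using procedure by eventually_elim (simp add: sup_class_risk_antimono)
qed

text \<open>Lower bounds pass to the infimum because they hold for every procedure; upper bounds are
  inherited from thresholding at the detection level.\<close>

lemma minimax_asymptotics:
  assumes s_inf: "filterlim s at_top sequentially"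
    and sparse: "filterlim (\<lambda>n. real n / real (s n)) at_top sequentially"
    and b: "(\<exists>c. \<forall>n. b n = c) \<or> filterlim b at_top sequentially \<or> filterlim b at_bot sequentially"
  shows "(\<lambda>n. (INF \<phi>\<in>procedures n. sup_class_risk n (s n) (b n) \<phi>) - Phi_bar (ereal (b n))) \<in> o(\<lambda>_. 1)"
proof -
  interpret adaptive_procedure s "\<lambda>n. threshold_procedure (signal_bound n (s n) 0) n"
    by (rule threshold_procedure_adaptive[OF s_inf sparse])
  have ne: "procedures n \<noteq> {}" for n using threshold_procedure_in_procedures by blast
  define R where "R n c = (INF \<phi>\<in>procedures n. sup_class_risk n (s n) c \<phi>)" for n c
  have R_le: "R n c \<le> sup_class_risk n (s n) c \<phi>" if "\<phi> \<in> procedures n" for n c \<phi>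
    unfolding R_def by (rule cINF_lower[OF bdd_below_sup_class_risk that])
  have R_ge: "a \<le> R n c" if "\<And>\<phi>. \<phi> \<in> procedures n \<Longrightarrow> a \<le> sup_class_risk n (s n) c \<phi>" for a n c
    unfolding R_def using ne that by (rule cINF_greatest)
  have thr: "R n c \<le> sup_class_risk n (s n) c (threshold_procedure (signal_bound n (s n) 0) n)" for n c
    by (rule R_le[OF threshold_procedure_in_procedures])
  have "(\<lambda>n. R n (b n) - Phi_bar (ereal (b n))) \<in> o(\<lambda>_. 1)"
  proof (rule tracks_Phi_bar[OF _ _ _ _ _ b])
    show "\<forall>\<^sub>F n in sequentially. Phi_bar (ereal c) - e \<le> R n c" if "0 < e" for c e
      using minimax_lower_bound[OF s_inf sparse that, of c] by eventually_elim (blast intro: R_ge)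
    show "\<forall>\<^sub>F n in sequentially. R n c \<le> Phi_bar (ereal c) + e" if "0 < e" for c e
      using sup_class_risk_le[OF that, of c] by eventually_elim (rule order_trans[OF thr])
    show "\<forall>\<^sub>F n in sequentially. \<forall>c. R n c \<le> 1 + e" if "0 < e" for e
      using sup_class_risk_le_1[OF that] by eventually_elim (blast intro: order_trans[OF thr])
    show "\<forall>\<^sub>F n in sequentially. \<forall>c. 0 \<le> R n c"
      by (intro always_eventually allI R_ge sup_class_risk_nonneg)
    show "\<forall>\<^sub>F n in sequentially. \<forall>c d. c \<le> d \<longrightarrow> R n d \<le> R n c"
      by (intro always_eventually allI impI R_ge) (blast intro: order_trans[OF R_le sup_class_risk_antimono])
  qed
  then show ?thesis by (simp only: R_def)
qed

theorem theorem7: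
  fixes s :: "nat \<Rightarrow> nat" and b :: "nat \<Rightarrow> real"
  assumes s_inf: "filterlim s at_top sequentially"
    and sparse: "filterlim (\<lambda>n. real n / real (s n)) at_top sequentially"
    and b: "(\<exists>c. \<forall>n. b n = c) \<or> filterlim b at_top sequentially \<or> filterlim b at_bot sequentially"
  shows "(\<lambda>n. (INF \<phi>\<in>procedures n. sup_class_risk n (s n) (b n) \<phi>) - Phi_bar (ereal (b n)))
            \<in> o(\<lambda>_. 1)
    \<and> (\<forall>(t::real) w. 0 < t \<and> t < 1 \<and> mml_weight w \<longrightarrow>
          (\<lambda>n. sup_class_risk n (s n) (b n) (ell_procedure w t n) - Phi_bar (ereal (b n)))
            \<in> o(\<lambda>_. 1))
    \<and> (\<forall>\<alpha> :: nat \<Rightarrow> real. (\<forall>n. 0 < \<alpha> n \<and> \<alpha> n < 1) \<and> \<alpha> \<in> o(\<lambda>_. 1)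
          \<and> (\<lambda>n. - ln (\<alpha> n)) \<in> o(\<lambda>n. sqrt (ln (real n)))
          \<and> (\<exists>c<1::real. (\<lambda>n. real (s n)) \<in> O(\<lambda>n. real n powr c)) \<longrightarrow>
          (\<lambda>n. sup_class_risk n (s n) (b n) (BH_procedure (\<alpha> n) n) - Phi_bar (ereal (b n)))
            \<in> o(\<lambda>_. 1))"
proof (intro conjI allI impI)
  show "(\<lambda>n. (INF \<phi>\<in>procedures n. sup_class_risk n (s n) (b n) \<phi>) - Phi_bar (ereal (b n))) \<in> o(\<lambda>_. 1)"
    by (rule minimax_asymptotics[OF assms])
next
  fix t :: real and w
  assume "0 < t \<and> t < 1 \<and> mml_weight w"
  then interpret mml w t "(1 - t) / t" by unfold_locales auto
  show "(\<lambda>n. sup_class_risk n (s n) (b n) (ell_procedure w t n) - Phi_bar (ereal (b n))) \<in> o(\<lambda>_. 1)"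
    by (rule adaptive_procedure.risk_asymptotics[OF adaptive[OF s_inf sparse] b])
next
  fix \<alpha> :: "nat \<Rightarrow> real"
  assume "(\<forall>n. 0 < \<alpha> n \<and> \<alpha> n < 1) \<and> \<alpha> \<in> o(\<lambda>_. 1)
          \<and> (\<lambda>n. - ln (\<alpha> n)) \<in> o(\<lambda>n. sqrt (ln (real n)))
          \<and> (\<exists>c<1::real. (\<lambda>n. real (s n)) \<in> O(\<lambda>n. real n powr c))"
  then have "adaptive_procedure s (\<lambda>n. BH_procedure (\<alpha> n) n)"
    using BH_adaptive[OF s_inf sparse, of \<alpha>] by blast
  then show "(\<lambda>n. sup_class_risk n (s n) (b n) (BH_procedure (\<alpha> n) n) - Phi_bar (ereal (b n))) \<in> o(\<lambda>_. 1)"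
    using b by (rule adaptive_procedure.risk_asymptotics)
qed

end
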